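(* Let $\Omega\subset\mathbb{R}^N$ be a bounded domain, $N\ge 1$. Let $1<q<r$. Then $\lambda_k(q)=\lambda_k(q;r)$ for all $k\in\mathbb{N}$.
   Context: $\|\cdot\|_s$ is the norm of $L^s(\Omega)$; $W^{1,s}=W^{1,s}(\Omega)$, and $W_0^{1,s}=W_0^{1,s}(\Omega)$ is equipped with the norm $\|\nabla u\|_s$. Krasnoselskii genus: for a symmetric subset $A=-A$ of a topological vector space $X$, $\gamma(A;X)=\inf\{k\in\mathbb{N}:\exists\, h\in C(A,\mathbb{R}^k\setminus\{0\}),\ h\text{ odd}\}$, continuity of $h$ being with respect to the topology of $X$; $\gamma(A;X)=+\infty$ if no such $h$ exists, and $\gamma(\emptyset;X)=0$. For $s>1$, $\Sigma_k(s)$ is the set of all symmetric $A\subset W_0^{1,s}\setminus\{0\}$ which are compact in $W_0^{1,s}$ and satisfy $\gamma(A;W_0^{1,s})\ge k$. Define $$\lambda_k(q)=\inf\Big\{\max_{u\in A}\frac{\|\nabla u\|_q^q}{\|u\|_q^q}: A\in\Sigma_k(q)\Big\},\qquad \lambda_k(q;r)=\inf\Big\{\sup_{u\in A}\frac{\|\nabla u\|_q^q}{\|u\|_q^q}: A\in\Sigma_k(r),\ A\subset W^{1,q}\Big\}.$$ (The constraint $A\subset W^{1,q}$ is automatic when $q<r$.) *)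

theory Defs
  imports "HOL-Analysis.Analysis" "HOL-Library.Extended_Nat" "HOL-Library.Extended_Real"
begin

section \<open>Test functions\<close>

definition grad :: "(real^'n \<Rightarrow> real) \<Rightarrow> real^'n \<Rightarrow> real^'n" where
  "grad f x = (\<chi> i. frechet_derivative f (at x) (axis i 1))"

fun C_k :: "nat \<Rightarrow> (real^'n \<Rightarrow> real) \<Rightarrow> bool" where
  "C_k 0 f \<longleftrightarrow> continuous_on UNIV f"
| "C_k (Suc m) f \<longleftrightarrow> f differentiable_on UNIV \<and> (\<forall>i. C_k m (\<lambda>x. grad f x $ i))"

definition test_functions :: "(real^'n) set \<Rightarrow> (real^'n \<Rightarrow> real) set" where
  "test_functions \<Omega> = {\<phi>. (\<forall>m. C_k m \<phi>) \<and>
     compact (closure {x. \<phi> x \<noteq> 0}) \<and> closure {x. \<phi> x \<noteq> 0} \<subseteq> \<Omega>}"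


section \<open>Lebesgue and Sobolev functions\<close>

definition L_space :: "(real^'n) set \<Rightarrow> real \<Rightarrow> (real^'n \<Rightarrow> 'b::euclidean_space) set" where
  "L_space \<Omega> s = {f. f \<in> borel_measurable (lebesgue_on \<Omega>) \<and>
     integrable (lebesgue_on \<Omega>) (\<lambda>x. norm (f x) powr s)}"

definition L_norm :: "(real^'n) set \<Rightarrow> real \<Rightarrow> (real^'n \<Rightarrow> 'b::euclidean_space) \<Rightarrow> real" where
  "L_norm \<Omega> s f = (LINT x|lebesgue_on \<Omega>. norm (f x) powr s) powr (1 / s)"

definition locally_integrable :: "(real^'n) set \<Rightarrow> (real^'n \<Rightarrow> 'b::euclidean_space) \<Rightarrow> bool" where
  "locally_integrable \<Omega> f \<longleftrightarrow> (\<forall>K. compact K \<and> K \<subseteq> \<Omega> \<longrightarrow> integrable (lebesgue_on K) f)"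

definition is_weak_gradient ::
    "(real^'n) set \<Rightarrow> (real^'n \<Rightarrow> real) \<Rightarrow> (real^'n \<Rightarrow> real^'n) \<Rightarrow> bool" where
  "is_weak_gradient \<Omega> u g \<longleftrightarrow>
     locally_integrable \<Omega> u \<and> locally_integrable \<Omega> g \<and>
     (\<forall>\<phi>\<in>test_functions \<Omega>. \<forall>i.
        (LINT x|lebesgue_on \<Omega>. u x * grad \<phi> x $ i) = - (LINT x|lebesgue_on \<Omega>. g x $ i * \<phi> x))"

text \<open>On an open set a weak gradient is unique up to null sets, so the choice below does not
  affect norms.\<close>

definition weak_gradient :: "(real^'n) set \<Rightarrow> (real^'n \<Rightarrow> real) \<Rightarrow> real^'n \<Rightarrow> real^'n" where
  "weak_gradient \<Omega> u = (SOME g. is_weak_gradient \<Omega> u g)"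


section \<open>Sobolev spaces\<close>

text \<open>As usual, elements of function spaces over \<open>\<Omega>\<close> are classes of measurable functions modulo
  equality almost everywhere in \<open>\<Omega>\<close>; values outside \<open>\<Omega>\<close> are irrelevant. The type and the classes
  do not depend on the exponent, so that spaces with different exponents can be compared by
  inclusion.\<close>

type_synonym 'n fclass = "(real^'n \<Rightarrow> real) set"

definition ae_class :: "(real^'n) set \<Rightarrow> (real^'n \<Rightarrow> real) \<Rightarrow> 'n fclass" where
  "ae_class \<Omega> u = {v. v \<in> borel_measurable (lebesgue_on \<Omega>) \<and> (AE x in lebesgue_on \<Omega>. v x = u x)}"

definition rep :: "'n fclass \<Rightarrow> real^'n \<Rightarrow> real" where
  "rep U = (SOME u. u \<in> U)"

definition zero_class :: "(real^'n) set \<Rightarrow> 'n fclass" where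
  "zero_class \<Omega> = ae_class \<Omega> (\<lambda>x. 0)"

definition minus_class :: "(real^'n) set \<Rightarrow> 'n fclass \<Rightarrow> 'n fclass \<Rightarrow> 'n fclass" where
  "minus_class \<Omega> U V = ae_class \<Omega> (\<lambda>x. rep U x - rep V x)"

definition uminus_class :: "(real^'n) set \<Rightarrow> 'n fclass \<Rightarrow> 'n fclass" where
  "uminus_class \<Omega> U = ae_class \<Omega> (\<lambda>x. - rep U x)"

definition fun_norm :: "(real^'n) set \<Rightarrow> real \<Rightarrow> 'n fclass \<Rightarrow> real" where
  "fun_norm \<Omega> s U = L_norm \<Omega> s (rep U)"

definition grad_norm :: "(real^'n) set \<Rightarrow> real \<Rightarrow> 'n fclass \<Rightarrow> real" where
  "grad_norm \<Omega> s U = L_norm \<Omega> s (weak_gradient \<Omega> (rep U))"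

definition W1 :: "(real^'n) set \<Rightarrow> real \<Rightarrow> 'n fclass set" where
  "W1 \<Omega> s = {ae_class \<Omega> u | u. u \<in> L_space \<Omega> s \<and> (\<exists>g\<in>L_space \<Omega> s. is_weak_gradient \<Omega> u g)}"

definition W1_norm :: "(real^'n) set \<Rightarrow> real \<Rightarrow> 'n fclass \<Rightarrow> real" where
  "W1_norm \<Omega> s U = (fun_norm \<Omega> s U powr s + grad_norm \<Omega> s U powr s) powr (1 / s)"

text \<open>The closure of the test functions in \<open>W1 \<Omega> s\<close>.\<close>

definition W1_0 :: "(real^'n) set \<Rightarrow> real \<Rightarrow> 'n fclass set" where
  "W1_0 \<Omega> s = {U \<in> W1 \<Omega> s. \<forall>\<epsilon>>0. \<exists>\<phi>\<in>test_functions \<Omega>.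
     W1_norm \<Omega> s (minus_class \<Omega> U (ae_class \<Omega> \<phi>)) < \<epsilon>}"

definition W1_0_topology :: "(real^'n) set \<Rightarrow> real \<Rightarrow> 'n fclass topology" where
  "W1_0_topology \<Omega> s =
     Metric_space.mtopology (W1_0 \<Omega> s) (\<lambda>U V. grad_norm \<Omega> s (minus_class \<Omega> U V))"


section \<open>Krasnoselskii genus and minimax values\<close>

text \<open>The parameter \<open>neg\<close> is the map \<open>x \<mapsto> -x\<close> of the space \<open>X\<close>. The infimum is taken in \<open>enat\<close>,
  hence is \<open>\<infinity>\<close> if there is no admissible \<open>h\<close>.\<close>

definition genus :: "'a topology \<Rightarrow> ('a \<Rightarrow> 'a) \<Rightarrow> 'a set \<Rightarrow> enat" where
  "genus X neg A = (if A = {} then 0 else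
     Inf {enat k | k. \<exists>h.
       continuous_map (subtopology X A) (subtopology (Euclidean_space k) (- {\<lambda>i. 0})) h \<and>
       (\<forall>u\<in>A. h (neg u) = (\<lambda>i. - h u i))})"

definition Sigma_k :: "(real^'n) set \<Rightarrow> nat \<Rightarrow> real \<Rightarrow> 'n fclass set set" where
  "Sigma_k \<Omega> k s = {A. A \<subseteq> W1_0 \<Omega> s - {zero_class \<Omega>} \<and> uminus_class \<Omega> ` A = A \<and>
     compactin (W1_0_topology \<Omega> s) A \<and>
     enat k \<le> genus (W1_0_topology \<Omega> s) (uminus_class \<Omega>) A}"

definition rayleigh :: "(real^'n) set \<Rightarrow> real \<Rightarrow> 'n fclass \<Rightarrow> real" where
  "rayleigh \<Omega> q U = grad_norm \<Omega> q U powr q / fun_norm \<Omega> q U powr q"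

text \<open>In the first definition the supremum is a maximum for nonempty \<open>A\<close>, since the Rayleigh
  quotient is continuous on the compact set \<open>A\<close>.\<close>

definition lambda_k :: "(real^'n) set \<Rightarrow> nat \<Rightarrow> real \<Rightarrow> ereal" where
  "lambda_k \<Omega> k q = (INF A\<in>Sigma_k \<Omega> k q. SUP U\<in>A. ereal (rayleigh \<Omega> q U))"

definition lambda_k2 :: "(real^'n) set \<Rightarrow> nat \<Rightarrow> real \<Rightarrow> real \<Rightarrow> ereal" where
  "lambda_k2 \<Omega> k q r =
     (INF A\<in>{A \<in> Sigma_k \<Omega> k r. A \<subseteq> W1 \<Omega> q}. SUP U\<in>A. ereal (rayleigh \<Omega> q U))"

end

theory Submission
  imports Defs
begin

text \<open>Both values are minimax values of the same Rayleigh quotient; only the families of admissible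
  sets differ.

  \<open>\<lambda>\<^sub>k(q) \<le> \<lambda>\<^sub>k(q;r)\<close>: since \<open>\<Omega>\<close> is bounded, the inclusion of \<open>W\<^sub>0\<^sup>1\<^sup>,\<^sup>r\<close> into \<open>W\<^sub>0\<^sup>1\<^sup>,\<^sup>q\<close> is continuous,
  and it is odd. A continuous odd map \<open>P\<close> preserves compactness and symmetry and does not decrease the
  genus, because an odd map on the image pulls back along \<open>P\<close> (\<open>genus_le_if_odd_continuous\<close>). So
  every set that is admissible for \<open>r\<close> is admissible for \<open>q\<close> (\<open>Sigma_k_mono\<close>).

  \<open>\<lambda>\<^sub>k(q;r) \<le> \<lambda>\<^sub>k(q)\<close>: let \<open>A\<close> be admissible for \<open>q\<close>. Test functions are dense in \<open>W\<^sub>0\<^sup>1\<^sup>,\<^sup>q\<close>, so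
  finitely many \<open>\<delta>\<close>-balls around test functions cover \<open>A\<close>. A partition of unity subordinate to these balls and to their
  reflections yields an odd continuous map \<open>P\<close> of \<open>A\<close> into the span of finitely many test functions
  which moves every point by at most \<open>\<delta>\<close> (\<open>exists_finite_rank_odd_approximation\<close>). In a
  finite-dimensional space it does not matter which exponent measures the distance, so \<open>P\<close> is
  continuous into \<open>W\<^sub>0\<^sup>1\<^sup>,\<^sup>r\<close> as well. Since \<open>A\<close> is compact and omits the zero class, the norm of
  \<open>L\<^sup>q\<close> is bounded below on \<open>A\<close> by a positive constant. Hence for small \<open>\<delta>\<close> the image \<open>P(A)\<close> omits the zero class, and
  its Rayleigh quotients exceed the supremum over \<open>A\<close> by as little as desired
  (\<open>lambda_k2_le_SUP\<close>).

  These arguments need \<open>\<parallel>\<nabla>u\<parallel>\<^sub>s\<close> to be a metric on \<open>W\<^sub>0\<^sup>1\<^sup>,\<^sup>s\<close> that controls the norm of \<open>L\<^sup>s\<close>. This rests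
  on three facts: weak gradients are unique up to null sets (by
  \<open>fundamental_lemma_calculus_of_variations\<close>), the Minkowski inequality \<open>L_norm_triangle\<close>, and the
  Poincare inequality \<open>poincare\<close>, which follows from integrating \<open>\<partial>\<^sub>i(x\<^sub>i \<bar>\<phi>\<bar>\<^sup>q)\<close>.\<close>

section \<open>Smooth functions\<close>

lemma grad_eqI:
  assumes "(f has_derivative f') (at x)"
  shows "grad f x $ i = f' (axis i 1)"
  using frechet_derivative_at[OF assms] by (simp add: grad_def)

lemma C_k_SucD:
  assumes "C_k (Suc m) f"
  shows "C_k m f"
  using assms
proof (induction m arbitrary: f)
  case 0
  then show ?case by (simp add: differentiable_imp_continuous_on)
next
  case (Suc m)
  have d: "f differentiable_on UNIV" and g: "\<And>i. C_k (Suc m) (\<lambda>x. grad f x $ i)"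
    using Suc.prems by auto
  have "\<And>i. C_k m (\<lambda>x. grad f x $ i)"
    using Suc.IH[OF g] .
  then show ?case using d by simp
qed

lemma linear_sum_scaleR:
  fixes f :: "'a::real_vector \<Rightarrow> real"
  assumes "linear f"
  shows "f (\<Sum>i\<in>I. c i *\<^sub>R v i) = (\<Sum>i\<in>I. c i * f (v i))"
  using assms by (simp add: linear_sum linear_cmul)

lemma C_k_Suc_has_derivative:
  assumes "C_k (Suc m) f"
  shows "(f has_derivative (\<lambda>h. h \<bullet> grad f x)) (at x)"
proof -
  have "f differentiable (at x)"
    using assms by (simp add: differentiable_on_def)
  then have D: "(f has_derivative frechet_derivative f (at x)) (at x)"
    by (simp add: frechet_derivative_works)
  then have lin: "linear (frechet_derivative f (at x))"
    by (rule has_derivative_linear)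
  have "frechet_derivative f (at x) h = h \<bullet> grad f x" for h
  proof -
    have "frechet_derivative f (at x) (\<Sum>i\<in>UNIV. (h $ i) *\<^sub>R axis i 1)
        = (\<Sum>i\<in>UNIV. h $ i * frechet_derivative f (at x) (axis i 1))"
      by (rule linear_sum_scaleR[OF lin])
    moreover have "(\<Sum>i\<in>UNIV. (h $ i) *\<^sub>R axis i 1) = h"
      using basis_expansion[of h] by (simp add: scalar_mult_eq_scaleR)
    ultimately show ?thesis by (simp add: inner_vec_def grad_def)
  qed
  then have "frechet_derivative f (at x) = (\<lambda>h. h \<bullet> grad f x)" by auto
  with D show ?thesis by simp
qed

lemma C_k_const [simp]: "C_k m (\<lambda>x::real^'n. c)"
proof (induction m arbitrary: c)
  case (Suc m)
  have "grad (\<lambda>x. c) x $ i = 0" for x :: "real^'n" and i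
    using grad_eqI[OF has_derivative_const, of c x i] by simp
  then show ?case using Suc by simp
qed simp

lemma C_k_nth: "C_k m (\<lambda>x::real^'n. x $ i)"
proof (cases m)
  case (Suc k)
  have D: "((\<lambda>x. x $ i) has_derivative (\<lambda>h. h $ i)) (at x)" for x :: "real^'n"
    by (rule bounded_linear_imp_has_derivative) (rule bounded_linear_vec_nth)
  have "grad (\<lambda>x. x $ i) x $ j = axis j 1 $ i" for x :: "real^'n" and j
    by (rule grad_eqI[OF D])
  then show ?thesis using Suc D
    by (auto simp: differentiable_on_def differentiable_def intro: has_derivative_at_withinI)
qed (simp add: continuous_on_component)

lemma C_k_add: "C_k m f \<Longrightarrow> C_k m g \<Longrightarrow> C_k m (\<lambda>x. f x + g x)"
proof (induction m arbitrary: f g)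
  case (Suc m)
  have "grad (\<lambda>x. f x + g x) x $ i = grad f x $ i + grad g x $ i" for x i
    using grad_eqI[OF has_derivative_add[OF Suc.prems[THEN C_k_Suc_has_derivative]], of x i]
    by (simp add: inner_axis')
  then show ?case using Suc by (auto intro: differentiable_on_add)
qed (simp add: continuous_on_add)

lemma C_k_mult: "C_k m f \<Longrightarrow> C_k m g \<Longrightarrow> C_k m (\<lambda>x. f x * g x)"
proof (induction m arbitrary: f g)
  case (Suc m)
  have "grad (\<lambda>x. f x * g x) x $ i = f x * grad g x $ i + grad f x $ i * g x" for x i
    using grad_eqI[OF has_derivative_mult[OF Suc.prems[THEN C_k_Suc_has_derivative]], of x i]
    by (simp add: inner_axis')
  moreover have "C_k m (\<lambda>x. f x * grad g x $ i + grad f x $ i * g x)" for i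
    by (rule C_k_add; rule Suc.IH) (use Suc.prems Suc.prems[THEN C_k_SucD] in auto)
  ultimately show ?case using Suc.prems by (auto intro: differentiable_on_mult)
qed (simp add: continuous_on_mult)

text \<open>The outer function is given together with all its derivatives \<open>G 0, G 1, \<dots>\<close>, so that one
  induction on the order of differentiability handles the whole chain: differentiating
  \<open>G n \<circ> f\<close> produces \<open>G (Suc n) \<circ> f\<close> times a derivative of \<open>f\<close>.\<close>

lemma C_k_compose:
  fixes G :: "nat \<Rightarrow> real \<Rightarrow> real"
  assumes G: "\<And>n t. (G n has_real_derivative G (Suc n) t) (at t)"
  shows "C_k m f \<Longrightarrow> C_k m (\<lambda>x. G n (f x))"
proof (induction m arbitrary: n)
  case 0
  have "continuous_on UNIV (G n)"
    using G by (meson DERIV_continuous_on has_field_derivative_at_within)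
  then show ?case using 0 by (auto intro: continuous_on_compose2)
next
  case (Suc m)
  have D: "((\<lambda>x. G n (f x)) has_derivative (\<lambda>h. (h \<bullet> grad f x) * G (Suc n) (f x))) (at x)" for x
    using has_derivative_compose[OF C_k_Suc_has_derivative[OF Suc.prems]
        G[unfolded has_field_derivative_def]]
    by (simp add: mult.commute)
  have "grad (\<lambda>x. G n (f x)) x $ i = grad f x $ i * G (Suc n) (f x)" for x i
    using grad_eqI[OF D, of x i] by (simp add: inner_axis')
  moreover have "C_k m (\<lambda>x. grad f x $ i * G (Suc n) (f x))" for i
    using Suc.prems Suc.prems[THEN C_k_SucD] by (metis C_k.simps(2) C_k_mult Suc.IH)
  moreover have "(\<lambda>x. G n (f x)) differentiable_on UNIV"
    unfolding differentiable_on_def differentiable_def using D by blast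
  ultimately show ?case by simp
qed

lemma C_k_prod:
  assumes "finite I" "\<And>i. i \<in> I \<Longrightarrow> C_k m (f i)"
  shows "C_k m (\<lambda>x. \<Prod>i\<in>I. f i x)"
  using assms by (induction I rule: finite_induct) (auto intro: C_k_mult)

section \<open>Smooth approximation of indicator functions of boxes\<close>

text \<open>The functions \<open>p(1/t) exp(-1/t)\<close> with a polynomial \<open>p\<close>, extended by 0 to \<open>t \<le> 0\<close>. This family
  contains the standard flat function \<open>exp(-1/t)\<close> and is closed under differentiation.\<close>

definition flat :: "real poly \<Rightarrow> real \<Rightarrow> real" where
  "flat p t = (if t > 0 then poly p (1/t) * exp (- (1/t)) else 0)"

text \<open>With \<open>u = 1/t\<close> the quotient is a polynomial in \<open>u\<close> times \<open>exp(-u)\<close>. This limit is both the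
  continuity and the differentiability at the only critical point 0.\<close>

lemma flat_quotient_tendsto: "((\<lambda>t. flat p t / t) \<longlongrightarrow> 0) (at_right 0)"
proof -
  have *: "((\<lambda>u. u * (poly p u * exp (- u))) \<longlongrightarrow> 0) at_top"
  proof -
    have mono: "((\<lambda>u. u ^ k / exp u) \<longlongrightarrow> (0::real)) at_top" for k :: nat
      by (rule tendsto_power_div_exp_0)
    have "((\<lambda>u. \<Sum>i\<le>degree p. coeff p i * (u ^ Suc i / exp u)) \<longlongrightarrow> (\<Sum>i\<le>degree p. coeff p i * 0)) at_top"
      by (intro tendsto_intros mono)
    moreover have "(\<Sum>i\<le>degree p. coeff p i * (u ^ Suc i / exp u)) = u * (poly p u * exp (- u))" for u
      by (simp add: poly_altdef exp_minus field_simps sum_distrib_left sum_distrib_right sum_divide_distrib)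
    ultimately show ?thesis by simp
  qed
  have "((\<lambda>t. inverse t * (poly p (inverse t) * exp (- inverse t))) \<longlongrightarrow> 0) (at_right 0)"
    by (rule filterlim_compose[OF * filterlim_inverse_at_top_right])
  then show ?thesis
    by (rule Lim_transform_eventually)
       (auto simp: eventually_at_right_less flat_def divide_simps intro!: eventually_mono[OF eventually_at_right_less])
qed

lemma flat_has_derivative:
  "(flat p has_real_derivative flat ([:0,0,1:] * (p - pderiv p)) t) (at t)"
proof -
  consider "t > 0" | "t < 0" | "t = 0" by linarith
  then show ?thesis
  proof cases
    case 1
    have "((\<lambda>t. poly p (1/t) * exp (- (1/t))) has_real_derivative flat ([:0,0,1:] * (p - pderiv p)) t) (at t)"
      using 1 by (auto simp: flat_def intro!: derivative_eq_intros DERIV_chain2[OF poly_DERIV])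
        (simp add: field_simps power2_eq_square)
    then show ?thesis
      by (rule has_field_derivative_transform_within_open[where S="{0<..}"]) (use 1 in \<open>auto simp: flat_def\<close>)
  next
    case 2
    have "((\<lambda>t. 0) has_real_derivative flat ([:0,0,1:] * (p - pderiv p)) t) (at t)"
      using 2 by (simp add: flat_def)
    then show ?thesis
      by (rule has_field_derivative_transform_within_open[where S="{..<0}"]) (use 2 in \<open>auto simp: flat_def\<close>)
  next
    case 3
    have "((\<lambda>t. flat p t / t) \<longlongrightarrow> 0) (at_left 0)"
      by (rule tendsto_eventually) (auto simp: flat_def eventually_at_filter)
    then have "((\<lambda>t. flat p t / t) \<longlongrightarrow> 0) (at 0)"
      using flat_quotient_tendsto filterlim_split_at by blast
    then show ?thesis using 3
      by (simp add: has_field_derivative_iff flat_def)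
  qed
qed

text \<open>The \<open>n\<close>-th derivative of \<open>exp(-1/t)\<close>, extended by 0.\<close>

definition flat_exp :: "nat \<Rightarrow> real \<Rightarrow> real" where
  "flat_exp n = flat (((\<lambda>p. [:0,0,1:] * (p - pderiv p)) ^^ n) 1)"

lemma flat_exp_deriv: "(flat_exp n has_real_derivative flat_exp (Suc n) t) (at t)"
  using flat_has_derivative by (simp add: flat_exp_def)

text \<open>The factors are positive exactly on the two half-spaces that bound the box in direction \<open>i\<close>,
  hence the product is positive exactly on the open box.\<close>

definition box_bump :: "real^'n \<Rightarrow> real^'n \<Rightarrow> real^'n \<Rightarrow> real" where
  "box_bump a b x = (\<Prod>i\<in>UNIV. flat_exp 0 (x $ i - a $ i) * flat_exp 0 (b $ i - x $ i))"

lemma box_bump_smooth: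
  fixes a b :: "real^'n"
  shows "C_k m (box_bump a b)"
proof -
  have "C_k m (\<lambda>x::real^'n. x $ i + - a $ i)" "C_k m (\<lambda>x::real^'n. b $ i + (-1) * x $ i)" for i
    by (intro C_k_add C_k_mult C_k_nth C_k_const)+
  from this[THEN C_k_compose[where G=flat_exp and n=0, OF flat_exp_deriv]] show ?thesis
    unfolding box_bump_def by (intro C_k_prod C_k_mult) (auto simp: algebra_simps)
qed

lemma flat_exp_0_sign: "flat_exp 0 t \<ge> 0" "flat_exp 0 t > 0 \<longleftrightarrow> t > 0"
  by (auto simp: flat_exp_def flat_def)

lemma box_bump_pos_iff: "box_bump a b x > 0 \<longleftrightarrow> x \<in> box a b"
  and box_bump_nonneg: "box_bump a b x \<ge> 0"
proof -
  show n: "box_bump a b x \<ge> 0"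
    unfolding box_bump_def by (intro prod_nonneg) (simp add: flat_exp_0_sign)
  have "box_bump a b x \<noteq> 0 \<longleftrightarrow> (\<forall>i. a $ i < x $ i \<and> x $ i < b $ i)"
    using flat_exp_0_sign by (auto simp: box_bump_def) (smt (verit))+
  then show "box_bump a b x > 0 \<longleftrightarrow> x \<in> box a b"
    using n by (auto simp: mem_box_cart)
qed

text \<open>Composing the bump with \<open>1 - exp(-n t)\<close> keeps its support and drives every positive value to 1,
  so these test functions approximate the indicator function of the box without any normalisation.\<close>

lemma box_indicator_approx_test_function:
  assumes "cbox a b \<subseteq> \<Omega>"
  shows "(\<lambda>x. 1 - exp (- (real n * box_bump a b x))) \<in> test_functions \<Omega>"
proof -
  let ?G = "\<lambda>k t::real. (if k = 0 then 1 else 0) - (-1) ^ k * exp (- t)"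
  have G: "(?G k has_real_derivative ?G (Suc k) t) (at t)" for k t
    by (auto intro!: derivative_eq_intros)
  have "C_k m (\<lambda>x. ?G 0 (real n * box_bump a b x))" for m
    by (rule C_k_compose[where G="?G", OF G]) (intro C_k_mult C_k_const box_bump_smooth)
  then have "C_k m (\<lambda>x. 1 - exp (- (real n * box_bump a b x)))" for m
    by simp
  moreover have sub: "closure {x. 1 - exp (- (real n * box_bump a b x)) \<noteq> 0} \<subseteq> cbox a b"
  proof (rule closure_minimal)
    show "{x. 1 - exp (- (real n * box_bump a b x)) \<noteq> 0} \<subseteq> cbox a b"
      using box_bump_pos_iff[of a b] box_bump_nonneg[of a b] box_subset_cbox[of a b]
      by (smt (verit) mem_Collect_eq mult_eq_0_iff exp_zero subsetD subsetI)
  qed (simp add: closed_cbox)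
  moreover have "compact (closure {x. 1 - exp (- (real n * box_bump a b x)) \<noteq> 0})"
    using sub by (meson bounded_cbox bounded_subset closed_closure compact_eq_bounded_closed)
  ultimately show ?thesis
    using assms by (auto simp: test_functions_def)
qed

lemma box_indicator_approx_tendsto:
  "(\<lambda>n. 1 - exp (- (real n * box_bump a b x))) \<longlonglongrightarrow> indicator (box a b) x"
proof (cases "x \<in> box a b")
  case True
  then have p: "box_bump a b x > 0" by (simp add: box_bump_pos_iff)
  have "(\<lambda>n. exp (- box_bump a b x) ^ n) \<longlonglongrightarrow> 0"
    using p by (intro LIMSEQ_power_zero) auto
  then have "(\<lambda>n. 1 - exp (- (real n * box_bump a b x))) \<longlonglongrightarrow> 1 - 0"
    by (intro tendsto_diff tendsto_const) (simp add: exp_of_nat_mult[symmetric])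
  then show ?thesis using True by simp
next
  case False
  then have "box_bump a b x = 0"
    by (metis box_bump_pos_iff box_bump_nonneg less_eq_real_def)
  then show ?thesis using False by simp
qed

section \<open>Integration by parts\<close>

lemma integrable_lborel_continuous_compact_support:
  fixes f :: "'a::euclidean_space \<Rightarrow> 'b::{banach, second_countable_topology}"
  assumes "continuous_on UNIV f" "bounded K" "\<And>x. x \<notin> K \<Longrightarrow> f x = 0"
  shows "integrable lborel f"
proof -
  have "integrable lborel (\<lambda>x. indicator (closure K) x *\<^sub>R f x)"
    using assms by (intro borel_integrable_compact) (auto intro: continuous_on_subset)
  moreover have "(\<lambda>x. indicator (closure K) x *\<^sub>R f x) = f"
    using assms(3) closure_subset by (fastforce simp: indicator_def)
  ultimately show ?thesis by simp
qed

lemma lebesgue_on_integral_eq_lborel: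
  fixes f :: "'a::euclidean_space \<Rightarrow> 'b::{banach, second_countable_topology}"
  assumes "S \<in> sets lebesgue" "f \<in> borel_measurable borel" "\<And>x. x \<notin> S \<Longrightarrow> f x = 0"
  shows "integrable (lebesgue_on S) f \<longleftrightarrow> integrable lborel f"
    and "(LINT x|lebesgue_on S. f x) = (LINT x|lborel. f x)"
proof -
  have eq: "(\<lambda>x. indicator S x *\<^sub>R f x) = f"
    using assms(3) by (auto simp: indicator_def fun_eq_iff)
  show "integrable (lebesgue_on S) f \<longleftrightarrow> integrable lborel f"
    using assms by (subst integrable_restrict_space) (auto simp: eq integrable_completion)
  show "(LINT x|lebesgue_on S. f x) = (LINT x|lborel. f x)"
    using assms by (subst integral_restrict_space) (auto simp: eq integral_completion)
qed

lemma integral_lborel_translate: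
  fixes f :: "'a::euclidean_space \<Rightarrow> real"
  assumes "f \<in> borel_measurable borel"
  shows "(LINT x|lborel. f (x + c)) = (LINT x|lborel. f x)"
proof -
  have "(LINT x|lborel. f x) = (LINT x|distr lborel borel ((+) c). f x)"
    by (simp add: lborel_distr_plus)
  also have "\<dots> = (LINT x|lborel. f (c + x))"
    using assms by (subst integral_distr) auto
  finally show ?thesis by (simp add: add.commute)
qed

lemma abs_diff_along_line_le:
  fixes f :: "'a::euclidean_space \<Rightarrow> real"
  assumes D: "\<And>x. (f has_derivative f' x) (at x)"
    and B: "\<And>x. \<bar>f' x e\<bar> \<le> B" and t: "t > 0"
  shows "\<bar>f (x + t *\<^sub>R e) - f x\<bar> \<le> t * B"
proof -
  have "((\<lambda>s. f (x + s *\<^sub>R e)) has_real_derivative f' (x + s *\<^sub>R e) e) (at s)" for s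
  proof -
    have "((\<lambda>s. x + s *\<^sub>R e) has_derivative (\<lambda>h. h *\<^sub>R e)) (at s)"
      by (auto intro!: derivative_eq_intros)
    from has_derivative_compose[OF this D]
    have "((\<lambda>s. f (x + s *\<^sub>R e)) has_derivative (\<lambda>h. f' (x + s *\<^sub>R e) (h *\<^sub>R e))) (at s)" .
    moreover have "f' (x + s *\<^sub>R e) (h *\<^sub>R e) = f' (x + s *\<^sub>R e) e * h" for h
      using linear_cmul[OF has_derivative_linear[OF D]] by simp
    ultimately show ?thesis by (simp add: has_field_derivative_def)
  qed
  then obtain z where "f (x + t *\<^sub>R e) - f (x + 0 *\<^sub>R e) = (t - 0) * f' (x + z *\<^sub>R e) e"
    using MVT2[OF t, of "\<lambda>s. f (x + s *\<^sub>R e)" "\<lambda>s. f' (x + s *\<^sub>R e) e"] by blast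
  then show ?thesis
    using B[of "x + z *\<^sub>R e"] t by (simp add: abs_mult)
qed

text \<open>The integrals of the difference quotients vanish by translation invariance of the Lebesgue
  measure, and the quotients are dominated by a multiple of the indicator function of a ball. This
  is the divergence theorem for compactly supported functions.\<close>

lemma integral_directional_derivative_eq_0:
  fixes f :: "'a::euclidean_space \<Rightarrow> real"
  assumes D: "\<And>x. (f has_derivative f' x) (at x)"
    and B: "\<And>x. \<bar>f' x e\<bar> \<le> B"
    and K: "bounded K" "\<And>x. x \<notin> K \<Longrightarrow> f x = 0"
  shows "integrable lborel (\<lambda>x. f' x e)" "(LINT x|lborel. f' x e) = 0"
proof -
  define t where "t n = inverse (real (Suc n))" for n
  define Q where "Q n x = (f (x + t n *\<^sub>R e) - f x) / t n" for n x
  have tpos: "t n > 0" "t n \<le> 1" for n by (auto simp: t_def field_simps)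
  have t0: "t \<longlonglongrightarrow> 0" unfolding t_def by (rule LIMSEQ_inverse_real_of_nat)
  have cont: "continuous_on UNIV f"
    using D by (meson differentiable_imp_continuous_on differentiable_on_def differentiable_def has_derivative_at_withinI)
  then have [measurable]: "f \<in> borel_measurable borel"
    by (rule borel_measurable_continuous_onI)
  have B0: "B \<ge> 0" using B[of undefined] by linarith
  obtain R where R: "\<And>x. x \<in> K \<Longrightarrow> norm x \<le> R"
    using K(1) bounded_iff by blast
  have lim: "(\<lambda>n. Q n x) \<longlonglongrightarrow> f' x e" for x
  proof -
    have "((\<lambda>s. x + s *\<^sub>R e) has_derivative (\<lambda>h. h *\<^sub>R e)) (at 0)"
      by (auto intro!: derivative_eq_intros)
    from has_derivative_compose[OF this, of f "f' x"] D
    have "((\<lambda>s. f (x + s *\<^sub>R e)) has_derivative (\<lambda>h. f' x (h *\<^sub>R e))) (at 0)"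
      by simp
    moreover have "f' x (h *\<^sub>R e) = f' x e * h" for h
      using linear_cmul[OF has_derivative_linear[OF D]] by simp
    ultimately have "((\<lambda>s. f (x + s *\<^sub>R e)) has_real_derivative f' x e) (at 0)"
      by (simp add: has_field_derivative_def)
    then have "((\<lambda>h. (f (x + h *\<^sub>R e) - f x) / h) \<longlongrightarrow> f' x e) (at 0)"
      by (simp add: DERIV_def)
    moreover have "filterlim t (at 0) sequentially"
      using t0 tpos(1) by (simp add: filterlim_at less_imp_neq[symmetric])
    ultimately show ?thesis
      unfolding Q_def by (rule filterlim_compose)
  qed
  have bound: "norm (Q n x) \<le> B * indicator (cball 0 (R + norm e)) x" for n x
  proof (cases "x \<in> cball 0 (R + norm e)")
    case True
    have "\<bar>f (x + t n *\<^sub>R e) - f x\<bar> \<le> t n * B"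
      by (rule abs_diff_along_line_le[OF D B tpos(1)])
    then show ?thesis using True tpos[of n] by (simp add: Q_def field_simps)
  next
    case False
    have "norm x > R" using False norm_ge_zero[of e] unfolding mem_cball_0 by linarith
    moreover have "norm (x + t n *\<^sub>R e) > R"
    proof -
      have "norm x \<le> norm (x + t n *\<^sub>R e) + norm (t n *\<^sub>R e)"
        by (metis add_diff_cancel_right' norm_triangle_ineq4)
      moreover have "norm (t n *\<^sub>R e) \<le> norm e"
        using tpos[of n] by (simp add: mult_left_le_one_le)
      ultimately show ?thesis using False by simp
    qed
    ultimately have "f x = 0" "f (x + t n *\<^sub>R e) = 0"
      using K(2) R by (meson not_less)+
    then show ?thesis using B0 by (simp add: Q_def)
  qed
  have ind: "integrable lborel (\<lambda>x. B * indicator (cball (0::'a) (R + norm e)) x)"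
    by (intro integrable_mult_right integrable_real_indicator)
      (use emeasure_lborel_cball_finite in auto)
  have lim_meas: "(\<lambda>x. f' x e) \<in> borel_measurable lborel"
    by (rule borel_measurable_LIMSEQ_real[OF lim]) (simp add: Q_def)
  have Qmeas: "Q n \<in> borel_measurable lborel" for n
    unfolding Q_def by measurable
  have int0: "(LINT x|lborel. Q n x) = 0" for n
  proof -
    have i: "integrable lborel f"
      by (rule integrable_lborel_continuous_compact_support[OF cont K])
    have "bounded ((\<lambda>x. x - t n *\<^sub>R e) ` K)"
      using bounded_translation_minus[OF K(1)] by simp
    then have "integrable lborel (\<lambda>x. f (x + t n *\<^sub>R e))"
    proof (rule integrable_lborel_continuous_compact_support[rotated])
      show "continuous_on UNIV (\<lambda>x. f (x + t n *\<^sub>R e))"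
        by (intro continuous_on_compose2[OF cont] continuous_intros) auto
      show "f (x + t n *\<^sub>R e) = 0" if "x \<notin> (\<lambda>x. x - t n *\<^sub>R e) ` K" for x
        using that K(2) by (metis add_diff_cancel_right' image_eqI)
    qed
    then show ?thesis using i
      by (simp add: Q_def integral_lborel_translate)
  qed
  show "integrable lborel (\<lambda>x. f' x e)"
    by (rule integrable_dominated_convergence[where s=Q, OF lim_meas Qmeas ind]) (use lim bound in auto)
  have "(\<lambda>n. LINT x|lborel. Q n x) \<longlonglongrightarrow> (LINT x|lborel. f' x e)"
    by (rule integral_dominated_convergence[where s=Q, OF lim_meas Qmeas ind]) (use lim bound in auto)
  then show "(LINT x|lborel. f' x e) = 0"
    by (simp add: int0 LIMSEQ_const_iff)
qed

section \<open>Test functions\<close>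

lemma test_function_C_k: "\<phi> \<in> test_functions \<Omega> \<Longrightarrow> C_k m \<phi>"
  by (simp add: test_functions_def)

lemma test_function_has_derivative:
  "\<phi> \<in> test_functions \<Omega> \<Longrightarrow> (\<phi> has_derivative (\<lambda>h. h \<bullet> grad \<phi> x)) (at x)"
  by (rule C_k_Suc_has_derivative[of 0]) (rule test_function_C_k)

lemma test_function_support:
  assumes "\<phi> \<in> test_functions \<Omega>"
  obtains K where "compact K" "K \<subseteq> \<Omega>" "\<And>x. x \<notin> K \<Longrightarrow> \<phi> x = 0" "\<And>x. x \<notin> K \<Longrightarrow> grad \<phi> x = 0"
proof
  let ?K = "closure {x. \<phi> x \<noteq> 0}"
  show "compact ?K" "?K \<subseteq> \<Omega>" using assms by (auto simp: test_functions_def)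
  show z: "\<phi> x = 0" if "x \<notin> ?K" for x
    using that closure_subset[of "{x. \<phi> x \<noteq> 0}"] by blast
  show "grad \<phi> x = 0" if "x \<notin> ?K" for x
  proof -
    have "((\<lambda>x. 0::real) has_derivative (\<lambda>h. 0)) (at x)" by simp
    then have "(\<phi> has_derivative (\<lambda>h. 0)) (at x)"
    proof (rule has_derivative_transform_within_open[where s="- ?K"])
      show "0 = \<phi> y" if "y \<in> - ?K" for y using z[of y] that by simp
      show "open (- ?K)" by (intro open_Compl closed_closure)
      show "x \<in> - ?K" using that by simp
    qed
    from grad_eqI[OF this] show ?thesis by (simp add: vec_eq_iff)
  qed
qed

lemma test_function_continuous: "\<phi> \<in> test_functions \<Omega> \<Longrightarrow> continuous_on UNIV \<phi>"
  using test_function_C_k[of \<phi> \<Omega> 0] by simp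

lemma test_function_grad_continuous:
  assumes "\<phi> \<in> test_functions \<Omega>"
  shows "continuous_on UNIV (grad \<phi>)"
proof -
  have "continuous_on UNIV (\<lambda>x. grad \<phi> x $ i)" for i
    using test_function_C_k[OF assms, of 1] by simp
  then have "continuous_on UNIV (\<lambda>x. \<chi> i. grad \<phi> x $ i)"
    by (rule continuous_on_vec_lambda)
  then show ?thesis by simp
qed

lemma continuous_compact_support_bounded:
  fixes f :: "'a::topological_space \<Rightarrow> 'b::real_normed_vector"
  assumes "continuous_on UNIV f" "compact K" "\<And>x. x \<notin> K \<Longrightarrow> f x = 0"
  obtains B where "B > 0" "\<And>x. norm (f x) \<le> B"
proof -
  have "bounded (f ` K)"
    using assms by (meson compact_continuous_image compact_imp_bounded continuous_on_subset subset_UNIV)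
  then obtain B where B: "B > 0" "\<And>x. x \<in> K \<Longrightarrow> norm (f x) \<le> B"
    by (auto simp: bounded_pos)
  show ?thesis
  proof (rule that[OF B(1)])
    show "norm (f x) \<le> B" for x
      using B assms(3)[of x] by (cases "x \<in> K") auto
  qed
qed

lemma locally_integrable_continuous:
  fixes f :: "real^'n \<Rightarrow> 'b::euclidean_space"
  assumes "continuous_on UNIV f"
  shows "locally_integrable \<Omega> f"
  unfolding locally_integrable_def
proof safe
  fix K :: "(real^'n) set" assume K: "compact K"
  have "integrable lborel (\<lambda>x. indicator K x *\<^sub>R f x)"
    using assms K by (intro borel_integrable_compact) (auto intro: continuous_on_subset)
  then have "integrable lebesgue (\<lambda>x. indicator K x *\<^sub>R f x)"
    by (subst integrable_completion[OF borel_measurable_integrable])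
  then show "integrable (lebesgue_on K) f"
    using K by (subst integrable_restrict_space) (auto intro: lmeasurable_compact fmeasurableD)
qed

text \<open>Integration by parts is the vanishing of the integral of \<open>\<partial>\<^sub>i(\<phi> \<psi>)\<close>.\<close>

lemma test_function_weak_gradient:
  assumes "\<Omega> \<in> sets lebesgue" and \<phi>: "\<phi> \<in> test_functions \<Omega>"
  shows "is_weak_gradient \<Omega> \<phi> (grad \<phi>)"
  unfolding is_weak_gradient_def
proof (intro conjI ballI allI)
  show "locally_integrable \<Omega> \<phi>" "locally_integrable \<Omega> (grad \<phi>)"
    using \<phi> by (auto intro!: locally_integrable_continuous test_function_continuous test_function_grad_continuous)
  fix \<psi> i assume \<psi>: "\<psi> \<in> test_functions \<Omega>"
  obtain K where K: "compact K" "K \<subseteq> \<Omega>" "\<And>x. x \<notin> K \<Longrightarrow> \<phi> x = 0" "\<And>x. x \<notin> K \<Longrightarrow> grad \<phi> x = 0"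
    using test_function_support[OF \<phi>] by metis
  have K': "\<phi> x = 0" "grad \<phi> x = 0" if "x \<notin> \<Omega>" for x
    using K(2-4) that by auto
  note c = test_function_continuous[OF \<phi>] test_function_continuous[OF \<psi>]
    test_function_grad_continuous[OF \<phi>] test_function_grad_continuous[OF \<psi>]
  have c1: "continuous_on UNIV (\<lambda>x. \<phi> x * grad \<psi> x $ i)" and c2: "continuous_on UNIV (\<lambda>x. grad \<phi> x $ i * \<psi> x)"
    using c by (auto intro!: continuous_intros)
  let ?D = "\<lambda>x. \<phi> x * grad \<psi> x $ i + grad \<phi> x $ i * \<psi> x"
  have cD: "continuous_on UNIV ?D"
    using c1 c2 by (rule continuous_on_add)
  obtain B where B: "\<And>x. norm (?D x) \<le> B"
    using continuous_compact_support_bounded[OF cD K(1)] K(3,4) by (metis (lifting) mult_zero_left zero_index add_0)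
  have i1: "integrable lborel (\<lambda>x. \<phi> x * grad \<psi> x $ i)"
    by (rule integrable_lborel_continuous_compact_support[OF c1 compact_imp_bounded[OF K(1)]]) (simp add: K)
  have i2: "integrable lborel (\<lambda>x. grad \<phi> x $ i * \<psi> x)"
    by (rule integrable_lborel_continuous_compact_support[OF c2 compact_imp_bounded[OF K(1)]]) (simp add: K)
  have "(LINT x|lborel. \<phi> x * (axis i 1 \<bullet> grad \<psi> x) + (axis i 1 \<bullet> grad \<phi> x) * \<psi> x) = 0"
  proof (rule integral_directional_derivative_eq_0(2))
    show "((\<lambda>x. \<phi> x * \<psi> x) has_derivative (\<lambda>h. \<phi> x * (h \<bullet> grad \<psi> x) + (h \<bullet> grad \<phi> x) * \<psi> x)) (at x)" for x
      by (rule has_derivative_mult[OF test_function_has_derivative[OF \<phi>] test_function_has_derivative[OF \<psi>]])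
    show "\<bar>\<phi> x * (axis i 1 \<bullet> grad \<psi> x) + (axis i 1 \<bullet> grad \<phi> x) * \<psi> x\<bar> \<le> B" for x
      using B[of x] by (simp add: inner_axis')
    show "bounded K" using K(1) by (rule compact_imp_bounded)
    show "\<phi> x * \<psi> x = 0" if "x \<notin> K" for x using K(3)[OF that] by simp
  qed
  then have "(LINT x|lborel. ?D x) = 0"
    by (simp add: inner_axis')
  then have "(LINT x|lborel. \<phi> x * grad \<psi> x $ i) = - (LINT x|lborel. grad \<phi> x $ i * \<psi> x)"
    using i1 i2 by simp
  moreover have "(LINT x|lebesgue_on \<Omega>. \<phi> x * grad \<psi> x $ i) = (LINT x|lborel. \<phi> x * grad \<psi> x $ i)"
    by (rule lebesgue_on_integral_eq_lborel) (use assms K' c1 in \<open>auto intro: borel_measurable_continuous_onI\<close>)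
  moreover have "(LINT x|lebesgue_on \<Omega>. grad \<phi> x $ i * \<psi> x) = (LINT x|lborel. grad \<phi> x $ i * \<psi> x)"
    by (rule lebesgue_on_integral_eq_lborel) (use assms K' c2 in \<open>auto intro: borel_measurable_continuous_onI\<close>)
  ultimately show "(LINT x|lebesgue_on \<Omega>. \<phi> x * grad \<psi> x $ i) = - (LINT x|lebesgue_on \<Omega>. grad \<phi> x $ i * \<psi> x)"
    by simp
qed

section \<open>The fundamental lemma of the calculus of variations\<close>

text \<open>Boxes form an intersection-stable generator of the Borel sets, and the sets over which \<open>f\<close>
  integrates to 0 form a Dynkin system. So \<open>f\<close> integrates to 0 over the sets where it is
  nonnegative and where it is nonpositive.\<close>

lemma AE_0_if_box_integrals_0:
  fixes f :: "'a::euclidean_space \<Rightarrow> real"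
  assumes f: "integrable lborel f" and total: "(LINT x|lborel. f x) = 0"
    and box: "\<And>c d. (LINT x|lborel. indicator (box c d) x * f x) = 0"
  shows "AE x in lborel. f x = 0"
proof -
  have int: "integrable lborel (\<lambda>x. indicator A x * f x)" if "A \<in> sets borel" for A
    using integrable_mult_indicator[of A lborel f] that f by simp
  have borel: "(LINT x|lborel. indicator A x * f x) = 0" if A: "A \<in> sets borel" for A
  proof -
    have "Int_stable (range (\<lambda>(a, b). box a b :: 'a set))"
      by (auto simp: Int_stable_def box_Int_box)
    moreover have "(range (\<lambda>(a, b). box a b :: 'a set)) \<subseteq> Pow UNIV"
      by auto
    moreover have "A \<in> sigma_sets UNIV (range (\<lambda>(a, b). box a b))"
      using A unfolding borel_eq_box by simp
    ultimately show ?thesis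
    proof (induction rule: sigma_sets_induct_disjoint)
      case (basic A) then show ?case using box by auto
    next
      case empty then show ?case by simp
    next
      case (compl A)
      then have [simp]: "A \<in> sets borel" by (simp add: borel_eq_box)
      have "(LINT x|lborel. indicator (UNIV - A) x * f x) = (LINT x|lborel. f x - indicator A x * f x)"
        by (intro Bochner_Integration.integral_cong) (auto simp: indicator_def)
      then show ?case using compl f int[of A] total by simp
    next
      case (union F)
      then have F: "\<And>i. F i \<in> sets borel"
        by (simp add: borel_eq_box subset_eq)
      then have U: "(\<Union>i. F i) \<in> sets borel" by auto
      have "(LINT x:(\<Union>i. F i)|lborel. f x) = (\<Sum>i. (LINT x:(F i)|lborel. f x))"
        using F int[OF U] union(1)
        by (intro lebesgue_integral_countable_add) (auto simp: set_integrable_def disjoint_family_on_def)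
      then show ?case using union by (simp add: set_lebesgue_integral_def)
    qed
  qed
  have [measurable]: "f \<in> borel_measurable borel" using f by auto
  have AEz: "AE x in lborel. indicator A x * f x = 0"
    if "A \<in> sets borel" "(\<forall>x\<in>A. f x \<ge> 0) \<or> (\<forall>x\<in>A. - f x \<ge> 0)" for A
    using that(2)
  proof
    assume "\<forall>x\<in>A. f x \<ge> 0"
    then show ?thesis
      using integral_nonneg_eq_0_iff_AE[OF int[OF that(1)]] borel[OF that(1)] by (auto simp: indicator_def)
  next
    assume a: "\<forall>x\<in>A. - f x \<ge> 0"
    have "AE x in lborel. - (indicator A x * f x) = 0"
      using a integral_nonneg_eq_0_iff_AE[OF integrable_minus[OF int[OF that(1)]]] borel[OF that(1)]
      by (auto simp: indicator_def)
    then show ?thesis by simp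
  qed
  have "AE x in lborel. indicator {x. f x \<ge> 0} x * f x = 0" "AE x in lborel. indicator {x. f x \<le> 0} x * f x = 0"
    by (rule AEz; measurable; auto)+
  then show ?thesis
    by eventually_elim (auto simp: indicator_def split: if_splits)
qed

lemma integral_box_eq_0_if_orthogonal:
  fixes h :: "real^'n \<Rightarrow> real"
  assumes \<Omega>: "\<Omega> \<in> sets lebesgue" and h: "locally_integrable \<Omega> h"
    and orth: "\<And>\<phi>. \<phi> \<in> test_functions \<Omega> \<Longrightarrow> (LINT x|lebesgue_on \<Omega>. h x * \<phi> x) = 0"
    and sub: "cbox a b \<subseteq> \<Omega>"
  shows "integrable lebesgue (\<lambda>x. indicator (box a b) x * h x)"
    and "(LINT x|lebesgue. indicator (box a b) x * h x) = 0"
proof -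
  let ?\<phi> = "\<lambda>n x. 1 - exp (- (real n * box_bump a b x))"
  have "integrable (lebesgue_on (cbox a b)) h"
    using h sub by (simp add: locally_integrable_def)
  then have "integrable lebesgue (\<lambda>x. indicator (cbox a b) x *\<^sub>R h x)"
    by (subst (asm) integrable_restrict_space) auto
  then have "integrable lebesgue (\<lambda>x. indicator (box a b) x *\<^sub>R (indicator (cbox a b) x *\<^sub>R h x))"
    by (rule integrable_mult_indicator[rotated]) auto
  moreover have eq: "(\<lambda>x. indicator (box a b) x *\<^sub>R (indicator (cbox a b) x *\<^sub>R h x)) = (\<lambda>x. indicator (box a b) x * h x)"
    using box_subset_cbox[of a b] by (auto simp: indicator_def fun_eq_iff)
  ultimately show i: "integrable lebesgue (\<lambda>x. indicator (box a b) x * h x)" by metis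
  have z: "?\<phi> n x = 0" if "x \<notin> box a b" for n x
    using that box_bump_pos_iff[of a b x] box_bump_nonneg[of a b x] by auto
  have \<phi>01: "0 \<le> ?\<phi> n x" "?\<phi> n x \<le> 1" for n x
    using box_bump_nonneg[of a b x] by auto
  have zero: "(LINT x|lebesgue. ?\<phi> n x * (indicator (box a b) x * h x)) = 0" for n
  proof -
    have "(LINT x|lebesgue_on \<Omega>. h x * ?\<phi> n x) = 0"
      by (rule orth[OF box_indicator_approx_test_function[OF sub]])
    then have "(LINT x|lebesgue. indicator \<Omega> x *\<^sub>R (h x * ?\<phi> n x)) = 0"
      using \<Omega> by (subst (asm) integral_restrict_space) auto
    moreover have "(\<lambda>x. indicator \<Omega> x *\<^sub>R (h x * ?\<phi> n x)) = (\<lambda>x. ?\<phi> n x * (indicator (box a b) x * h x))"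
    proof
      fix x
      show "indicator \<Omega> x *\<^sub>R (h x * ?\<phi> n x) = ?\<phi> n x * (indicator (box a b) x * h x)"
        using z[of x n] sub box_subset_cbox[of a b] by (cases "x \<in> box a b") (auto simp: indicator_def)
    qed
    ultimately show ?thesis by (simp only:)
  qed
  have "(\<lambda>n. LINT x|lebesgue. ?\<phi> n x * (indicator (box a b) x * h x)) \<longlonglongrightarrow> (LINT x|lebesgue. indicator (box a b) x * h x)"
  proof (rule integral_dominated_convergence[where w="\<lambda>x. norm (indicator (box a b) x * h x)"])
    have "?\<phi> n \<in> borel_measurable lebesgue" for n
      using test_function_continuous[OF box_indicator_approx_test_function[OF sub], of n]
      by (intro measurable_completion) (simp add: borel_measurable_continuous_onI)
    then show "(\<lambda>x. ?\<phi> n x * (indicator (box a b) x * h x)) \<in> borel_measurable lebesgue" for n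
      by (rule borel_measurable_times[OF _ borel_measurable_integrable[OF i]])
    show "AE x in lebesgue. (\<lambda>n. ?\<phi> n x * (indicator (box a b) x * h x)) \<longlonglongrightarrow> indicator (box a b) x * h x"
    proof (rule AE_I2)
      fix x
      have "(\<lambda>n. ?\<phi> n x * (indicator (box a b) x * h x)) \<longlonglongrightarrow> indicator (box a b) x * (indicator (box a b) x * h x)"
        by (intro tendsto_mult box_indicator_approx_tendsto tendsto_const)
      then show "(\<lambda>n. ?\<phi> n x * (indicator (box a b) x * h x)) \<longlonglongrightarrow> indicator (box a b) x * h x"
        by (simp only: mult.assoc[symmetric] indicator_inter_arith[symmetric] Int_absorb)
    qed
    show "AE x in lebesgue. norm (?\<phi> n x * (indicator (box a b) x * h x)) \<le> norm (indicator (box a b) x * h x)" for n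
      using \<phi>01 by (intro AE_I2) (auto simp: abs_mult intro!: mult_left_le_one_le)
  qed (use i in auto)
  then show "(LINT x|lebesgue. indicator (box a b) x * h x) = 0"
    by (simp only: zero LIMSEQ_const_iff)
qed

text \<open>Every box, intersected with the fixed box, is a box whose closure still lies in \<open>\<Omega>\<close>; therefore
  testing inside the fixed box suffices. Passing to a Borel version of \<open>h\<close> makes the Dynkin argument
  applicable to the completed measure.\<close>

lemma AE_0_on_box_if_orthogonal:
  fixes h :: "real^'n \<Rightarrow> real"
  assumes \<Omega>: "\<Omega> \<in> sets lebesgue" and h: "locally_integrable \<Omega> h"
    and orth: "\<And>\<phi>. \<phi> \<in> test_functions \<Omega> \<Longrightarrow> (LINT x|lebesgue_on \<Omega>. h x * \<phi> x) = 0"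
    and sub: "cbox a b \<subseteq> \<Omega>"
  shows "AE x in lebesgue. x \<in> box a b \<longrightarrow> h x = 0"
proof -
  let ?H = "\<lambda>x. indicator (box a b) x * h x"
  note I = integral_box_eq_0_if_orthogonal[OF \<Omega> h orth]
  have H: "integrable lebesgue ?H" and H0: "(LINT x|lebesgue. ?H x) = 0"
    using I[OF _ sub] by auto
  obtain g where g: "g \<in> borel_measurable lborel" and eq: "AE x in lborel. ?H x = g x"
    using completion_ex_borel_measurable_real[of ?H lborel] H by auto
  have eq': "AE x in lebesgue. ?H x = g x" using eq by (rule AE_completion)
  have gm: "g \<in> borel_measurable lebesgue" using g by (rule measurable_completion)
  have transfer: "(LINT x|lborel. indicator A x * g x) = (LINT x|lebesgue. indicator A x * ?H x)"
    if A: "A \<in> sets borel" for A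
  proof -
    have "(LINT x|lborel. indicator A x * g x) = (LINT x|lebesgue. indicator A x * g x)"
      using g A by (intro integral_completion[symmetric]) auto
    also have "\<dots> = (LINT x|lebesgue. indicator A x * ?H x)"
    proof (rule integral_cong_AE)
      have "indicator A \<in> borel_measurable lebesgue"
        using A by (intro borel_measurable_indicator) auto
      then show "(\<lambda>x. indicator A x * g x) \<in> borel_measurable lebesgue"
        "(\<lambda>x. indicator A x * ?H x) \<in> borel_measurable lebesgue"
        using gm borel_measurable_integrable[OF H] by (auto intro: borel_measurable_times)
    qed (use eq' in auto)
    finally show ?thesis .
  qed
  have "integrable lebesgue g"
    using integrable_cong_AE[THEN iffD1, OF _ gm eq' H] H by auto
  then have gi: "integrable lborel g"
    using g by (simp add: integrable_completion)
  have "AE x in lborel. g x = 0"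
  proof (rule AE_0_if_box_integrals_0[OF gi])
    show "(LINT x|lborel. g x) = 0"
      using transfer[of UNIV] H0 by simp
    fix c d :: "real^'n"
    obtain c' d' where cd: "box c d \<inter> box a b = box c' d'" by (use box_Int_box[of c d a b] in blast)
    have "(LINT x|lborel. indicator (box c d) x * g x) = (LINT x|lebesgue. indicator (box c d) x * ?H x)"
      by (rule transfer) auto
    also have "\<dots> = (LINT x|lebesgue. indicator (box c' d') x * h x)"
      by (intro Bochner_Integration.integral_cong) (auto simp: cd[symmetric] indicator_def)
    also have "\<dots> = 0"
    proof (cases "box c' d' = {}")
      case False
      then have "cbox c' d' = closure (box c' d')" by (simp add: closure_box)
      also have "\<dots> \<subseteq> closure (box a b)" using cd by (intro closure_mono) auto
      also have "\<dots> \<subseteq> cbox a b" by (intro closure_minimal box_subset_cbox closed_cbox)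
      finally show ?thesis using I(2) sub by blast
    qed simp
    finally show "(LINT x|lborel. indicator (box c d) x * g x) = 0" .
  qed
  then have "AE x in lebesgue. g x = 0" by (rule AE_completion)
  with eq' show ?thesis
    by eventually_elim (auto simp: indicator_def)
qed

lemma AE_lebesgue_on_open_if_locally:
  fixes \<Omega> :: "'a::euclidean_space set"
  assumes "open \<Omega>" and loc: "\<And>a b. cbox a b \<subseteq> \<Omega> \<Longrightarrow> AE x in lebesgue. x \<in> box a b \<longrightarrow> P x"
  shows "AE x in lebesgue_on \<Omega>. P x"
proof -
  let ?F = "{(a, b). cbox a b \<subseteq> \<Omega>}"
  have "\<Omega> \<subseteq> (\<Union>(a, b)\<in>?F. box a b)"
  proof
    fix x assume "x \<in> \<Omega>"
    then obtain a b where "x \<in> box a b" "cbox a b \<subseteq> \<Omega>"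
      using assms(1) open_contains_cbox by metis
    then show "x \<in> (\<Union>(a, b)\<in>?F. box a b)" by auto
  qed
  moreover obtain F' where F': "F' \<subseteq> (\<lambda>(a,b). box a b) ` ?F" "countable F'" "\<Union>F' = (\<Union>(a, b)\<in>?F. box a b)"
  proof (rule Lindelof[of "(\<lambda>(a,b). box a b) ` ?F"])
    show "\<And>S. S \<in> (\<lambda>(a,b). box a b) ` ?F \<Longrightarrow> open S" by auto
  qed
  ultimately have sub: "\<Omega> \<subseteq> \<Union>F'" by simp
  have "AE x in lebesgue. \<forall>B\<in>F'. x \<in> B \<longrightarrow> P x"
    using F'(2) by (subst AE_ball_countable) (use F'(1) loc in auto)
  then have "AE x in lebesgue. x \<in> \<Omega> \<longrightarrow> P x"
    by eventually_elim (use sub in blast)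
  then show ?thesis
    using assms(1) by (subst AE_restrict_space_iff) auto
qed

lemma fundamental_lemma_calculus_of_variations:
  fixes h :: "real^'n \<Rightarrow> real"
  assumes "open \<Omega>" and h: "locally_integrable \<Omega> h"
    and orth: "\<And>\<phi>. \<phi> \<in> test_functions \<Omega> \<Longrightarrow> (LINT x|lebesgue_on \<Omega>. h x * \<phi> x) = 0"
  shows "AE x in lebesgue_on \<Omega>. h x = 0"
  using assms by (intro AE_lebesgue_on_open_if_locally AE_0_on_box_if_orthogonal) auto

section \<open>Minkowski inequality and inclusions of Lebesgue spaces\<close>

text \<open>Convexity of \<open>t\<^sup>s\<close> at \<open>x/a\<close> and \<open>y/b\<close> with weights \<open>a/(a+b)\<close> and \<open>b/(a+b)\<close>. For \<open>a\<close> and \<open>b\<close>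
  close to the norms of two functions, integrating it gives the Minkowski inequality.\<close>

lemma powr_add_le_weighted:
  fixes x y a b s :: real
  assumes "0 \<le> x" "0 \<le> y" "0 < a" "0 < b" "1 \<le> s"
  shows "(x + y) powr s \<le> (a + b) powr (s - 1) * (a powr (1 - s) * x powr s + b powr (1 - s) * y powr s)"
proof -
  have one: "z powr s \<le> (c + d) powr (s - 1) * (c powr (1 - s) * z powr s)"
    if "0 \<le> z" "0 < c" "0 < d" for z c d
  proof -
    have "c powr (s - 1) * c powr (1 - s) = 1"
      using that by (simp add: powr_add[symmetric])
    moreover have "c powr (s - 1) * c powr (1 - s) \<le> (c + d) powr (s - 1) * c powr (1 - s)"
      using that assms by (intro mult_right_mono powr_mono2) auto
    ultimately have "1 * z powr s \<le> ((c + d) powr (s - 1) * c powr (1 - s)) * z powr s"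
      by (intro mult_right_mono) auto
    then show ?thesis by (simp add: mult.assoc)
  qed
  consider "x = 0" | "y = 0" | "x > 0" "y > 0" using assms by linarith
  then show ?thesis
  proof cases
    case 1
    then show ?thesis using one[of y b a] assms by (simp add: add.commute)
  next
    case 2
    then show ?thesis using one[of x a b] assms by simp
  next
    case 3
    let ?t = "b / (a + b)"
    have t: "1 - ?t = a / (a + b)" using assms by (simp add: field_simps)
    have "((1 - ?t) *\<^sub>R (x / a) + ?t *\<^sub>R (y / b)) powr s
        \<le> (1 - ?t) * (x / a) powr s + ?t * (y / b) powr s"
      by (rule convex_onD[OF powr_convex]) (use assms 3 in auto)
    moreover have "(1 - ?t) *\<^sub>R (x / a) + ?t *\<^sub>R (y / b) = (x + y) / (a + b)"
      using assms unfolding t by (simp add: add_divide_distrib)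
    ultimately have "(a + b) powr s * ((x + y) / (a + b)) powr s
       \<le> (a + b) powr s * (a / (a + b) * (x / a) powr s + b / (a + b) * (y / b) powr s)"
      by (intro mult_left_mono) (auto simp: t)
    moreover have "(a + b) powr s * ((x + y) / (a + b)) powr s = (x + y) powr s"
      using assms by (simp add: powr_mult[symmetric])
    moreover have "(a + b) powr s * (a / (a + b) * (x / a) powr s + b / (a + b) * (y / b) powr s)
      = (a + b) powr (s - 1) * (a powr (1 - s) * x powr s + b powr (1 - s) * y powr s)"
    proof -
      have aux: "X * (a / A * (p / P) + b / A * (r / R)) = X / A * (a / P * p + b / R * r)" for X A p P r R :: real
        by (simp add: divide_inverse algebra_simps)
      show ?thesis
        using assms 3 aux[of "(a + b) powr s" "a + b" "x powr s" "a powr s" "y powr s" "b powr s"]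
        by (simp add: powr_divide powr_diff)
    qed
    ultimately show ?thesis by simp
  qed
qed

lemma norm_add_powr_le:
  fixes f g :: "'b::real_normed_vector"
  assumes "0 < a" "0 < b" "1 \<le> s"
  shows "norm (f + g) powr s
    \<le> (a + b) powr (s - 1) * (a powr (1 - s) * norm f powr s + b powr (1 - s) * norm g powr s)"
proof -
  have "norm (f + g) powr s \<le> (norm f + norm g) powr s"
    using assms by (intro powr_mono2 norm_triangle_ineq) auto
  also have "\<dots> \<le> (a + b) powr (s - 1) * (a powr (1 - s) * norm f powr s + b powr (1 - s) * norm g powr s)"
    using assms by (intro powr_add_le_weighted) auto
  finally show ?thesis .
qed

lemma L_space_measurable: "f \<in> L_space \<Omega> s \<Longrightarrow> f \<in> borel_measurable (lebesgue_on \<Omega>)"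
  and L_space_integrable: "f \<in> L_space \<Omega> s \<Longrightarrow> integrable (lebesgue_on \<Omega>) (\<lambda>x. norm (f x) powr s)"
  by (auto simp: L_space_def)

lemma L_space_add:
  assumes f: "f \<in> L_space \<Omega> s" and g: "g \<in> L_space \<Omega> s" and s: "1 \<le> s"
  shows "(\<lambda>x. f x + g x) \<in> L_space \<Omega> s"
  unfolding L_space_def
proof safe
  note [measurable] = L_space_measurable[OF f] L_space_measurable[OF g]
  show "(\<lambda>x. f x + g x) \<in> borel_measurable (lebesgue_on \<Omega>)" by measurable
  show "integrable (lebesgue_on \<Omega>) (\<lambda>x. norm (f x + g x) powr s)"
  proof (rule Bochner_Integration.integrable_bound)
    show "integrable (lebesgue_on \<Omega>) (\<lambda>x. 2 powr (s - 1) * (norm (f x) powr s + norm (g x) powr s))"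
      using f g by (intro integrable_mult_right integrable_add) (auto simp: L_space_def)
    show "AE x in lebesgue_on \<Omega>. norm (norm (f x + g x) powr s) \<le> norm (2 powr (s - 1) * (norm (f x) powr s + norm (g x) powr s))"
      using norm_add_powr_le[of 1 1 s] s by (intro AE_I2) simp
  qed measurable
qed

lemma L_space_scale:
  assumes f: "f \<in> L_space \<Omega> s"
  shows "(\<lambda>x. c *\<^sub>R f x) \<in> L_space \<Omega> s"
  using f by (auto simp: L_space_def powr_mult)

lemma L_norm_nonneg: "0 \<le> L_norm \<Omega> s f"
  by (simp add: L_norm_def)

lemma L_norm_powr: "1 \<le> s \<Longrightarrow> L_norm \<Omega> s f powr s = (LINT x|lebesgue_on \<Omega>. norm (f x) powr s)"
  by (simp add: L_norm_def powr_powr)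

lemma L_norm_le_iff: "1 \<le> s \<Longrightarrow> 0 \<le> c \<Longrightarrow> L_norm \<Omega> s f \<le> c \<longleftrightarrow> (LINT x|lebesgue_on \<Omega>. norm (f x) powr s) \<le> c powr s"
  using powr_mono2[of s "L_norm \<Omega> s f" c] powr_less_mono2[of s c "L_norm \<Omega> s f"]
  by (force simp: L_norm_powr L_norm_nonneg not_le)

lemma L_norm_scale:
  assumes "1 \<le> s"
  shows "L_norm \<Omega> s (\<lambda>x. c *\<^sub>R f x) = \<bar>c\<bar> * L_norm \<Omega> s f"
  using assms by (simp add: L_norm_def powr_mult powr_powr)

text \<open>The weights are taken slightly larger than the norms, which avoids a case distinction on
  vanishing norms.\<close>

lemma L_norm_triangle:
  assumes f: "f \<in> L_space \<Omega> s" and g: "g \<in> L_space \<Omega> s" and s: "1 \<le> s"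
  shows "L_norm \<Omega> s (\<lambda>x. f x + g x) \<le> L_norm \<Omega> s f + L_norm \<Omega> s g"
proof (rule field_le_epsilon)
  fix e :: real assume e: "e > 0"
  let ?M = "lebesgue_on \<Omega>"
  define a b where "a = L_norm \<Omega> s f + e / 2" and "b = L_norm \<Omega> s g + e / 2"
  have ab: "a > 0" "b > 0" using e by (auto simp: a_def b_def add_nonneg_pos L_norm_nonneg)
  have If: "(LINT x|?M. norm (f x) powr s) \<le> a powr s" and Ig: "(LINT x|?M. norm (g x) powr s) \<le> b powr s"
    using s ab e by (auto simp: L_norm_le_iff[symmetric] a_def b_def)
  have "(LINT x|?M. norm (f x + g x) powr s)
     \<le> (LINT x|?M. (a + b) powr (s - 1) * (a powr (1 - s) * norm (f x) powr s + b powr (1 - s) * norm (g x) powr s))"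
    using L_space_add[OF f g s] f g ab s norm_add_powr_le
    by (intro integral_mono integrable_mult_right integrable_add) (auto simp: L_space_def)
  also have "\<dots> = (a + b) powr (s - 1) * (a powr (1 - s) * (LINT x|?M. norm (f x) powr s) + b powr (1 - s) * (LINT x|?M. norm (g x) powr s))"
    using f g by (simp add: L_space_def)
  also have "\<dots> \<le> (a + b) powr (s - 1) * (a powr (1 - s) * a powr s + b powr (1 - s) * b powr s)"
    using If Ig by (intro mult_left_mono add_mono) auto
  also have "\<dots> = (a + b) powr s"
    using ab by (simp add: powr_add[symmetric] powr_diff)
  finally have "L_norm \<Omega> s (\<lambda>x. f x + g x) \<le> a + b"
    using ab s by (simp add: L_norm_le_iff)
  then show "L_norm \<Omega> s (\<lambda>x. f x + g x) \<le> L_norm \<Omega> s f + L_norm \<Omega> s g + e"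
    by (simp add: a_def b_def)
qed

lemma L_norm_eq_0D:
  assumes "f \<in> L_space \<Omega> s" "L_norm \<Omega> s f = 0"
  shows "AE x in lebesgue_on \<Omega>. f x = 0"
proof -
  have "(LINT x|lebesgue_on \<Omega>. norm (f x) powr s) = 0"
    using assms(2) by (simp add: L_norm_def)
  then have "AE x in lebesgue_on \<Omega>. norm (f x) powr s = 0"
    using integral_nonneg_eq_0_iff_AE[OF L_space_integrable[OF assms(1)]] by simp
  then show ?thesis by eventually_elim simp
qed

text \<open>Completeness of the Lebesgue measure: measurability depends on the class modulo null sets only.\<close>

lemma borel_measurable_lebesgue_on_AE:
  fixes f g :: "'a::euclidean_space \<Rightarrow> 'b::euclidean_space"
  assumes S: "S \<in> sets lebesgue" and f: "f \<in> borel_measurable (lebesgue_on S)"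
    and ae: "AE x in lebesgue_on S. f x = g x"
  shows "g \<in> borel_measurable (lebesgue_on S)"
proof -
  have "(\<lambda>x. indicator S x *\<^sub>R f x) \<in> borel_measurable lebesgue"
    using f S borel_measurable_restrict_space_iff[of S lebesgue f] by simp
  moreover have "AE x in lebesgue. indicator S x *\<^sub>R f x = indicator S x *\<^sub>R g x"
    using ae S by (subst (asm) AE_restrict_space_iff) (auto elim!: eventually_mono simp: indicator_def)
  ultimately have "(\<lambda>x. indicator S x *\<^sub>R g x) \<in> borel_measurable lebesgue"
    by (rule borel_measurable_AE)
  then show ?thesis
    using S borel_measurable_restrict_space_iff[of S lebesgue g] by simp
qed

text \<open>If one of the integrands is not measurable, then by completeness neither is the other, and both
  integrals have the default value 0.\<close>

lemma L_norm_cong_AE: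
  fixes f g :: "real^'n \<Rightarrow> 'b::euclidean_space"
  assumes \<Omega>: "\<Omega> \<in> sets lebesgue" and ae: "AE x in lebesgue_on \<Omega>. f x = g x"
  shows "L_norm \<Omega> s f = L_norm \<Omega> s g"
proof -
  let ?f = "\<lambda>x. norm (f x) powr s" and ?g = "\<lambda>x. norm (g x) powr s"
  have ae1: "AE x in lebesgue_on \<Omega>. ?f x = ?g x" and ae2: "AE x in lebesgue_on \<Omega>. ?g x = ?f x"
    using ae by (eventually_elim, simp)+
  have "(LINT x|lebesgue_on \<Omega>. ?f x) = (LINT x|lebesgue_on \<Omega>. ?g x)"
  proof (cases "?f \<in> borel_measurable (lebesgue_on \<Omega>)")
    case True
    then show ?thesis
      using borel_measurable_lebesgue_on_AE[OF \<Omega> True ae1] ae1 by (intro integral_cong_AE)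
  next
    case False
    then have "?g \<notin> borel_measurable (lebesgue_on \<Omega>)"
      using borel_measurable_lebesgue_on_AE[OF \<Omega> _ ae2] by blast
    then have "\<not> integrable (lebesgue_on \<Omega>) ?f" "\<not> integrable (lebesgue_on \<Omega>) ?g"
      using False by (auto dest: borel_measurable_integrable)
    then show ?thesis by (simp add: not_integrable_integral_eq)
  qed
  then show ?thesis by (simp add: L_norm_def)
qed

lemma L_space_cong_AE:
  assumes "\<Omega> \<in> sets lebesgue" "f \<in> L_space \<Omega> s" "AE x in lebesgue_on \<Omega>. f x = g x"
  shows "g \<in> L_space \<Omega> s"
proof -
  have f[measurable]: "f \<in> borel_measurable (lebesgue_on \<Omega>)"
    using assms by (auto simp: L_space_def)
  have g[measurable]: "g \<in> borel_measurable (lebesgue_on \<Omega>)"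
    by (rule borel_measurable_lebesgue_on_AE[OF assms(1) f assms(3)])
  have "integrable (lebesgue_on \<Omega>) (\<lambda>x. norm (g x) powr s)"
    by (rule integrable_cong_AE_imp[OF L_space_integrable[OF assms(2)]]) (use assms(3) in auto)
  then show ?thesis using g by (simp add: L_space_def)
qed

lemma finite_measure_lebesgue_on_bounded:
  assumes "bounded \<Omega>" "\<Omega> \<in> sets lebesgue"
  shows "finite_measure (lebesgue_on \<Omega>)"
  using assms by (intro finite_measure_lebesgue_on bounded_set_imp_lmeasurable)

text \<open>For \<open>t \<le> \<eta>\<close> the first term suffices, otherwise the second. The first term is small and the
  second is controlled by the larger exponent, so this takes the place of the Hoelder inequality
  in comparing \<open>L\<^sup>q\<close> with \<open>L\<^sup>r\<close> on a bounded set.\<close>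

lemma powr_le_eps_powr:
  fixes t \<eta> q r :: real
  assumes "0 \<le> t" "0 < \<eta>" "0 < q" "q \<le> r"
  shows "t powr q \<le> \<eta> powr q + \<eta> powr (q - r) * t powr r"
proof (cases "t \<le> \<eta>")
  case True
  then show ?thesis using powr_mono2[of q t \<eta>] assms
    by (smt (verit) powr_ge_zero mult_nonneg_nonneg)
next
  case False
  then have "t powr q = t powr (q - r) * t powr r"
    by (simp add: powr_add[symmetric])
  also have "\<dots> \<le> \<eta> powr (q - r) * t powr r"
    using False assms by (intro mult_right_mono powr_mono2') auto
  finally show ?thesis by (smt (verit) powr_ge_zero)
qed

lemma L_space_mono:
  assumes \<Omega>: "bounded \<Omega>" "\<Omega> \<in> sets lebesgue" and "0 < q" "q \<le> r" and f: "f \<in> L_space \<Omega> r"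
  shows "f \<in> L_space \<Omega> q"
proof -
  interpret finite_measure "lebesgue_on \<Omega>" using \<Omega> by (rule finite_measure_lebesgue_on_bounded)
  note [measurable] = L_space_measurable[OF f]
  have "integrable (lebesgue_on \<Omega>) (\<lambda>x. norm (f x) powr q)"
  proof (rule Bochner_Integration.integrable_bound)
    show "integrable (lebesgue_on \<Omega>) (\<lambda>x. 1 + norm (f x) powr r)"
      using L_space_integrable[OF f] by simp
    show "AE x in lebesgue_on \<Omega>. norm (norm (f x) powr q) \<le> norm (1 + norm (f x) powr r)"
      using powr_le_eps_powr[of "norm (f _)" 1 q r] assms by (intro AE_I2) simp
  qed measurable
  then show ?thesis using L_space_measurable[OF f] by (simp add: L_space_def)
qed

text \<open>Continuity of the inclusion of \<open>L\<^sup>r\<close> into \<open>L\<^sup>q\<close> at 0, which is all that a linear inclusion needs.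
  The measure of \<open>\<Omega>\<close> determines \<open>\<eta>\<close> in \<open>powr_le_eps_powr\<close>, and then \<open>\<eta>\<close> determines \<open>d\<close>.\<close>

lemma L_norm_small_mono:
  fixes \<Omega> :: "(real^'n) set"
  assumes \<Omega>: "bounded \<Omega>" "\<Omega> \<in> sets lebesgue" and qr: "1 \<le> q" "q \<le> r" and e: "0 < e"
  obtains d where "d > 0" "\<And>f :: real^'n \<Rightarrow> 'b::euclidean_space. f \<in> L_space \<Omega> r \<Longrightarrow> L_norm \<Omega> r f < d \<Longrightarrow> L_norm \<Omega> q f < e"
proof -
  interpret finite_measure "lebesgue_on \<Omega>" using \<Omega> by (rule finite_measure_lebesgue_on_bounded)
  define m where "m = measure (lebesgue_on \<Omega>) \<Omega>"
  define e' where "e' = e / 2"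
  have e': "0 < e'" "e' < e" using e by (auto simp: e'_def)
  define \<eta> where "\<eta> = (e' powr q / (2 * (m + 1))) powr (1 / q)"
  have m: "m \<ge> 0" by (simp add: m_def)
  have \<eta>: "\<eta> > 0" using e' m by (simp add: \<eta>_def)
  have \<eta>q: "\<eta> powr q * m \<le> e' powr q / 2"
  proof -
    have "\<eta> powr q = e' powr q / (2 * (m + 1))"
      using qr m by (simp add: \<eta>_def powr_powr)
    then have "\<eta> powr q * m = e' powr q / 2 * (m / (m + 1))" by simp
    also have "\<dots> \<le> e' powr q / 2 * 1" using m by (intro mult_left_mono) auto
    finally show ?thesis by simp
  qed
  define d where "d = (e' powr q / (2 * \<eta> powr (q - r))) powr (1 / r)"
  have d: "d > 0" using e' \<eta> by (simp add: d_def)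
  have dr: "\<eta> powr (q - r) * d powr r = e' powr q / 2"
    using qr \<eta> by (simp add: d_def powr_powr)
  show ?thesis
  proof (rule that[OF d])
    fix f :: "real^'n \<Rightarrow> 'b" assume f: "f \<in> L_space \<Omega> r" and small: "L_norm \<Omega> r f < d"
    have Ir: "(LINT x|lebesgue_on \<Omega>. norm (f x) powr r) \<le> d powr r"
      using small qr d by (simp add: L_norm_le_iff[symmetric])
    have fq: "f \<in> L_space \<Omega> q" using L_space_mono[OF \<Omega> _ _ f] qr by simp
    have "(LINT x|lebesgue_on \<Omega>. norm (f x) powr q) \<le> (LINT x|lebesgue_on \<Omega>. \<eta> powr q + \<eta> powr (q - r) * norm (f x) powr r)"
      using L_space_integrable[OF f] L_space_integrable[OF fq] powr_le_eps_powr[of "norm (f _)" \<eta> q r] qr \<eta>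
      by (intro integral_mono) auto
    also have "\<dots> = \<eta> powr q * m + \<eta> powr (q - r) * (LINT x|lebesgue_on \<Omega>. norm (f x) powr r)"
      using L_space_integrable[OF f] \<Omega>(2) by (simp add: m_def space_restrict_space)
    also have "\<dots> \<le> e' powr q / 2 + \<eta> powr (q - r) * d powr r"
      using \<eta>q Ir by (intro add_mono mult_left_mono) auto
    also have "\<dots> = e' powr q" using dr by simp
    finally have "L_norm \<Omega> q f \<le> e'" using e' qr by (simp add: L_norm_le_iff)
    then show "L_norm \<Omega> q f < e" using e' by simp
  qed
qed

lemma continuous_compact_support_L_space:
  assumes \<Omega>: "bounded \<Omega>" "\<Omega> \<in> sets lebesgue" and s: "1 \<le> s"
    and f: "continuous_on UNIV f" "compact K" "\<And>x. x \<notin> K \<Longrightarrow> f x = 0"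
  shows "f \<in> L_space \<Omega> s"
proof -
  interpret finite_measure "lebesgue_on \<Omega>" using \<Omega> by (rule finite_measure_lebesgue_on_bounded)
  obtain B where B: "B > 0" "\<And>x. norm (f x) \<le> B"
    using continuous_compact_support_bounded[OF f] by blast
  have m[measurable]: "f \<in> borel_measurable (lebesgue_on \<Omega>)"
    by (intro measurable_restrict_space1 measurable_completion) (simp add: f(1) borel_measurable_continuous_onI)
  have "integrable (lebesgue_on \<Omega>) (\<lambda>x. norm (f x) powr s)"
    by (rule integrable_const_bound[where B="B powr s"]) (use B s in \<open>auto intro!: powr_mono2\<close>)
  then show ?thesis using m by (simp add: L_space_def)
qed

section \<open>Weak gradients\<close>

lemma integrable_times_compact_support:
  fixes u :: "real^'n \<Rightarrow> real"
  assumes \<Omega>: "\<Omega> \<in> sets lebesgue" and u: "locally_integrable \<Omega> u"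
    and \<psi>: "continuous_on UNIV \<psi>" "compact K" "K \<subseteq> \<Omega>" "\<And>x. x \<notin> K \<Longrightarrow> \<psi> x = 0"
  shows "integrable (lebesgue_on \<Omega>) (\<lambda>x. u x * \<psi> x)"
proof -
  obtain B where B: "B > 0" "\<And>x. norm (\<psi> x) \<le> B"
    using continuous_compact_support_bounded[OF \<psi>(1,2,4)] by blast
  have Ks: "K \<in> sets lebesgue" using \<psi>(2) by (auto intro: fmeasurableD lmeasurable_compact)
  have "integrable (lebesgue_on K) u"
    using u \<psi> by (simp add: locally_integrable_def)
  then have i: "integrable lebesgue (\<lambda>x. indicator K x *\<^sub>R u x)"
    using Ks by (subst (asm) integrable_restrict_space) auto
  have m: "\<psi> \<in> borel_measurable lebesgue"
    by (intro measurable_completion) (simp add: \<psi>(1) borel_measurable_continuous_onI)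
  have "integrable lebesgue (\<lambda>x. (indicator K x *\<^sub>R u x) * \<psi> x)"
  proof (rule Bochner_Integration.integrable_bound)
    show "integrable lebesgue (\<lambda>x. B * norm (indicator K x *\<^sub>R u x))"
      by (intro integrable_mult_right integrable_norm i)
    show "(\<lambda>x. (indicator K x *\<^sub>R u x) * \<psi> x) \<in> borel_measurable lebesgue"
      by (rule borel_measurable_times[OF borel_measurable_integrable[OF i] m])
    show "AE x in lebesgue. norm ((indicator K x *\<^sub>R u x) * \<psi> x) \<le> norm (B * norm (indicator K x *\<^sub>R u x))"
      using B by (intro AE_I2) (auto simp: abs_mult mult.commute[of _ "\<bar>\<psi> _\<bar>"] intro!: mult_right_mono)
  qed
  moreover have "(\<lambda>x. (indicator K x *\<^sub>R u x) * \<psi> x) = (\<lambda>x. indicator \<Omega> x *\<^sub>R (u x * \<psi> x))"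
    using \<psi>(3,4) by (force simp: indicator_def fun_eq_iff)
  ultimately show ?thesis
    using \<Omega> by (subst integrable_restrict_space) auto
qed

lemma locally_integrable_component:
  fixes g :: "real^'n \<Rightarrow> real^'n"
  shows "locally_integrable \<Omega> g \<Longrightarrow> locally_integrable \<Omega> (\<lambda>x. g x $ i)"
  by (auto simp: locally_integrable_def intro: integrable_bounded_linear[OF bounded_linear_vec_nth])

lemma locally_integrable_lincomb:
  assumes "locally_integrable \<Omega> f" "locally_integrable \<Omega> g"
  shows "locally_integrable \<Omega> (\<lambda>x. a *\<^sub>R f x + b *\<^sub>R g x)"
  using assms by (auto simp: locally_integrable_def)

lemma is_weak_gradient_integrable:
  assumes \<Omega>: "\<Omega> \<in> sets lebesgue" and w: "is_weak_gradient \<Omega> u g" and \<phi>: "\<phi> \<in> test_functions \<Omega>"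
  shows "integrable (lebesgue_on \<Omega>) (\<lambda>x. u x * grad \<phi> x $ i)"
    and "integrable (lebesgue_on \<Omega>) (\<lambda>x. g x $ i * \<phi> x)"
proof -
  obtain K where K: "compact K" "K \<subseteq> \<Omega>" "\<And>x. x \<notin> K \<Longrightarrow> \<phi> x = 0" "\<And>x. x \<notin> K \<Longrightarrow> grad \<phi> x = 0"
    using test_function_support[OF \<phi>] by metis
  have l: "locally_integrable \<Omega> u" "locally_integrable \<Omega> (\<lambda>x. g x $ i)"
    using w by (auto simp: is_weak_gradient_def intro: locally_integrable_component)
  show "integrable (lebesgue_on \<Omega>) (\<lambda>x. u x * grad \<phi> x $ i)"
    by (rule integrable_times_compact_support[OF \<Omega> l(1) _ K(1,2)])
      (auto simp: K(4) intro!: continuous_intros test_function_grad_continuous[OF \<phi>])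
  show "integrable (lebesgue_on \<Omega>) (\<lambda>x. g x $ i * \<phi> x)"
    by (rule integrable_times_compact_support[OF \<Omega> l(2) test_function_continuous[OF \<phi>] K(1,2,3)])
qed

lemma is_weak_gradient_lincomb:
  assumes \<Omega>: "\<Omega> \<in> sets lebesgue" and u: "is_weak_gradient \<Omega> u g" and v: "is_weak_gradient \<Omega> v h"
  shows "is_weak_gradient \<Omega> (\<lambda>x. a * u x + b * v x) (\<lambda>x. a *\<^sub>R g x + b *\<^sub>R h x)"
  unfolding is_weak_gradient_def
proof (intro conjI ballI allI)
  show "locally_integrable \<Omega> (\<lambda>x. a * u x + b * v x)" "locally_integrable \<Omega> (\<lambda>x. a *\<^sub>R g x + b *\<^sub>R h x)"
    using u v locally_integrable_lincomb[of \<Omega> u v] locally_integrable_lincomb[of \<Omega> g h]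
    by (auto simp: is_weak_gradient_def)
  fix \<phi> i assume \<phi>: "\<phi> \<in> test_functions \<Omega>"
  note iu = is_weak_gradient_integrable[OF \<Omega> u \<phi>, of i] and iv = is_weak_gradient_integrable[OF \<Omega> v \<phi>, of i]
  have eu: "(LINT x|lebesgue_on \<Omega>. u x * grad \<phi> x $ i) = - (LINT x|lebesgue_on \<Omega>. g x $ i * \<phi> x)"
    and ev: "(LINT x|lebesgue_on \<Omega>. v x * grad \<phi> x $ i) = - (LINT x|lebesgue_on \<Omega>. h x $ i * \<phi> x)"
    using u v \<phi> by (auto simp: is_weak_gradient_def)
  have "(LINT x|lebesgue_on \<Omega>. (a * u x + b * v x) * grad \<phi> x $ i)
      = (LINT x|lebesgue_on \<Omega>. a * (u x * grad \<phi> x $ i) + b * (v x * grad \<phi> x $ i))"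
    by (simp add: algebra_simps)
  also have "\<dots> = - (LINT x|lebesgue_on \<Omega>. a * (g x $ i * \<phi> x) + b * (h x $ i * \<phi> x))"
    using iu iv by (simp add: eu ev)
  also have "\<dots> = - (LINT x|lebesgue_on \<Omega>. (a *\<^sub>R g x + b *\<^sub>R h x) $ i * \<phi> x)"
    by (simp add: algebra_simps)
  finally show "(LINT x|lebesgue_on \<Omega>. (a * u x + b * v x) * grad \<phi> x $ i)
      = - (LINT x|lebesgue_on \<Omega>. (a *\<^sub>R g x + b *\<^sub>R h x) $ i * \<phi> x)" .
qed

lemma is_weak_gradient_unique_AE:
  assumes "open \<Omega>" and g: "is_weak_gradient \<Omega> u g" and h: "is_weak_gradient \<Omega> u h"
  shows "AE x in lebesgue_on \<Omega>. g x = h x"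
proof -
  have \<Omega>: "\<Omega> \<in> sets lebesgue" using assms(1) by auto
  have d: "is_weak_gradient \<Omega> (\<lambda>x. 1 * u x + (-1) * u x) (\<lambda>x. 1 *\<^sub>R g x + (-1) *\<^sub>R h x)"
    by (rule is_weak_gradient_lincomb[OF \<Omega> g h])
  have "AE x in lebesgue_on \<Omega>. (1 *\<^sub>R g x + (-1) *\<^sub>R h x) $ i = 0" for i
  proof (rule fundamental_lemma_calculus_of_variations[OF assms(1)])
    show "locally_integrable \<Omega> (\<lambda>x. (1 *\<^sub>R g x + (-1) *\<^sub>R h x) $ i)"
      using d unfolding is_weak_gradient_def by (intro locally_integrable_component) simp
    show "(LINT x|lebesgue_on \<Omega>. (1 *\<^sub>R g x + (-1) *\<^sub>R h x) $ i * \<phi> x) = 0" if "\<phi> \<in> test_functions \<Omega>" for \<phi>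
    proof -
      have "(LINT x|lebesgue_on \<Omega>. (1 * u x + (-1) * u x) * grad \<phi> x $ i)
         = - (LINT x|lebesgue_on \<Omega>. (1 *\<^sub>R g x + (-1) *\<^sub>R h x) $ i * \<phi> x)"
        using d that unfolding is_weak_gradient_def by blast
      then show ?thesis by simp
    qed
  qed
  then have "AE x in lebesgue_on \<Omega>. \<forall>i. (1 *\<^sub>R g x + (-1) *\<^sub>R h x) $ i = 0"
    by (simp add: AE_all_countable)
  then show ?thesis by eventually_elim (simp add: vec_eq_iff)
qed

lemma locally_integrable_cong_AE:
  assumes \<Omega>: "\<Omega> \<in> sets lebesgue" and f: "locally_integrable \<Omega> f" and ae: "AE x in lebesgue_on \<Omega>. f x = g x"
  shows "locally_integrable \<Omega> g"
  unfolding locally_integrable_def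
proof safe
  fix K assume K: "compact K" "K \<subseteq> \<Omega>"
  have Ks: "K \<in> sets lebesgue" using K by (auto intro: fmeasurableD lmeasurable_compact)
  have i: "integrable (lebesgue_on K) f" using f K by (simp add: locally_integrable_def)
  have a: "AE x in lebesgue_on K. f x = g x"
    using ae \<Omega> Ks K(2) by (auto simp: AE_restrict_space_iff elim!: eventually_mono)
  show "integrable (lebesgue_on K) g"
    by (rule integrable_cong_AE_imp[OF i])
      (use a borel_measurable_lebesgue_on_AE[OF Ks borel_measurable_integrable[OF i] a] in auto)
qed

lemma is_weak_gradient_cong_AE:
  assumes \<Omega>: "\<Omega> \<in> sets lebesgue" and w: "is_weak_gradient \<Omega> u g"
    and uv: "AE x in lebesgue_on \<Omega>. u x = v x"
  shows "is_weak_gradient \<Omega> v g"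
  unfolding is_weak_gradient_def
proof (intro conjI ballI allI)
  show "locally_integrable \<Omega> v" "locally_integrable \<Omega> g"
    using w locally_integrable_cong_AE[OF \<Omega> _ uv] by (auto simp: is_weak_gradient_def)
  fix \<phi> i assume \<phi>: "\<phi> \<in> test_functions \<Omega>"
  have m: "(\<lambda>x. u x * grad \<phi> x $ i) \<in> borel_measurable (lebesgue_on \<Omega>)"
    using is_weak_gradient_integrable[OF \<Omega> w \<phi>, of i] by auto
  have ae: "AE x in lebesgue_on \<Omega>. u x * grad \<phi> x $ i = v x * grad \<phi> x $ i"
    using uv by eventually_elim simp
  have "(LINT x|lebesgue_on \<Omega>. v x * grad \<phi> x $ i) = (LINT x|lebesgue_on \<Omega>. u x * grad \<phi> x $ i)"
    by (rule integral_cong_AE) (use ae m borel_measurable_lebesgue_on_AE[OF \<Omega> m ae] in auto)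
  then show "(LINT x|lebesgue_on \<Omega>. v x * grad \<phi> x $ i) = - (LINT x|lebesgue_on \<Omega>. g x $ i * \<phi> x)"
    using w \<phi> by (simp add: is_weak_gradient_def)
qed

section \<open>The Poincare inequality for test functions\<close>

lemma has_real_derivative_abs_powr:
  fixes q t :: real
  assumes "1 < q"
  shows "((\<lambda>t. \<bar>t\<bar> powr q) has_real_derivative q * \<bar>t\<bar> powr (q - 1) * sgn t) (at t)"
proof -
  consider "t > 0" | "t < 0" | "t = 0" by linarith
  then show ?thesis
  proof cases
    case 1
    have "((\<lambda>t. t powr q) has_real_derivative q * \<bar>t\<bar> powr (q - 1) * sgn t) (at t)"
      using 1 by (auto intro!: derivative_eq_intros simp: powr_diff)
    then show ?thesis
      by (rule has_field_derivative_transform_within_open[where S="{0<..}"]) (use 1 in auto)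
  next
    case 2
    have "((\<lambda>t. (- t) powr q) has_real_derivative q * \<bar>t\<bar> powr (q - 1) * sgn t) (at t)"
      using 2 by (auto intro!: derivative_eq_intros simp: powr_diff)
    then show ?thesis
      by (rule has_field_derivative_transform_within_open[where S="{..<0}"]) (use 2 in auto)
  next
    case 3
    have "((\<lambda>h::real. \<bar>h\<bar> powr (q - 1)) \<longlongrightarrow> 0) (at 0)"
      using assms by (intro tendsto_zero_powrI[where b="q - 1"]) (auto intro!: tendsto_eq_intros)
    then have "((\<lambda>h::real. \<bar>h\<bar> powr (q - 1) * sgn h) \<longlongrightarrow> 0) (at 0)"
      by (rule Lim_null_comparison[rotated]) (auto simp: abs_mult sgn_if)
    moreover have "\<forall>\<^sub>F h in at 0. \<bar>h\<bar> powr (q - 1) * sgn h = \<bar>h\<bar> powr q / h"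
      by (auto simp: eventually_at_filter powr_diff sgn_if abs_if divide_simps)
    ultimately have "((\<lambda>h::real. \<bar>h\<bar> powr q / h) \<longlongrightarrow> 0) (at 0)"
      by (rule Lim_transform_eventually)
    then show ?thesis using 3 by (simp add: DERIV_def)
  qed
qed

text \<open>A form of the Young inequality whose first term has a factor below 1, so that it can be absorbed
  into the left-hand side of the Poincare inequality. The two cases compare \<open>p\<close> with \<open>t/(2M)\<close>.\<close>

lemma absorbing_young:
  fixes t p M q :: real
  assumes "0 \<le> t" "0 \<le> p" "0 < M" "1 < q"
  shows "M * (t powr (q - 1) * p) \<le> 1/2 * t powr q + M * (2 * M) powr (q - 1) * p powr q"
proof (cases "2 * M * p \<le> t")
  case True
  have "M * (t powr (q - 1) * p) = 1/2 * (t powr (q - 1) * (2 * M * p))" by simp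
  also have "\<dots> \<le> 1/2 * (t powr (q - 1) * t)"
    using True by (intro mult_left_mono) auto
  also have "t powr (q - 1) * t = t powr q"
    using assms by (cases "t = 0") (auto simp: powr_diff)
  finally show ?thesis using assms by (smt (verit) mult_nonneg_nonneg powr_ge_zero)
next
  case False
  have "t powr (q - 1) * p \<le> (2 * M * p) powr (q - 1) * p"
    using False assms by (intro mult_right_mono powr_mono2) auto
  also have "\<dots> = (2 * M) powr (q - 1) * (p powr (q - 1) * p)"
    using assms by (simp add: powr_mult)
  also have "p powr (q - 1) * p = p powr q"
    using assms by (cases "p = 0") (auto simp: powr_diff)
  finally have "M * (t powr (q - 1) * p) \<le> M * ((2 * M) powr (q - 1) * p powr q)"
    using assms by (intro mult_left_mono) auto
  moreover have "0 \<le> 1/2 * t powr q" by simp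
  ultimately show ?thesis unfolding mult.assoc by linarith
qed

text \<open>Integrating \<open>\<partial>\<^sub>i(x\<^sub>i \<bar>\<phi>\<bar>\<^sup>q)\<close> to 0 expresses \<open>\<integral>\<bar>\<phi>\<bar>\<^sup>q\<close> as an integral bounded by
  \<open>R q \<integral>\<bar>\<phi>\<bar>\<^sup>q\<^sup>-\<^sup>1 \<bar>\<nabla>\<phi>\<bar>\<close> if \<open>\<Omega>\<close> lies in the ball of radius \<open>R\<close>, and \<open>absorbing_young\<close> absorbs
  half of the left-hand side.\<close>

lemma poincare_test_function:
  fixes \<Omega> :: "(real^'n) set"
  assumes \<Omega>: "bounded \<Omega>" "\<Omega> \<in> sets lebesgue" and q: "1 < q"
  obtains C where "C > 0" "\<And>\<phi>. \<phi> \<in> test_functions \<Omega> \<Longrightarrow> L_norm \<Omega> q \<phi> \<le> C * L_norm \<Omega> q (grad \<phi>)"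
proof -
  obtain R where R: "R > 0" "\<And>x. x \<in> \<Omega> \<Longrightarrow> norm x \<le> R"
    using \<Omega>(1) by (auto simp: bounded_pos)
  \<comment> \<open>any coordinate direction will do\<close>
  define i :: 'n where "i = undefined"
  define M where "M = R * q"
  have M: "M > 0" using R q by (simp add: M_def)
  define C where "C = M * (2 * M) powr (q - 1)"
  have C: "C > 0" using M by (simp add: C_def)
  have main: "(LINT x|lebesgue_on \<Omega>. norm (\<phi> x) powr q) \<le> 2 * C * (LINT x|lebesgue_on \<Omega>. norm (grad \<phi> x) powr q)"
    if \<phi>: "\<phi> \<in> test_functions \<Omega>" for \<phi>
  proof -
    obtain K where K: "compact K" "K \<subseteq> \<Omega>" "\<And>x. x \<notin> K \<Longrightarrow> \<phi> x = 0" "\<And>x. x \<notin> K \<Longrightarrow> grad \<phi> x = 0"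
      using test_function_support[OF \<phi>] by metis
    have K': "\<phi> x = 0" "grad \<phi> x = 0" if "x \<notin> \<Omega>" for x
      using K that by auto
    let ?u = "\<lambda>x. norm (\<phi> x) powr q" and ?g = "\<lambda>x. norm (grad \<phi> x) powr q"
    have cu: "continuous_on UNIV ?u" and cg: "continuous_on UNIV ?g"
      using q by (auto intro!: continuous_on_powr' continuous_on_norm continuous_on_const
          continuous_on_rabs test_function_continuous[OF \<phi>] test_function_grad_continuous[OF \<phi>])
    have iu: "integrable lborel ?u" and ig: "integrable lborel ?g"
      by (rule integrable_lborel_continuous_compact_support[OF _ compact_imp_bounded[OF K(1)]]; simp add: cu[simplified] cg K)+
    obtain B1 where B1: "B1 > 0" "\<And>x. norm (\<phi> x) \<le> B1"
      using continuous_compact_support_bounded[OF test_function_continuous[OF \<phi>] K(1,3)] by blast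
    obtain B2 where B2: "B2 > 0" "\<And>x. norm (grad \<phi> x) \<le> B2"
      using continuous_compact_support_bounded[OF test_function_grad_continuous[OF \<phi>] K(1,4)] by blast
    define S where "S x = q * \<bar>\<phi> x\<bar> powr (q - 1) * sgn (\<phi> x)" for x
    let ?D = "\<lambda>x. x $ i * ((axis i 1 \<bullet> grad \<phi> x) * S x) + axis i 1 $ i * \<bar>\<phi> x\<bar> powr q"
    have absD: "\<bar>x $ i * ((axis i 1 \<bullet> grad \<phi> x) * S x)\<bar> \<le> M * (\<bar>\<phi> x\<bar> powr (q - 1) * norm (grad \<phi> x))" for x
    proof (cases "x \<in> \<Omega>")
      case True
      have "\<bar>x $ i\<bar> \<le> R" using component_le_norm_cart[of x i] R(2)[OF True] by simp
      moreover have "\<bar>axis i 1 \<bullet> grad \<phi> x\<bar> \<le> norm (grad \<phi> x)"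
        using component_le_norm_cart[of "grad \<phi> x" i] by (simp add: inner_axis')
      moreover have "\<bar>S x\<bar> \<le> q * \<bar>\<phi> x\<bar> powr (q - 1)"
        using q by (simp add: S_def abs_mult sgn_if)
      ultimately have "\<bar>x $ i\<bar> * (\<bar>axis i 1 \<bullet> grad \<phi> x\<bar> * \<bar>S x\<bar>) \<le> R * (norm (grad \<phi> x) * (q * \<bar>\<phi> x\<bar> powr (q - 1)))"
        using R by (intro mult_mono) auto
      then show ?thesis by (simp add: M_def abs_mult mult_ac)
    next
      case False
      then show ?thesis using K' by simp
    qed
    have D: "((\<lambda>x. x $ i * \<bar>\<phi> x\<bar> powr q) has_derivative
        (\<lambda>h. x $ i * ((h \<bullet> grad \<phi> x) * S x) + h $ i * \<bar>\<phi> x\<bar> powr q)) (at x)" for x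
    proof (rule has_derivative_mult)
      show "((\<lambda>x. x $ i) has_derivative (\<lambda>h. h $ i)) (at x)"
        by (rule bounded_linear_imp_has_derivative) (rule bounded_linear_vec_nth)
      have "((\<lambda>x. \<bar>\<phi> x\<bar> powr q) has_derivative (\<lambda>h. (q * \<bar>\<phi> x\<bar> powr (q - 1) * sgn (\<phi> x)) * (h \<bullet> grad \<phi> x))) (at x)"
        by (rule has_derivative_compose[OF test_function_has_derivative[OF \<phi>]
              has_real_derivative_abs_powr[OF q, unfolded has_field_derivative_def]])
      then show "((\<lambda>x. \<bar>\<phi> x\<bar> powr q) has_derivative (\<lambda>h. (h \<bullet> grad \<phi> x) * S x)) (at x)"
        by (simp add: S_def mult.commute)
    qed
    have bound: "\<bar>?D x\<bar> \<le> M * (B1 powr (q - 1) * B2) + B1 powr q" for x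
    proof -
      have "\<bar>?D x\<bar> \<le> \<bar>x $ i * ((axis i 1 \<bullet> grad \<phi> x) * S x)\<bar> + \<bar>\<phi> x\<bar> powr q"
        by (simp add: abs_triangle_ineq[THEN order_trans])
      also have "\<dots> \<le> M * (\<bar>\<phi> x\<bar> powr (q - 1) * norm (grad \<phi> x)) + \<bar>\<phi> x\<bar> powr q"
        using absD by simp
      also have "\<dots> \<le> M * (B1 powr (q - 1) * B2) + B1 powr q"
        using B1 B2 M q by (intro add_mono mult_left_mono mult_mono powr_mono2) auto
      finally show ?thesis .
    qed
    have Dint: "integrable lborel ?D" and D0: "(LINT x|lborel. ?D x) = 0"
      by (rule integral_directional_derivative_eq_0[OF D bound compact_imp_bounded[OF K(1)]]; simp add: K(3))+
    \<comment> \<open>\<open>?D\<close> is \<open>\<partial>\<^sub>i(x\<^sub>i \<bar>\<phi>\<bar>\<^sup>q)\<close>: its first summand is absorbed, its second is \<open>\<bar>\<phi>\<bar>\<^sup>q\<close>\<close>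
    have pt: "?u x \<le> ?D x + (1/2 * ?u x + C * ?g x)" for x
    proof -
      have "- (x $ i * ((axis i 1 \<bullet> grad \<phi> x) * S x)) \<le> 1/2 * ?u x + C * ?g x"
        using absD[of x] absorbing_young[of "norm (\<phi> x)" "norm (grad \<phi> x)" M q] M q
        by (simp add: C_def)
      then show ?thesis by simp
    qed
    have "(LINT x|lborel. ?u x) \<le> (LINT x|lborel. ?D x + (1/2 * ?u x + C * ?g x))"
      by (intro integral_mono iu Bochner_Integration.integrable_add integrable_mult_right Dint ig pt)
    also have "\<dots> = (LINT x|lborel. ?D x) + (1/2 * (LINT x|lborel. ?u x) + C * (LINT x|lborel. ?g x))"
      using iu ig Dint by (simp del: axis_nth)
    finally have "(LINT x|lborel. ?u x) \<le> 2 * C * (LINT x|lborel. ?g x)"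
      using D0 by simp
    moreover have "(LINT x|lebesgue_on \<Omega>. ?u x) = (LINT x|lborel. ?u x)"
      by (rule lebesgue_on_integral_eq_lborel(2)[OF \<Omega>(2) borel_measurable_continuous_onI[OF cu]]) (simp add: K')
    moreover have "(LINT x|lebesgue_on \<Omega>. ?g x) = (LINT x|lborel. ?g x)"
      by (rule lebesgue_on_integral_eq_lborel(2)[OF \<Omega>(2) borel_measurable_continuous_onI[OF cg]]) (simp add: K')
    ultimately show ?thesis by simp
  qed
  show ?thesis
  proof (rule that[of "(2 * C) powr (1 / q)"])
    show "(2 * C) powr (1 / q) > 0" using C by simp
    fix \<phi> assume \<phi>: "\<phi> \<in> test_functions \<Omega>"
    have "((2 * C) powr (1 / q) * L_norm \<Omega> q (grad \<phi>)) powr q = 2 * C * (LINT x|lebesgue_on \<Omega>. norm (grad \<phi> x) powr q)"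
      using q C by (simp add: powr_mult L_norm_powr powr_powr)
    then show "L_norm \<Omega> q \<phi> \<le> (2 * C) powr (1 / q) * L_norm \<Omega> q (grad \<phi>)"
      using main[OF \<phi>] q C by (simp add: L_norm_le_iff L_norm_nonneg)
  qed
qed

section \<open>Sobolev functions with zero boundary values\<close>

text \<open>Sobolev spaces of functions instead of classes. The operations on classes involve a choice
  of representatives, while sums and multiples of functions are pointwise; so inequalities and
  closure properties have their natural form on this level.\<close>

definition sob :: "(real^'n) set \<Rightarrow> real \<Rightarrow> (real^'n \<Rightarrow> real) set" where
  "sob \<Omega> s = {u \<in> L_space \<Omega> s. \<exists>g\<in>L_space \<Omega> s. is_weak_gradient \<Omega> u g}"

definition grad_seminorm :: "(real^'n) set \<Rightarrow> real \<Rightarrow> (real^'n \<Rightarrow> real) \<Rightarrow> real" where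
  "grad_seminorm \<Omega> s u = L_norm \<Omega> s (weak_gradient \<Omega> u)"

definition sob0 :: "(real^'n) set \<Rightarrow> real \<Rightarrow> (real^'n \<Rightarrow> real) set" where
  "sob0 \<Omega> s = {u \<in> sob \<Omega> s. \<forall>\<epsilon>>0. \<exists>\<phi>\<in>test_functions \<Omega>.
     L_norm \<Omega> s (\<lambda>x. u x - \<phi> x) < \<epsilon> \<and> grad_seminorm \<Omega> s (\<lambda>x. u x - \<phi> x) < \<epsilon>}"

lemma test_functions_lincomb:
  assumes "\<phi> \<in> test_functions \<Omega>" "\<psi> \<in> test_functions \<Omega>"
  shows "(\<lambda>x. a * \<phi> x + b * \<psi> x) \<in> test_functions \<Omega>"
proof -
  have sub: "closure {x. a * \<phi> x + b * \<psi> x \<noteq> 0} \<subseteq> closure {x. \<phi> x \<noteq> 0} \<union> closure {x. \<psi> x \<noteq> 0}"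
    unfolding closure_Un[symmetric] by (intro closure_mono) auto
  moreover have c: "compact (closure {x. \<phi> x \<noteq> 0} \<union> closure {x. \<psi> x \<noteq> 0})"
    using assms by (auto simp: test_functions_def)
  ultimately have "compact (closure {x. a * \<phi> x + b * \<psi> x \<noteq> 0})"
    by (meson bounded_subset closed_closure compact_eq_bounded_closed)
  moreover have "C_k m (\<lambda>x. a * \<phi> x + b * \<psi> x)" for m
    using assms by (intro C_k_add C_k_mult C_k_const) (auto simp: test_functions_def)
  ultimately show ?thesis
    using sub assms by (auto simp: test_functions_def)
qed

lemma zero_test_function: "(\<lambda>x. 0) \<in> test_functions \<Omega>"
  by (simp add: test_functions_def)

locale bounded_open_set =
  fixes \<Omega> :: "(real^'n) set"
  assumes open_Om: "open \<Omega>" and bounded_Om: "bounded \<Omega>"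
begin

lemma lebesgue_sets_Om: "\<Omega> \<in> sets lebesgue"
  using open_Om by auto

lemma weak_gradient_AE_eq:
  assumes "is_weak_gradient \<Omega> u g"
  shows "AE x in lebesgue_on \<Omega>. g x = weak_gradient \<Omega> u x"
proof -
  have "is_weak_gradient \<Omega> u (weak_gradient \<Omega> u)"
    unfolding weak_gradient_def by (rule someI[where P="is_weak_gradient \<Omega> u", OF assms])
  then show ?thesis by (rule is_weak_gradient_unique_AE[OF open_Om assms])
qed

lemma sob_weak_gradient:
  assumes "u \<in> sob \<Omega> s"
  shows "is_weak_gradient \<Omega> u (weak_gradient \<Omega> u)" "weak_gradient \<Omega> u \<in> L_space \<Omega> s"
proof -
  obtain g where g: "g \<in> L_space \<Omega> s" "is_weak_gradient \<Omega> u g"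
    using assms by (auto simp: sob_def)
  show "is_weak_gradient \<Omega> u (weak_gradient \<Omega> u)"
    unfolding weak_gradient_def by (rule someI[where P="is_weak_gradient \<Omega> u", OF g(2)])
  show "weak_gradient \<Omega> u \<in> L_space \<Omega> s"
    by (rule L_space_cong_AE[OF lebesgue_sets_Om g(1) weak_gradient_AE_eq[OF g(2)]])
qed

lemma grad_seminorm_eq:
  assumes "is_weak_gradient \<Omega> u g" "g \<in> L_space \<Omega> s"
  shows "grad_seminorm \<Omega> s u = L_norm \<Omega> s g"
  unfolding grad_seminorm_def
  using L_norm_cong_AE[OF lebesgue_sets_Om weak_gradient_AE_eq[OF assms(1)]] by simp

lemma grad_seminorm_nonneg: "0 \<le> grad_seminorm \<Omega> s u"
  by (simp add: grad_seminorm_def L_norm_nonneg)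

lemma L_space_lincomb:
  assumes "f \<in> L_space \<Omega> s" "g \<in> L_space \<Omega> s" "1 \<le> s"
  shows "(\<lambda>x. a *\<^sub>R f x + b *\<^sub>R g x) \<in> L_space \<Omega> s"
  using assms by (intro L_space_add L_space_scale)

lemma sob_lincomb:
  assumes u: "u \<in> sob \<Omega> s" and v: "v \<in> sob \<Omega> s" and s: "1 \<le> s"
  shows "(\<lambda>x. a * u x + b * v x) \<in> sob \<Omega> s"
    and "grad_seminorm \<Omega> s (\<lambda>x. a * u x + b * v x) \<le> \<bar>a\<bar> * grad_seminorm \<Omega> s u + \<bar>b\<bar> * grad_seminorm \<Omega> s v"
proof -
  let ?g = "weak_gradient \<Omega> u" and ?h = "weak_gradient \<Omega> v"
  note gu = sob_weak_gradient[OF u] and gv = sob_weak_gradient[OF v]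
  have L: "(\<lambda>x. a *\<^sub>R ?g x + b *\<^sub>R ?h x) \<in> L_space \<Omega> s"
    by (rule L_space_lincomb[OF gu(2) gv(2) s])
  have W: "is_weak_gradient \<Omega> (\<lambda>x. a * u x + b * v x) (\<lambda>x. a *\<^sub>R ?g x + b *\<^sub>R ?h x)"
    by (rule is_weak_gradient_lincomb[OF lebesgue_sets_Om gu(1) gv(1)])
  have "(\<lambda>x. a * u x + b * v x) \<in> L_space \<Omega> s"
    using L_space_lincomb[of u s v a b] u v s by (simp add: sob_def)
  then show "(\<lambda>x. a * u x + b * v x) \<in> sob \<Omega> s"
    using L W by (auto simp: sob_def)
  have "grad_seminorm \<Omega> s (\<lambda>x. a * u x + b * v x) = L_norm \<Omega> s (\<lambda>x. a *\<^sub>R ?g x + b *\<^sub>R ?h x)"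
    by (rule grad_seminorm_eq[OF W L])
  also have "\<dots> \<le> L_norm \<Omega> s (\<lambda>x. a *\<^sub>R ?g x) + L_norm \<Omega> s (\<lambda>x. b *\<^sub>R ?h x)"
    by (intro L_norm_triangle L_space_scale gu gv s)
  also have "\<dots> = \<bar>a\<bar> * grad_seminorm \<Omega> s u + \<bar>b\<bar> * grad_seminorm \<Omega> s v"
    using s by (simp add: L_norm_scale grad_seminorm_def)
  finally show "grad_seminorm \<Omega> s (\<lambda>x. a * u x + b * v x) \<le> \<bar>a\<bar> * grad_seminorm \<Omega> s u + \<bar>b\<bar> * grad_seminorm \<Omega> s v" .
qed

lemma L_norm_lincomb_le:
  fixes u v :: "real^'n \<Rightarrow> real"
  assumes "u \<in> L_space \<Omega> s" "v \<in> L_space \<Omega> s" "1 \<le> s"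
  shows "L_norm \<Omega> s (\<lambda>x. a * u x + b * v x) \<le> \<bar>a\<bar> * L_norm \<Omega> s u + \<bar>b\<bar> * L_norm \<Omega> s v"
  using L_norm_triangle[OF L_space_scale[OF assms(1), of a] L_space_scale[OF assms(2), of b] assms(3)]
    L_norm_scale[OF assms(3), of \<Omega> a u] L_norm_scale[OF assms(3), of \<Omega> b v] by simp

lemma sob_cong_AE:
  assumes u: "u \<in> sob \<Omega> s" and ae: "AE x in lebesgue_on \<Omega>. u x = v x"
  shows "v \<in> sob \<Omega> s" "grad_seminorm \<Omega> s v = grad_seminorm \<Omega> s u"
proof -
  have w: "is_weak_gradient \<Omega> v (weak_gradient \<Omega> u)"
    by (rule is_weak_gradient_cong_AE[OF lebesgue_sets_Om sob_weak_gradient(1)[OF u] ae])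
  have "v \<in> L_space \<Omega> s"
    by (rule L_space_cong_AE[OF lebesgue_sets_Om _ ae]) (use u in \<open>simp add: sob_def\<close>)
  then show "v \<in> sob \<Omega> s"
    using w sob_weak_gradient(2)[OF u] by (auto simp: sob_def)
  show "grad_seminorm \<Omega> s v = grad_seminorm \<Omega> s u"
    using grad_seminorm_eq[OF w sob_weak_gradient(2)[OF u]] by (simp add: grad_seminorm_def)
qed

lemma test_function_sob:
  assumes \<phi>: "\<phi> \<in> test_functions \<Omega>" and s: "1 \<le> s"
  shows "\<phi> \<in> sob \<Omega> s" "grad_seminorm \<Omega> s \<phi> = L_norm \<Omega> s (grad \<phi>)"
proof -
  obtain K where K: "compact K" "\<And>x. x \<notin> K \<Longrightarrow> \<phi> x = 0" "\<And>x. x \<notin> K \<Longrightarrow> grad \<phi> x = 0"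
    using test_function_support[OF \<phi>] by metis
  have L: "\<phi> \<in> L_space \<Omega> s" "grad \<phi> \<in> L_space \<Omega> s"
    using continuous_compact_support_L_space[OF bounded_Om lebesgue_sets_Om s test_function_continuous[OF \<phi>] K(1,2)]
      continuous_compact_support_L_space[OF bounded_Om lebesgue_sets_Om s test_function_grad_continuous[OF \<phi>] K(1,3)]
    by auto
  have W: "is_weak_gradient \<Omega> \<phi> (grad \<phi>)"
    by (rule test_function_weak_gradient[OF lebesgue_sets_Om \<phi>])
  show "\<phi> \<in> sob \<Omega> s" using L W by (auto simp: sob_def)
  show "grad_seminorm \<Omega> s \<phi> = L_norm \<Omega> s (grad \<phi>)"
    by (rule grad_seminorm_eq[OF W L(2)])
qed

lemma sob_L_space: "u \<in> sob \<Omega> s \<Longrightarrow> u \<in> L_space \<Omega> s"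
  by (simp add: sob_def)

lemma sob_measurable: "u \<in> sob \<Omega> s \<Longrightarrow> u \<in> borel_measurable (lebesgue_on \<Omega>)"
  by (simp add: sob_def L_space_def)

lemma sob0_sob: "u \<in> sob0 \<Omega> s \<Longrightarrow> u \<in> sob \<Omega> s"
  by (simp add: sob0_def)

lemma sob_zero_norms:
  assumes "1 \<le> s"
  shows "L_norm \<Omega> s (\<lambda>x. 0 :: real) = 0" "grad_seminorm \<Omega> s (\<lambda>x. 0) = 0"
proof -
  show "L_norm \<Omega> s (\<lambda>x. 0 :: real) = 0" using assms by (simp add: L_norm_def)
  have z: "(\<lambda>x. 0) \<in> sob \<Omega> s" by (rule test_function_sob[OF zero_test_function assms])
  show "grad_seminorm \<Omega> s (\<lambda>x. 0) = 0"
    using sob_lincomb(2)[OF z z assms, of 0 0] grad_seminorm_nonneg[of s "\<lambda>x. 0"] by simp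
qed

lemma test_function_sob0:
  assumes \<phi>: "\<phi> \<in> test_functions \<Omega>" and s: "1 \<le> s"
  shows "\<phi> \<in> sob0 \<Omega> s"
  unfolding sob0_def using test_function_sob(1)[OF assms] \<phi> sob_zero_norms[OF s]
  by (auto intro!: bexI[of _ \<phi>])

lemma sob0_lincomb:
  assumes u: "u \<in> sob0 \<Omega> s" and v: "v \<in> sob0 \<Omega> s" and s: "1 \<le> s"
  shows "(\<lambda>x. a * u x + b * v x) \<in> sob0 \<Omega> s"
  unfolding sob0_def
proof (intro CollectI conjI allI impI)
  show "(\<lambda>x. a * u x + b * v x) \<in> sob \<Omega> s"
    by (rule sob_lincomb(1)[OF sob0_sob[OF u] sob0_sob[OF v] s])
  fix e :: real assume e: "e > 0"
  define d where "d = e / (\<bar>a\<bar> + \<bar>b\<bar> + 1)"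
  have d: "d > 0" using e by (simp add: d_def)
  have de: "\<bar>a\<bar> * d + \<bar>b\<bar> * d < e"
  proof -
    have "(\<bar>a\<bar> + \<bar>b\<bar> + 1) * d = e" by (simp add: d_def)
    then show ?thesis using d by (simp add: distrib_right)
  qed
  obtain \<phi> where \<phi>: "\<phi> \<in> test_functions \<Omega>" "L_norm \<Omega> s (\<lambda>x. u x - \<phi> x) < d" "grad_seminorm \<Omega> s (\<lambda>x. u x - \<phi> x) < d"
    using u d by (auto simp: sob0_def)
  obtain \<psi> where \<psi>: "\<psi> \<in> test_functions \<Omega>" "L_norm \<Omega> s (\<lambda>x. v x - \<psi> x) < d" "grad_seminorm \<Omega> s (\<lambda>x. v x - \<psi> x) < d"
    using v d by (auto simp: sob0_def)
  have us: "(\<lambda>x. u x - \<phi> x) \<in> sob \<Omega> s"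
    using sob_lincomb(1)[OF sob0_sob[OF u] test_function_sob(1)[OF \<phi>(1) s] s, of 1 "-1"] by simp
  have vs: "(\<lambda>x. v x - \<psi> x) \<in> sob \<Omega> s"
    using sob_lincomb(1)[OF sob0_sob[OF v] test_function_sob(1)[OF \<psi>(1) s] s, of 1 "-1"] by simp
  have eq: "(\<lambda>x. (a * u x + b * v x) - (a * \<phi> x + b * \<psi> x)) = (\<lambda>x. a * (u x - \<phi> x) + b * (v x - \<psi> x))"
    by (simp add: algebra_simps)
  show "\<exists>\<xi>\<in>test_functions \<Omega>. L_norm \<Omega> s (\<lambda>x. a * u x + b * v x - \<xi> x) < e
      \<and> grad_seminorm \<Omega> s (\<lambda>x. a * u x + b * v x - \<xi> x) < e"
  proof (intro bexI[of _ "\<lambda>x. a * \<phi> x + b * \<psi> x"] conjI)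
    show "(\<lambda>x. a * \<phi> x + b * \<psi> x) \<in> test_functions \<Omega>"
      by (rule test_functions_lincomb[OF \<phi>(1) \<psi>(1)])
    have le: "\<bar>a\<bar> * X + \<bar>b\<bar> * Y < e" if "X < d" "Y < d" for X Y
    proof -
      have "\<bar>a\<bar> * X + \<bar>b\<bar> * Y \<le> \<bar>a\<bar> * d + \<bar>b\<bar> * d"
        using that by (intro add_mono mult_left_mono) auto
      then show ?thesis using de by linarith
    qed
    show "L_norm \<Omega> s (\<lambda>x. a * u x + b * v x - (a * \<phi> x + b * \<psi> x)) < e"
      unfolding eq using L_norm_lincomb_le[OF sob_L_space[OF us] sob_L_space[OF vs] s, of a b] le[OF \<phi>(2) \<psi>(2)]
      by linarith
    show "grad_seminorm \<Omega> s (\<lambda>x. a * u x + b * v x - (a * \<phi> x + b * \<psi> x)) < e"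
      unfolding eq using sob_lincomb(2)[OF us vs s, of a b] le[OF \<phi>(3) \<psi>(3)]
      by linarith
  qed
qed

text \<open>Both sides are continuous along approximation by test functions.\<close>

lemma poincare:
  assumes q: "1 < q"
  obtains C where "C > 0" "\<And>u. u \<in> sob0 \<Omega> q \<Longrightarrow> L_norm \<Omega> q u \<le> C * grad_seminorm \<Omega> q u"
proof -
  obtain C where C: "C > 0" "\<And>\<phi>. \<phi> \<in> test_functions \<Omega> \<Longrightarrow> L_norm \<Omega> q \<phi> \<le> C * L_norm \<Omega> q (grad \<phi>)"
    using poincare_test_function[OF bounded_Om lebesgue_sets_Om q] by metis
  have q1: "1 \<le> q" using q by simp
  show ?thesis
  proof (rule that[OF C(1)])
    fix u assume u: "u \<in> sob0 \<Omega> q"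
    show "L_norm \<Omega> q u \<le> C * grad_seminorm \<Omega> q u"
    proof (rule field_le_epsilon)
      fix e :: real assume e: "e > 0"
      define d where "d = e / (1 + C)"
      have d: "d > 0" using e C by (simp add: d_def)
      have "(1 + C) * d = e" using C by (simp add: d_def)
      then have de: "d + C * d = e" by (simp add: distrib_right)
      obtain \<phi> where \<phi>: "\<phi> \<in> test_functions \<Omega>" "L_norm \<Omega> q (\<lambda>x. u x - \<phi> x) < d" "grad_seminorm \<Omega> q (\<lambda>x. u x - \<phi> x) < d"
        using u d by (auto simp: sob0_def)
      note us = sob0_sob[OF u] and ps = test_function_sob(1)[OF \<phi>(1) q1]
      have ds: "(\<lambda>x. u x - \<phi> x) \<in> sob \<Omega> q"
        using sob_lincomb(1)[OF us ps q1, of 1 "-1"] by simp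
      have "L_norm \<Omega> q u \<le> L_norm \<Omega> q (\<lambda>x. u x - \<phi> x) + L_norm \<Omega> q \<phi>"
        using L_norm_lincomb_le[OF sob_L_space[OF ds] sob_L_space[OF ps] q1, of 1 1] by simp
      also have "\<dots> \<le> d + C * grad_seminorm \<Omega> q \<phi>"
        using \<phi>(2) C(2)[OF \<phi>(1)] test_function_sob(2)[OF \<phi>(1) q1] by simp
      also have "grad_seminorm \<Omega> q \<phi> \<le> grad_seminorm \<Omega> q u + d"
        using sob_lincomb(2)[OF us ds q1, of 1 "-1"] \<phi>(3) by simp
      finally show "L_norm \<Omega> q u \<le> C * grad_seminorm \<Omega> q u + e"
        using C(1) de by (simp add: distrib_left)
    qed
  qed
qed

lemma sob_mono:
  assumes "1 \<le> q" "q \<le> r" "u \<in> sob \<Omega> r"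
  shows "u \<in> sob \<Omega> q"
proof -
  have "f \<in> L_space \<Omega> q" if "f \<in> L_space \<Omega> r" for f :: "real^'n \<Rightarrow> 'b::euclidean_space"
    using L_space_mono[OF bounded_Om lebesgue_sets_Om _ assms(2) that] assms(1) by simp
  note mono = this
  obtain g where "g \<in> L_space \<Omega> r" "is_weak_gradient \<Omega> u g" and u: "u \<in> L_space \<Omega> r"
    using assms(3) by (auto simp: sob_def)
  then show ?thesis unfolding sob_def using mono[OF u] mono[of g] by auto
qed

lemma grad_seminorm_small_mono:
  assumes "1 \<le> q" "q \<le> r" "0 < e"
  obtains d where "d > 0" "\<And>u. u \<in> sob \<Omega> r \<Longrightarrow> grad_seminorm \<Omega> r u < d \<Longrightarrow> grad_seminorm \<Omega> q u < e"
proof -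
  obtain d where d: "d > 0" "\<And>f :: real^'n \<Rightarrow> real^'n. f \<in> L_space \<Omega> r \<Longrightarrow> L_norm \<Omega> r f < d \<Longrightarrow> L_norm \<Omega> q f < e"
    using L_norm_small_mono[OF bounded_Om lebesgue_sets_Om assms] by metis
  show ?thesis
    by (rule that[OF d(1)]) (use d(2) sob_weak_gradient(2) in \<open>auto simp: grad_seminorm_def\<close>)
qed

text \<open>The same test functions approximate in the smaller exponent, because smallness for \<open>r\<close> forces
  smallness for \<open>q\<close>.\<close>

lemma sob0_mono:
  assumes "1 \<le> q" "q \<le> r" "u \<in> sob0 \<Omega> r"
  shows "u \<in> sob0 \<Omega> q"
  unfolding sob0_def
proof (intro CollectI conjI allI impI)
  have us: "u \<in> sob \<Omega> r" using assms(3) by (rule sob0_sob)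
  show "u \<in> sob \<Omega> q" by (rule sob_mono[OF assms(1,2) us])
  fix e :: real assume e: "e > 0"
  have r1: "1 \<le> r" using assms by simp
  obtain d1 where d1: "d1 > 0" "\<And>f :: real^'n \<Rightarrow> real. f \<in> L_space \<Omega> r \<Longrightarrow> L_norm \<Omega> r f < d1 \<Longrightarrow> L_norm \<Omega> q f < e"
    using L_norm_small_mono[OF bounded_Om lebesgue_sets_Om assms(1,2) e] by metis
  obtain d2 where d2: "d2 > 0" "\<And>u. u \<in> sob \<Omega> r \<Longrightarrow> grad_seminorm \<Omega> r u < d2 \<Longrightarrow> grad_seminorm \<Omega> q u < e"
    using grad_seminorm_small_mono[OF assms(1,2) e] by metis
  define d where "d = min d1 d2"
  have d: "d > 0" "d \<le> d1" "d \<le> d2" using d1(1) d2(1) by (auto simp: d_def)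
  obtain \<phi> where \<phi>: "\<phi> \<in> test_functions \<Omega>" "L_norm \<Omega> r (\<lambda>x. u x - \<phi> x) < d" "grad_seminorm \<Omega> r (\<lambda>x. u x - \<phi> x) < d"
    using assms(3) d by (auto simp: sob0_def)
  have "(\<lambda>x. u x - \<phi> x) \<in> sob \<Omega> r"
    using sob_lincomb(1)[OF us test_function_sob(1)[OF \<phi>(1) r1] r1, of 1 "-1"] by simp
  then show "\<exists>\<phi>\<in>test_functions \<Omega>. L_norm \<Omega> q (\<lambda>x. u x - \<phi> x) < e \<and> grad_seminorm \<Omega> q (\<lambda>x. u x - \<phi> x) < e"
    using \<phi>(2,3) d(2,3) by (intro bexI[OF _ \<phi>(1)] conjI d1(2) d2(2) sob_L_space) auto
qed

end

section \<open>Classes modulo null sets\<close>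

lemma ae_class_cong:
  assumes "AE x in lebesgue_on \<Omega>. u x = v x"
  shows "ae_class \<Omega> u = ae_class \<Omega> v"
proof -
  have "(AE x in lebesgue_on \<Omega>. w x = u x) \<longleftrightarrow> (AE x in lebesgue_on \<Omega>. w x = v x)" for w
  proof
    show "AE x in lebesgue_on \<Omega>. w x = v x" if "AE x in lebesgue_on \<Omega>. w x = u x"
      using that assms by eventually_elim simp
    show "AE x in lebesgue_on \<Omega>. w x = u x" if "AE x in lebesgue_on \<Omega>. w x = v x"
      using that assms by eventually_elim simp
  qed
  then show ?thesis by (simp add: ae_class_def)
qed

lemma rep_ae_class_AE:
  assumes "u \<in> borel_measurable (lebesgue_on \<Omega>)"
  shows "AE x in lebesgue_on \<Omega>. rep (ae_class \<Omega> u) x = u x"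
proof -
  have "u \<in> ae_class \<Omega> u" using assms by (simp add: ae_class_def)
  then have "rep (ae_class \<Omega> u) \<in> ae_class \<Omega> u" unfolding rep_def by (rule someI[where P="\<lambda>v. v \<in> ae_class \<Omega> u"])
  then show ?thesis by (simp add: ae_class_def)
qed

lemma rep_ae_class_AE':
  assumes "u \<in> borel_measurable (lebesgue_on \<Omega>)"
  shows "AE x in lebesgue_on \<Omega>. u x = rep (ae_class \<Omega> u) x"
  using rep_ae_class_AE[OF assms] by eventually_elim simp

lemma ae_class_eq_iff:
  assumes "u \<in> borel_measurable (lebesgue_on \<Omega>)"
  shows "ae_class \<Omega> u = ae_class \<Omega> v \<longleftrightarrow> (AE x in lebesgue_on \<Omega>. u x = v x)"
proof
  assume "ae_class \<Omega> u = ae_class \<Omega> v"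
  moreover have "u \<in> ae_class \<Omega> u" using assms by (simp add: ae_class_def)
  ultimately show "AE x in lebesgue_on \<Omega>. u x = v x" by (simp add: ae_class_def)
qed (rule ae_class_cong)

lemma minus_ae_class:
  assumes "u \<in> borel_measurable (lebesgue_on \<Omega>)" "v \<in> borel_measurable (lebesgue_on \<Omega>)"
  shows "minus_class \<Omega> (ae_class \<Omega> u) (ae_class \<Omega> v) = ae_class \<Omega> (\<lambda>x. u x - v x)"
  unfolding minus_class_def
  by (rule ae_class_cong) (use rep_ae_class_AE[OF assms(1)] rep_ae_class_AE[OF assms(2)] in eventually_elim, simp)

lemma uminus_ae_class:
  assumes "u \<in> borel_measurable (lebesgue_on \<Omega>)"
  shows "uminus_class \<Omega> (ae_class \<Omega> u) = ae_class \<Omega> (\<lambda>x. - u x)"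
  unfolding uminus_class_def
  by (rule ae_class_cong) (use rep_ae_class_AE[OF assms(1)] in eventually_elim, simp)

text \<open>The norm of \<open>W1\<close> is small exactly if both of its parts are.\<close>

lemma powr_sum_root_bounds:
  fixes a b s :: real
  assumes "0 \<le> a" "0 \<le> b" "1 \<le> s"
  shows "a \<le> (a powr s + b powr s) powr (1 / s)" "b \<le> (a powr s + b powr s) powr (1 / s)"
    "(a powr s + b powr s) powr (1 / s) \<le> a + b"
proof -
  have "(a powr s) powr (1 / s) \<le> (a powr s + b powr s) powr (1 / s)"
    using assms by (intro powr_mono2) auto
  then show "a \<le> (a powr s + b powr s) powr (1 / s)"
    using assms by (simp add: powr_powr)
  have "(b powr s) powr (1 / s) \<le> (a powr s + b powr s) powr (1 / s)"
    using assms by (intro powr_mono2) auto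
  then show "b \<le> (a powr s + b powr s) powr (1 / s)"
    using assms by (simp add: powr_powr)
  have "a powr s + b powr s \<le> (a + b) powr s"
  proof -
    have p: "t powr s = t * t powr (s - 1)" if "t \<ge> 0" for t
      using that assms by (cases "t = 0") (auto simp: powr_diff)
    have "a powr s + b powr s = a * a powr (s - 1) + b * b powr (s - 1)"
      using assms by (simp add: p)
    also have "\<dots> \<le> a * (a + b) powr (s - 1) + b * (a + b) powr (s - 1)"
      using assms by (intro add_mono mult_left_mono powr_mono2) auto
    also have "\<dots> = (a + b) powr s"
      using assms p[of "a + b"] by (simp add: distrib_right)
    finally show ?thesis .
  qed
  then have "(a powr s + b powr s) powr (1 / s) \<le> ((a + b) powr s) powr (1 / s)"
    using assms by (intro powr_mono2) auto
  then show "(a powr s + b powr s) powr (1 / s) \<le> a + b"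
    using assms by (simp add: powr_powr)
qed

context bounded_open_set
begin

lemma fun_norm_ae_class:
  assumes "u \<in> borel_measurable (lebesgue_on \<Omega>)"
  shows "fun_norm \<Omega> s (ae_class \<Omega> u) = L_norm \<Omega> s u"
  unfolding fun_norm_def
  using L_norm_cong_AE[OF lebesgue_sets_Om rep_ae_class_AE'[OF assms]] by simp

lemma grad_norm_ae_class:
  assumes "u \<in> sob \<Omega> s"
  shows "grad_norm \<Omega> s (ae_class \<Omega> u) = grad_seminorm \<Omega> s u"
  using sob_cong_AE(2)[OF assms rep_ae_class_AE'[OF sob_measurable[OF assms]]]
  by (simp add: grad_norm_def grad_seminorm_def)

lemma sob_diff:
  assumes "u \<in> sob \<Omega> s" "v \<in> sob \<Omega> s" "1 \<le> s"
  shows "(\<lambda>x. u x - v x) \<in> sob \<Omega> s"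
  using sob_lincomb(1)[OF assms, of 1 "-1"] by simp

lemma sob0_diff:
  assumes "u \<in> sob0 \<Omega> s" "v \<in> sob0 \<Omega> s" "1 \<le> s"
  shows "(\<lambda>x. u x - v x) \<in> sob0 \<Omega> s"
  using sob0_lincomb[OF assms, of 1 "-1"] by simp

lemma sob0_minus:
  assumes "u \<in> sob0 \<Omega> s" "1 \<le> s"
  shows "(\<lambda>x. - u x) \<in> sob0 \<Omega> s"
  using sob0_lincomb[OF assms(1,1,2), of "-1" 0] by simp

lemma grad_norm_minus_class:
  assumes "u \<in> sob \<Omega> s" "v \<in> sob \<Omega> s" "1 \<le> s"
  shows "grad_norm \<Omega> s (minus_class \<Omega> (ae_class \<Omega> u) (ae_class \<Omega> v)) = grad_seminorm \<Omega> s (\<lambda>x. u x - v x)"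
  using assms by (simp add: minus_ae_class sob_measurable grad_norm_ae_class sob_diff)

lemma W1_norm_ae_class:
  assumes "u \<in> sob \<Omega> s"
  shows "W1_norm \<Omega> s (ae_class \<Omega> u) = (L_norm \<Omega> s u powr s + grad_seminorm \<Omega> s u powr s) powr (1 / s)"
  using assms by (simp add: W1_norm_def fun_norm_ae_class sob_measurable grad_norm_ae_class)

lemma W1_eq: "W1 \<Omega> s = ae_class \<Omega> ` sob \<Omega> s"
  unfolding W1_def sob_def by blast

text \<open>The link between the two levels: membership in \<open>W1_0\<close> does not depend on the representative.\<close>

lemma W1_0_eq:
  assumes s: "1 \<le> s"
  shows "W1_0 \<Omega> s = ae_class \<Omega> ` sob0 \<Omega> s"
proof -
  have key: "ae_class \<Omega> u \<in> W1_0 \<Omega> s \<longleftrightarrow> u \<in> sob0 \<Omega> s" if u: "u \<in> sob \<Omega> s" for u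
  proof -
    have N: "W1_norm \<Omega> s (minus_class \<Omega> (ae_class \<Omega> u) (ae_class \<Omega> \<phi>))
       = (L_norm \<Omega> s (\<lambda>x. u x - \<phi> x) powr s + grad_seminorm \<Omega> s (\<lambda>x. u x - \<phi> x) powr s) powr (1 / s)"
      if "\<phi> \<in> test_functions \<Omega>" for \<phi>
      using u test_function_sob(1)[OF that s] s
      by (simp add: minus_ae_class sob_measurable W1_norm_ae_class sob_diff)
    show ?thesis
    proof
      assume W: "ae_class \<Omega> u \<in> W1_0 \<Omega> s"
      have "\<exists>\<phi>\<in>test_functions \<Omega>. L_norm \<Omega> s (\<lambda>x. u x - \<phi> x) < e \<and> grad_seminorm \<Omega> s (\<lambda>x. u x - \<phi> x) < e"
        if e: "e > 0" for e
      proof -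
        obtain \<phi> where \<phi>: "\<phi> \<in> test_functions \<Omega>" "W1_norm \<Omega> s (minus_class \<Omega> (ae_class \<Omega> u) (ae_class \<Omega> \<phi>)) < e"
          using W e by (auto simp: W1_0_def)
        note b = powr_sum_root_bounds[OF L_norm_nonneg[of \<Omega> s "\<lambda>x. u x - \<phi> x"]
            grad_seminorm_nonneg[of s "\<lambda>x. u x - \<phi> x"] s]
        show ?thesis
          using \<phi>(2-) b(1,2) N[OF \<phi>(1)] by (intro bexI[OF _ \<phi>(1)]) linarith
      qed
      then show "u \<in> sob0 \<Omega> s" using u by (simp add: sob0_def)
    next
      assume W: "u \<in> sob0 \<Omega> s"
      have "\<exists>\<phi>\<in>test_functions \<Omega>. W1_norm \<Omega> s (minus_class \<Omega> (ae_class \<Omega> u) (ae_class \<Omega> \<phi>)) < e"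
        if e: "e > 0" for e
      proof -
        obtain \<phi> where \<phi>: "\<phi> \<in> test_functions \<Omega>" "L_norm \<Omega> s (\<lambda>x. u x - \<phi> x) < e / 2" "grad_seminorm \<Omega> s (\<lambda>x. u x - \<phi> x) < e / 2"
          using W e by (auto simp: sob0_def dest: spec[of _ "e / 2"])
        note b = powr_sum_root_bounds[OF L_norm_nonneg[of \<Omega> s "\<lambda>x. u x - \<phi> x"]
            grad_seminorm_nonneg[of s "\<lambda>x. u x - \<phi> x"] s]
        show ?thesis
          using \<phi>(2-) b(3) N[OF \<phi>(1)] by (intro bexI[OF _ \<phi>(1)]) linarith
      qed
      then show "ae_class \<Omega> u \<in> W1_0 \<Omega> s"
        using u by (auto simp: W1_0_def W1_eq)
    qed
  qed
  show ?thesis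
  proof (intro equalityI subsetI)
    fix U assume U: "U \<in> W1_0 \<Omega> s"
    then have "U \<in> W1 \<Omega> s" by (simp add: W1_0_def)
    then obtain u where "u \<in> sob \<Omega> s" "U = ae_class \<Omega> u" by (auto simp: W1_eq)
    then show "U \<in> ae_class \<Omega> ` sob0 \<Omega> s" using key U by blast
  next
    fix U assume "U \<in> ae_class \<Omega> ` sob0 \<Omega> s"
    then show "U \<in> W1_0 \<Omega> s" using key sob0_sob by blast
  qed
qed

lemma W1_0_rep:
  assumes "U \<in> W1_0 \<Omega> s" "1 \<le> s"
  obtains u where "u \<in> sob0 \<Omega> s" "U = ae_class \<Omega> u"
  using assms by (auto simp: W1_0_eq)

lemma uminus_W1_0:
  assumes "U \<in> W1_0 \<Omega> s" "1 \<le> s"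
  shows "uminus_class \<Omega> U \<in> W1_0 \<Omega> s"
proof -
  obtain u where u: "u \<in> sob0 \<Omega> s" "U = ae_class \<Omega> u" using W1_0_rep[OF assms] .
  then have "uminus_class \<Omega> U = ae_class \<Omega> (\<lambda>x. - u x)"
    by (simp add: uminus_ae_class sob_measurable[OF sob0_sob])
  then show ?thesis
    using sob0_minus[OF u(1) assms(2)] by (simp add: W1_0_eq[OF assms(2)])
qed

section \<open>The gradient norm as a metric\<close>

text \<open>If \<open>u\<close> has no weak gradient, then neither has \<open>v\<close>, and both choices are made from the same empty
  set of candidates. This case arises because symmetry of the metric below concerns arbitrary sets.\<close>

lemma weak_gradient_norm_minus:
  assumes ae: "AE x in lebesgue_on \<Omega>. v x = - u x"
  shows "L_norm \<Omega> s (weak_gradient \<Omega> v) = L_norm \<Omega> s (weak_gradient \<Omega> u)"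
proof -
  have neg: "is_weak_gradient \<Omega> b (\<lambda>x. - g x)"
    if "is_weak_gradient \<Omega> a g" "AE x in lebesgue_on \<Omega>. b x = - a x" for a b g
  proof -
    have "is_weak_gradient \<Omega> (\<lambda>x. (-1) * a x + 0 * a x) (\<lambda>x. (-1) *\<^sub>R g x + 0 *\<^sub>R g x)"
      by (rule is_weak_gradient_lincomb[OF lebesgue_sets_Om that(1,1)])
    then have "is_weak_gradient \<Omega> (\<lambda>x. - a x) (\<lambda>x. - g x)" by simp
    then show ?thesis
      by (rule is_weak_gradient_cong_AE[OF lebesgue_sets_Om]) (use that(2) in eventually_elim, simp)
  qed
  show ?thesis
  proof (cases "\<exists>g. is_weak_gradient \<Omega> u g")
    case True
    then obtain g where g: "is_weak_gradient \<Omega> u g" by blast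
    have "AE x in lebesgue_on \<Omega>. weak_gradient \<Omega> v x = - weak_gradient \<Omega> u x"
      using weak_gradient_AE_eq[OF g] weak_gradient_AE_eq[OF neg[OF g ae]] by eventually_elim simp
    from L_norm_cong_AE[OF lebesgue_sets_Om this] show ?thesis by (simp add: L_norm_def)
  next
    case False
    have "AE x in lebesgue_on \<Omega>. u x = - v x" using ae by eventually_elim simp
    then have "\<not> (\<exists>g. is_weak_gradient \<Omega> v g)" using False neg by blast
    with False have "is_weak_gradient \<Omega> u = is_weak_gradient \<Omega> v" by (auto simp: fun_eq_iff)
    then show ?thesis by (simp add: weak_gradient_def)
  qed
qed

text \<open>A metric space has a distance that is symmetric on the whole type, so \<open>U\<close> and \<open>V\<close> need not be classes
  of functions here; if the difference of the representatives is not measurable, then both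
  differences are the empty set.\<close>

lemma grad_norm_minus_class_commute:
  "grad_norm \<Omega> s (minus_class \<Omega> U V) = grad_norm \<Omega> s (minus_class \<Omega> V U)"
proof -
  let ?f = "\<lambda>x. rep U x - rep V x" and ?g = "\<lambda>x. rep V x - rep U x"
  have fg: "?g = (\<lambda>x. - ?f x)" "?f = (\<lambda>x. - ?g x)" by auto
  have meas: "f \<in> borel_measurable (lebesgue_on \<Omega>)" if ne: "ae_class \<Omega> f \<noteq> {}" for f
  proof -
    obtain w where "w \<in> borel_measurable (lebesgue_on \<Omega>)" "AE x in lebesgue_on \<Omega>. w x = f x"
      using ne unfolding ae_class_def by blast
    from borel_measurable_lebesgue_on_AE[OF lebesgue_sets_Om this] show ?thesis .
  qed
  show ?thesis
  proof (cases "?f \<in> borel_measurable (lebesgue_on \<Omega>)")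
    case True
    then have g: "?g \<in> borel_measurable (lebesgue_on \<Omega>)" unfolding fg(1) by (rule borel_measurable_uminus)
    have "AE x in lebesgue_on \<Omega>. rep (ae_class \<Omega> ?f) x = - rep (ae_class \<Omega> ?g) x"
      using rep_ae_class_AE[OF True] rep_ae_class_AE[OF g] by eventually_elim simp
    then show ?thesis
      unfolding grad_norm_def minus_class_def by (rule weak_gradient_norm_minus)
  next
    case False
    then have "?g \<notin> borel_measurable (lebesgue_on \<Omega>)"
      using borel_measurable_uminus[of ?g "lebesgue_on \<Omega>"] by (auto simp: fg(2)[symmetric])
    then have "ae_class \<Omega> ?f = {}" "ae_class \<Omega> ?g = {}" using False meas by blast+
    then show ?thesis by (simp add: minus_class_def)
  qed
qed

text \<open>Definiteness is the Poincare inequality: a vanishing gradient norm forces a vanishing norm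
  in \<open>L\<^sup>s\<close>.\<close>

lemma Metric_space_W1_0:
  assumes s: "1 < s"
  shows "Metric_space (W1_0 \<Omega> s) (\<lambda>U V. grad_norm \<Omega> s (minus_class \<Omega> U V))"
proof
  have s1: "1 \<le> s" using s by simp
  obtain C where C: "C > 0" "\<And>u. u \<in> sob0 \<Omega> s \<Longrightarrow> L_norm \<Omega> s u \<le> C * grad_seminorm \<Omega> s u"
    using poincare[OF s] by metis
  show "0 \<le> grad_norm \<Omega> s (minus_class \<Omega> U V)" for U V
    by (simp add: grad_norm_def L_norm_nonneg)
  show "grad_norm \<Omega> s (minus_class \<Omega> U V) = grad_norm \<Omega> s (minus_class \<Omega> V U)" for U V
    by (rule grad_norm_minus_class_commute)
  show "grad_norm \<Omega> s (minus_class \<Omega> U V) = 0 \<longleftrightarrow> U = V" if UV: "U \<in> W1_0 \<Omega> s" "V \<in> W1_0 \<Omega> s" for U V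
  proof -
    obtain u where u: "u \<in> sob0 \<Omega> s" "U = ae_class \<Omega> u" by (rule W1_0_rep[OF UV(1) s1])
    obtain v where v: "v \<in> sob0 \<Omega> s" "V = ae_class \<Omega> v" by (rule W1_0_rep[OF UV(2) s1])
    have d: "grad_norm \<Omega> s (minus_class \<Omega> U V) = grad_seminorm \<Omega> s (\<lambda>x. u x - v x)"
      using u v s1 by (simp add: grad_norm_minus_class sob0_sob)
    have ds: "(\<lambda>x. u x - v x) \<in> sob0 \<Omega> s" by (rule sob0_diff[OF u(1) v(1) s1])
    show ?thesis
    proof
      assume "grad_norm \<Omega> s (minus_class \<Omega> U V) = 0"
      then have "L_norm \<Omega> s (\<lambda>x. u x - v x) = 0"
        using C(2)[OF ds] d L_norm_nonneg[of \<Omega> s "\<lambda>x. u x - v x"] by simp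
      then have "AE x in lebesgue_on \<Omega>. u x - v x = 0"
        by (rule L_norm_eq_0D[OF sob_L_space[OF sob0_sob[OF ds]]])
      then have "AE x in lebesgue_on \<Omega>. u x = v x" by eventually_elim simp
      then show "U = V" unfolding u v by (rule ae_class_cong)
    next
      assume "U = V"
      then have "AE x in lebesgue_on \<Omega>. u x = v x"
        using u v ae_class_eq_iff[OF sob_measurable[OF sob0_sob[OF u(1)]]] by simp
      then have "AE x in lebesgue_on \<Omega>. u x - v x = 0" by eventually_elim simp
      from sob_cong_AE(2)[OF sob0_sob[OF ds] this] show "grad_norm \<Omega> s (minus_class \<Omega> U V) = 0"
        using d sob_zero_norms[OF s1] by simp
    qed
  qed
  show "grad_norm \<Omega> s (minus_class \<Omega> U W) \<le> grad_norm \<Omega> s (minus_class \<Omega> U V) + grad_norm \<Omega> s (minus_class \<Omega> V W)"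
    if UV: "U \<in> W1_0 \<Omega> s" "V \<in> W1_0 \<Omega> s" "W \<in> W1_0 \<Omega> s" for U V W
  proof -
    obtain u where u: "u \<in> sob0 \<Omega> s" "U = ae_class \<Omega> u" by (rule W1_0_rep[OF UV(1) s1])
    obtain v where v: "v \<in> sob0 \<Omega> s" "V = ae_class \<Omega> v" by (rule W1_0_rep[OF UV(2) s1])
    obtain w where w: "w \<in> sob0 \<Omega> s" "W = ae_class \<Omega> w" by (rule W1_0_rep[OF UV(3) s1])
    note S = u(1)[THEN sob0_sob] v(1)[THEN sob0_sob] w(1)[THEN sob0_sob]
    show ?thesis
      using sob_lincomb(2)[OF sob_diff[OF S(1,2) s1] sob_diff[OF S(2,3) s1] s1, of 1 1]
      by (simp add: u v w grad_norm_minus_class S s1)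
  qed
qed

end

section \<open>Genus and odd continuous maps\<close>

text \<open>Every admissible \<open>h\<close> on \<open>B\<close> yields the admissible \<open>h \<circ> P\<close> on \<open>A\<close> with the same \<open>k\<close>.\<close>

lemma genus_le_if_odd_continuous:
  assumes cont: "continuous_map (subtopology X A) (subtopology Y B) P" and img: "P ` A = B"
    and odd: "\<And>u. u \<in> A \<Longrightarrow> P (negX u) = negY (P u)"
  shows "genus X negX A \<le> genus Y negY B"
proof (cases "A = {}")
  case True
  then show ?thesis using img by (simp add: genus_def)
next
  case False
  then have B: "B \<noteq> {}" using img by auto
  have pull: "\<exists>h. continuous_map (subtopology X A) (subtopology (Euclidean_space k) (- {\<lambda>i. 0})) h \<and>
       (\<forall>u\<in>A. h (negX u) = (\<lambda>i. - h u i))"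
    if h: "continuous_map (subtopology Y B) (subtopology (Euclidean_space k) (- {\<lambda>i. 0})) h" "\<forall>u\<in>B. h (negY u) = (\<lambda>i. - h u i)"
    for k h
  proof (intro exI[of _ "h \<circ> P"] conjI ballI)
    show "continuous_map (subtopology X A) (subtopology (Euclidean_space k) (- {\<lambda>i. 0})) (h \<circ> P)"
      by (rule continuous_map_compose[OF cont h(1)])
    fix u assume u: "u \<in> A"
    then have "P u \<in> B" using img by blast
    then show "(h \<circ> P) (negX u) = (\<lambda>i. - (h \<circ> P) u i)"
      using odd[OF u] h(2) by simp
  qed
  show ?thesis
    unfolding genus_def if_not_P[OF False] if_not_P[OF B]
  proof (intro Inf_superset_mono subsetI)
    fix e assume "e \<in> {enat k | k. \<exists>h.
       continuous_map (subtopology Y B) (subtopology (Euclidean_space k) (- {\<lambda>i. 0})) h \<and>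
       (\<forall>u\<in>B. h (negY u) = (\<lambda>i. - h u i))}"
    then obtain k h where "e = enat k"
      "continuous_map (subtopology Y B) (subtopology (Euclidean_space k) (- {\<lambda>i. 0})) h"
      "\<forall>u\<in>B. h (negY u) = (\<lambda>i. - h u i)" by auto
    with pull[of k h] show "e \<in> {enat k | k. \<exists>h.
       continuous_map (subtopology X A) (subtopology (Euclidean_space k) (- {\<lambda>i. 0})) h \<and>
       (\<forall>u\<in>A. h (negX u) = (\<lambda>i. - h u i))}" by simp
  qed
qed

lemma (in Metric_space) continuous_map_Lipschitz_real:
  assumes "\<And>x y. x \<in> M \<Longrightarrow> y \<in> M \<Longrightarrow> \<bar>f x - f y\<bar> \<le> L * d x y"
  shows "continuous_map mtopology euclideanreal f"
proof -
  have "continuous_map mtopology Met_TC.mtopology f"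
    unfolding metric_continuous_map[OF Met_TC.Metric_space_axioms]
  proof (intro conjI ballI allI impI)
    fix a and e :: real assume a: "a \<in> M" and e: "0 < e"
    show "\<exists>\<delta>>0. \<forall>x. x \<in> M \<and> d a x < \<delta> \<longrightarrow> dist (f a) (f x) < e"
    proof (intro exI[of _ "e / (\<bar>L\<bar> + 1)"] conjI allI impI)
      show "0 < e / (\<bar>L\<bar> + 1)" using e by simp
      fix x assume x: "x \<in> M \<and> d a x < e / (\<bar>L\<bar> + 1)"
      have "\<bar>f a - f x\<bar> \<le> L * d a x" using assms a x by blast
      also have "\<dots> \<le> (\<bar>L\<bar> + 1) * d a x" by (intro mult_right_mono) auto
      also have "\<dots> < e" using x by (simp add: field_simps)
      finally show "dist (f a) (f x) < e" by (simp add: dist_real_def)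
    qed
  qed simp
  then show ?thesis by simp
qed

context bounded_open_set
begin

lemma topspace_W1_0_topology:
  "1 < s \<Longrightarrow> topspace (W1_0_topology \<Omega> s) = W1_0 \<Omega> s"
  unfolding W1_0_topology_def by (rule Metric_space.topspace_mtopology[OF Metric_space_W1_0])

lemma Sigma_k_image:
  assumes A: "A \<in> Sigma_k \<Omega> k s" and s: "1 < s"
    and cont: "continuous_map (subtopology (W1_0_topology \<Omega> s) A) (W1_0_topology \<Omega> s') P"
    and sub: "P ` A \<subseteq> W1_0 \<Omega> s' - {zero_class \<Omega>}"
    and odd: "\<And>U. U \<in> A \<Longrightarrow> P (uminus_class \<Omega> U) = uminus_class \<Omega> (P U)"
  shows "P ` A \<in> Sigma_k \<Omega> k s'"
proof -
  let ?X = "W1_0_topology \<Omega> s" and ?Y = "W1_0_topology \<Omega> s'"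
  have A': "uminus_class \<Omega> ` A = A" "compactin ?X A" "enat k \<le> genus ?X (uminus_class \<Omega>) A"
    using A by (auto simp: Sigma_k_def)
  have "uminus_class \<Omega> ` P ` A = P ` uminus_class \<Omega> ` A"
    using odd by (force simp: image_image)
  then have "uminus_class \<Omega> ` P ` A = P ` A" by (simp add: A'(1))
  moreover have "compactin ?Y (P ` A)"
    by (rule image_compactin[OF _ cont]) (simp add: A'(2))
  moreover have "genus ?X (uminus_class \<Omega>) A \<le> genus ?Y (uminus_class \<Omega>) (P ` A)"
  proof (rule genus_le_if_odd_continuous[where P=P])
    show "continuous_map (subtopology ?X A) (subtopology ?Y (P ` A)) P"
      using cont by (auto simp: continuous_map_in_subtopology)
  qed (use odd in auto)
  ultimately show ?thesis
    using sub A'(3) by (auto simp: Sigma_k_def)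
qed

lemma W1_0_mono:
  assumes "1 \<le> q" "q \<le> r"
  shows "W1_0 \<Omega> r \<subseteq> W1_0 \<Omega> q"
proof -
  have "1 \<le> r" using assms by simp
  then show ?thesis using sob0_mono[OF assms] assms(1) by (auto simp: W1_0_eq)
qed

lemma continuous_map_W1_0_embedding:
  assumes q: "1 < q" and qr: "q \<le> r"
  shows "continuous_map (W1_0_topology \<Omega> r) (W1_0_topology \<Omega> q) (\<lambda>U. U)"
proof -
  have r: "1 < r" and q1: "1 \<le> q" "1 \<le> r" using q qr by auto
  interpret R: Metric_space "W1_0 \<Omega> r" "\<lambda>U V. grad_norm \<Omega> r (minus_class \<Omega> U V)"
    by (rule Metric_space_W1_0[OF r])
  show ?thesis
    unfolding W1_0_topology_def R.metric_continuous_map[OF Metric_space_W1_0[OF q]]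
  proof (intro conjI ballI allI impI)
    show "(\<lambda>U. U) ` W1_0 \<Omega> r \<subseteq> W1_0 \<Omega> q" using W1_0_mono[OF q1(1) qr] by simp
    fix U and e :: real assume U: "U \<in> W1_0 \<Omega> r" and e: "0 < e"
    obtain d where d: "d > 0" "\<And>u. u \<in> sob \<Omega> r \<Longrightarrow> grad_seminorm \<Omega> r u < d \<Longrightarrow> grad_seminorm \<Omega> q u < e"
      using grad_seminorm_small_mono[OF q1(1) qr e] by metis
    show "\<exists>\<delta>>0. \<forall>V. V \<in> W1_0 \<Omega> r \<and> grad_norm \<Omega> r (minus_class \<Omega> U V) < \<delta> \<longrightarrow> grad_norm \<Omega> q (minus_class \<Omega> U V) < e"
    proof (intro exI[of _ d] conjI allI impI d(1))
      fix V assume V: "V \<in> W1_0 \<Omega> r \<and> grad_norm \<Omega> r (minus_class \<Omega> U V) < d"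
      obtain u where u: "u \<in> sob0 \<Omega> r" "U = ae_class \<Omega> u" by (rule W1_0_rep[OF U q1(2)])
      obtain v where v: "v \<in> sob0 \<Omega> r" "V = ae_class \<Omega> v" by (rule W1_0_rep[OF conjunct1[OF V] q1(2)])
      note S = sob0_sob[OF u(1)] sob0_sob[OF v(1)]
      have "grad_seminorm \<Omega> r (\<lambda>x. u x - v x) < d"
        using V u v S q1 by (simp add: grad_norm_minus_class)
      then have "grad_seminorm \<Omega> q (\<lambda>x. u x - v x) < e"
        by (rule d(2)[OF sob_diff[OF S q1(2)]])
      then show "grad_norm \<Omega> q (minus_class \<Omega> U V) < e"
        using sob_mono[OF q1(1) qr] S q1 by (simp add: u v grad_norm_minus_class)
    qed
  qed
qed

lemma Sigma_k_mono:
  assumes q: "1 < q" and qr: "q \<le> r" and A: "A \<in> Sigma_k \<Omega> k r"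
  shows "A \<in> Sigma_k \<Omega> k q"
proof -
  have "(\<lambda>U. U) ` A \<in> Sigma_k \<Omega> k q"
  proof (rule Sigma_k_image[OF A])
    show "1 < r" using q qr by simp
    show "continuous_map (subtopology (W1_0_topology \<Omega> r) A) (W1_0_topology \<Omega> q) (\<lambda>U. U)"
      by (rule continuous_map_from_subtopology[OF continuous_map_W1_0_embedding[OF q qr]])
    show "(\<lambda>U. U) ` A \<subseteq> W1_0 \<Omega> q - {zero_class \<Omega>}"
      using A W1_0_mono[of q r] q qr by (auto simp: Sigma_k_def)
  qed auto
  then show ?thesis by simp
qed

lemma lambda_k_le_lambda_k2:
  assumes "1 < q" "q \<le> r"
  shows "lambda_k \<Omega> k q \<le> lambda_k2 \<Omega> k q r"
  unfolding lambda_k_def lambda_k2_def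
  by (rule INF_superset_mono) (use Sigma_k_mono[OF assms] in auto)

section \<open>Finite-dimensional approximation\<close>

lemma sum_test_functions:
  assumes "finite T" "\<And>\<phi>. \<phi> \<in> T \<Longrightarrow> F \<phi> \<in> test_functions \<Omega>"
  shows "(\<lambda>x. \<Sum>\<phi>\<in>T. c \<phi> * F \<phi> x) \<in> test_functions \<Omega>"
  using assms
proof (induction T rule: finite_induct)
  case (insert \<psi> T)
  then show ?case
    using test_functions_lincomb[of "F \<psi>" \<Omega> "\<lambda>x. \<Sum>\<phi>\<in>T. c \<phi> * F \<phi> x" "c \<psi>" 1] by simp
qed (simp add: zero_test_function)

lemma sob_sum:
  assumes "finite T" "\<And>\<phi>. \<phi> \<in> T \<Longrightarrow> F \<phi> \<in> sob \<Omega> s" "1 \<le> s"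
  shows "(\<lambda>x. \<Sum>\<phi>\<in>T. c \<phi> * F \<phi> x) \<in> sob \<Omega> s
    \<and> grad_seminorm \<Omega> s (\<lambda>x. \<Sum>\<phi>\<in>T. c \<phi> * F \<phi> x) \<le> (\<Sum>\<phi>\<in>T. \<bar>c \<phi>\<bar> * grad_seminorm \<Omega> s (F \<phi>))"
  using assms(1,2)
proof (induction T rule: finite_induct)
  case empty
  then show ?case using test_function_sob(1)[OF zero_test_function assms(3)] sob_zero_norms[OF assms(3)] by simp
next
  case (insert \<psi> T)
  then show ?case
    using sob_lincomb[of "F \<psi>" s "\<lambda>x. \<Sum>\<phi>\<in>T. c \<phi> * F \<phi> x" "c \<psi>" 1] assms(3) by force
qed

lemma continuous_map_W1_0_dist:
  assumes s: "1 < s" and V: "V \<in> W1_0 \<Omega> s"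
  shows "continuous_map (W1_0_topology \<Omega> s) euclideanreal (\<lambda>U. grad_norm \<Omega> s (minus_class \<Omega> U V))"
    and "continuous_map (W1_0_topology \<Omega> s) euclideanreal (\<lambda>U. grad_norm \<Omega> s (minus_class \<Omega> (uminus_class \<Omega> U) V))"
proof -
  let ?d = "\<lambda>U V. grad_norm \<Omega> s (minus_class \<Omega> U V)"
  interpret Metric_space "W1_0 \<Omega> s" ?d
    by (rule Metric_space_W1_0[OF s])
  have s1: "1 \<le> s" using s by simp
  have L: "\<bar>?d U V - ?d W V\<bar> \<le> ?d U W" if "U \<in> W1_0 \<Omega> s" "W \<in> W1_0 \<Omega> s" for U W
    using triangle[OF that V] triangle[OF that(2,1) V] commute[of U W] by linarith
  show "continuous_map (W1_0_topology \<Omega> s) euclideanreal (\<lambda>U. ?d U V)"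
    unfolding W1_0_topology_def
    by (rule continuous_map_Lipschitz_real[where L=1]) (use L in simp)
  have neg: "?d (uminus_class \<Omega> U) (uminus_class \<Omega> W) = ?d U W" if UW: "U \<in> W1_0 \<Omega> s" "W \<in> W1_0 \<Omega> s" for U W
  proof -
    obtain u where u: "u \<in> sob0 \<Omega> s" "U = ae_class \<Omega> u" by (rule W1_0_rep[OF UW(1) s1])
    obtain w where w: "w \<in> sob0 \<Omega> s" "W = ae_class \<Omega> w" by (rule W1_0_rep[OF UW(2) s1])
    note S = sob0_sob[OF u(1)] sob0_sob[OF w(1)]
    note S' = sob0_sob[OF sob0_minus[OF u(1) s1]] sob0_sob[OF sob0_minus[OF w(1) s1]]
    have "?d (uminus_class \<Omega> U) (uminus_class \<Omega> W) = grad_seminorm \<Omega> s (\<lambda>x. - u x - - w x)"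
      by (simp only: u w uminus_ae_class[OF sob_measurable[OF S(1)]] uminus_ae_class[OF sob_measurable[OF S(2)]]
          grad_norm_minus_class[OF S' s1])
    also have "(\<lambda>x. - u x - - w x) = (\<lambda>x. w x - u x)" by auto
    also have "grad_seminorm \<Omega> s (\<lambda>x. w x - u x) = ?d W U"
      using S s1 by (simp add: u w grad_norm_minus_class)
    also have "\<dots> = ?d U W" by (rule commute)
    finally show ?thesis .
  qed
  show "continuous_map (W1_0_topology \<Omega> s) euclideanreal (\<lambda>U. ?d (uminus_class \<Omega> U) V)"
    unfolding W1_0_topology_def
    by (rule continuous_map_Lipschitz_real[where L=1]) (use L[OF uminus_W1_0 uminus_W1_0] s1 neg in simp)
qed

lemma uminus_uminus_W1_0:
  assumes "U \<in> W1_0 \<Omega> s" "1 \<le> s"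
  shows "uminus_class \<Omega> (uminus_class \<Omega> U) = U"
proof -
  obtain u where u: "u \<in> sob0 \<Omega> s" "U = ae_class \<Omega> u" by (rule W1_0_rep[OF assms])
  have "(\<lambda>x. - u x) \<in> borel_measurable (lebesgue_on \<Omega>)" "u \<in> borel_measurable (lebesgue_on \<Omega>)"
    using sob_measurable[OF sob0_sob[OF u(1)]] by auto
  then show ?thesis unfolding u(2) by (simp add: uminus_ae_class)
qed

text \<open>A Schauder projection made odd. Let \<open>w \<phi> U\<close> be the positive part of \<open>\<delta> - \<parallel>\<nabla>(U - \<phi>)\<parallel>\<close> for the
  centres \<open>\<phi>\<close> of a finite \<open>\<delta>\<close>-net. Then \<open>p U\<close> is the average of the points \<open>\<phi>\<close> with weights \<open>w \<phi> U\<close>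
  and of the points \<open>-\<phi>\<close> with weights \<open>w \<phi> (-U)\<close>. Each point of positive weight has distance less
  than \<open>\<delta>\<close> from \<open>U\<close>, hence so has the average; replacing \<open>U\<close> by \<open>-U\<close> exchanges the two families of weights.
  The coefficients are continuous real functions of \<open>U\<close>, and this makes \<open>p\<close> continuous for any
  exponent \<open>r\<close>.\<close>

lemma exists_finite_rank_odd_approximation:
  assumes q: "1 < q" and r: "1 < r" and d: "0 < \<delta>"
    and A: "A \<subseteq> W1_0 \<Omega> q" "compactin (W1_0_topology \<Omega> q) A" "uminus_class \<Omega> ` A = A"
  obtains p where "\<And>U. U \<in> A \<Longrightarrow> p U \<in> test_functions \<Omega>"
    "continuous_map (subtopology (W1_0_topology \<Omega> q) A) (W1_0_topology \<Omega> r) (\<lambda>U. ae_class \<Omega> (p U))"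
    "\<And>U. U \<in> A \<Longrightarrow> p (uminus_class \<Omega> U) = (\<lambda>x. - p U x)"
    "\<And>U. U \<in> A \<Longrightarrow> grad_norm \<Omega> q (minus_class \<Omega> U (ae_class \<Omega> (p U))) \<le> \<delta>"
proof -
  have q1: "1 \<le> q" and r1: "1 \<le> r" using q r by auto
  let ?X = "subtopology (W1_0_topology \<Omega> q) A"
  let ?n = "uminus_class \<Omega>"
  let ?d = "\<lambda>U \<phi>. grad_norm \<Omega> q (minus_class \<Omega> U (ae_class \<Omega> \<phi>))"
  interpret Q: Metric_space "W1_0 \<Omega> q" "\<lambda>U V. grad_norm \<Omega> q (minus_class \<Omega> U V)"
    by (rule Metric_space_W1_0[OF q])
  interpret R: Metric_space "W1_0 \<Omega> r" "\<lambda>U V. grad_norm \<Omega> r (minus_class \<Omega> U V)"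
    by (rule Metric_space_W1_0[OF r])
  have tW: "ae_class \<Omega> \<phi> \<in> W1_0 \<Omega> s" if "\<phi> \<in> test_functions \<Omega>" "1 \<le> s" for \<phi> s
    using test_function_sob0[OF that] W1_0_eq[OF that(2)] by simp
  have nA: "?n U \<in> A" if "U \<in> A" for U using that A(3) by blast
  have nn: "?n (?n U) = U" if "U \<in> A" for U using that A(1) uminus_uminus_W1_0[OF _ q1] by blast
  have topX: "topspace ?X = A"
    using A(1) topspace_W1_0_topology[OF q] by auto
  have dense: "\<exists>\<phi>\<in>test_functions \<Omega>. ?d U \<phi> < \<delta>" if U: "U \<in> W1_0 \<Omega> q" for U
  proof -
    obtain u where u: "u \<in> sob0 \<Omega> q" "U = ae_class \<Omega> u" by (rule W1_0_rep[OF U q1])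
    then obtain \<phi> where \<phi>: "\<phi> \<in> test_functions \<Omega>" "grad_seminorm \<Omega> q (\<lambda>x. u x - \<phi> x) < \<delta>"
      using d by (auto simp: sob0_def)
    then show ?thesis
      using u q1 by (intro bexI[OF _ \<phi>(1)]) (simp add: grad_norm_minus_class sob0_sob test_function_sob)
  qed
  obtain T where T: "finite T" "T \<subseteq> test_functions \<Omega>" "\<And>U. U \<in> A \<Longrightarrow> \<exists>\<phi>\<in>T. ?d U \<phi> < \<delta>"
  proof -
    let ?B = "\<lambda>\<phi>. Q.mball (ae_class \<Omega> \<phi>) \<delta>"
    have cover: "A \<subseteq> \<Union>(?B ` test_functions \<Omega>)"
    proof
      fix U assume U: "U \<in> A"
      then obtain \<phi> where "\<phi> \<in> test_functions \<Omega>" "?d U \<phi> < \<delta>" using dense A(1) by blast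
      then show "U \<in> \<Union>(?B ` test_functions \<Omega>)"
        using U A(1) tW[OF _ q1] Q.commute[of U "ae_class \<Omega> \<phi>"] by (auto intro!: bexI[of _ \<phi>])
    qed
    have op: "openin (W1_0_topology \<Omega> q) B" if "B \<in> ?B ` test_functions \<Omega>" for B
      using that by (auto simp: W1_0_topology_def)
    obtain F where F: "finite F" "F \<subseteq> ?B ` test_functions \<Omega>" "A \<subseteq> \<Union>F"
      using compactinD[OF A(2) op cover] by blast
    obtain T where T: "T \<subseteq> test_functions \<Omega>" "finite T" "F = ?B ` T"
      using finite_subset_image[OF F(1,2)] by blast
    show ?thesis
    proof (rule that[OF T(2,1)])
      fix U assume "U \<in> A"
      then obtain \<phi> where "\<phi> \<in> T" "U \<in> ?B \<phi>" using F(3) T(3) by blast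
      then show "\<exists>\<phi>\<in>T. ?d U \<phi> < \<delta>"
        using Q.commute[of U "ae_class \<Omega> \<phi>"] by (intro bexI[of _ \<phi>]) auto
    qed
  qed
  define w where "w \<phi> U = max 0 (\<delta> - ?d U \<phi>)" for \<phi> U
  define S where "S U = (\<Sum>\<phi>\<in>T. w \<phi> U + w \<phi> (?n U))" for U
  define c where "c U \<phi> = (w \<phi> U - w \<phi> (?n U)) / S U" for U \<phi>
  define p where "p U x = (\<Sum>\<phi>\<in>T. c U \<phi> * \<phi> x)" for U x
  have w0: "w \<phi> U \<ge> 0" for \<phi> U by (simp add: w_def)
  have Spos: "S U > 0" if U: "U \<in> A" for U
  proof -
    obtain \<phi> where \<phi>: "\<phi> \<in> T" "?d U \<phi> < \<delta>" using T(3)[OF U] by blast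
    have "0 < w \<phi> U + w \<phi> (?n U)" using \<phi>(2) w0[of \<phi> "?n U"] by (simp add: w_def)
    then show ?thesis
      unfolding S_def using T(1) \<phi>(1) w0 by (intro sum_pos2[of T \<phi>]) auto
  qed
  have codd: "c (?n U) \<phi> = - c U \<phi>" if U: "U \<in> A" for U \<phi>
    using nn[OF U] by (simp add: c_def S_def add.commute minus_divide_left)
  have cont_c: "continuous_map ?X euclideanreal (\<lambda>U. c U \<phi>)" if \<phi>: "\<phi> \<in> T" for \<phi>
  proof -
    have cw: "continuous_map ?X euclideanreal (\<lambda>U. w \<psi> U)" "continuous_map ?X euclideanreal (\<lambda>U. w \<psi> (?n U))"
      if "\<psi> \<in> T" for \<psi>
    proof -
      have W: "ae_class \<Omega> \<psi> \<in> W1_0 \<Omega> q" using that T(2) tW[OF _ q1] by blast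
      note D = continuous_map_W1_0_dist[OF q W, THEN continuous_map_from_subtopology]
      show "continuous_map ?X euclideanreal (\<lambda>U. w \<psi> U)" "continuous_map ?X euclideanreal (\<lambda>U. w \<psi> (?n U))"
        unfolding w_def by (intro continuous_map_real_max continuous_map_diff D continuous_map_const[THEN iffD2] disjI2; simp)+
    qed
    have cS: "continuous_map ?X euclideanreal S"
      unfolding S_def by (intro continuous_map_sum[OF T(1)] continuous_map_add cw)
    show ?thesis
      unfolding c_def by (intro continuous_map_real_divide continuous_map_diff cw \<phi> cS) (use Spos topX in force)
  qed
  have p_test: "p U \<in> test_functions \<Omega>" for U
    unfolding p_def using sum_test_functions[OF T(1), of "\<lambda>\<phi>. \<phi>"] T(2) by blast
  show ?thesis
  proof (rule that)
    show "p U \<in> test_functions \<Omega>" for U by (rule p_test)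
    show "p (?n U) = (\<lambda>x. - p U x)" if "U \<in> A" for U
      by (rule ext) (simp add: p_def codd[OF that] sum_negf)
    show "continuous_map ?X (W1_0_topology \<Omega> r) (\<lambda>U. ae_class \<Omega> (p U))"
      unfolding W1_0_topology_def[of \<Omega> r] R.continuous_map_to_metric
    proof (intro ballI allI impI)
      fix U and e :: real assume U: "U \<in> topspace ?X" and e: "0 < e"
      \<comment> \<open>a modulus of continuity of \<open>p\<close> at \<open>U\<close> for exponent \<open>r\<close>, in terms of the coefficients\<close>
      define E where "E V = (\<Sum>\<phi>\<in>T. \<bar>c U \<phi> - c V \<phi>\<bar> * grad_seminorm \<Omega> r \<phi>)" for V
      have cE: "continuous_map ?X euclideanreal E"
        unfolding E_def
        by (intro continuous_map_sum[OF T(1)] continuous_map_real_mult continuous_map_real_abs continuous_map_diff cont_c)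
          auto
      have "openin ?X {V \<in> topspace ?X. E V \<in> {..<e}}"
        by (rule openin_continuous_map_preimage[OF cE]) auto
      moreover have "ae_class \<Omega> (p V) \<in> R.mball (ae_class \<Omega> (p U)) e" if "E V < e" for V
      proof -
        have "grad_norm \<Omega> r (minus_class \<Omega> (ae_class \<Omega> (p U)) (ae_class \<Omega> (p V))) = grad_seminorm \<Omega> r (\<lambda>x. p U x - p V x)"
          by (intro grad_norm_minus_class test_function_sob p_test r1)
        also have "(\<lambda>x. p U x - p V x) = (\<lambda>x. \<Sum>\<phi>\<in>T. (c U \<phi> - c V \<phi>) * \<phi> x)"
          by (simp add: p_def sum_subtractf[symmetric] left_diff_distrib)
        also have "grad_seminorm \<Omega> r (\<lambda>x. \<Sum>\<phi>\<in>T. (c U \<phi> - c V \<phi>) * \<phi> x) \<le> E V"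
          unfolding E_def
          by (rule sob_sum[OF T(1) _ r1, THEN conjunct2]) (use test_function_sob(1)[OF _ r1] T(2) in blast)
        finally show ?thesis using that tW[OF p_test r1] by simp
      qed
      moreover have "E U = 0" by (simp add: E_def)
      ultimately show "\<exists>O'. openin ?X O' \<and> U \<in> O' \<and> (\<forall>V\<in>O'. ae_class \<Omega> (p V) \<in> R.mball (ae_class \<Omega> (p U)) e)"
        using U e by (intro exI[of _ "{V \<in> topspace ?X. E V \<in> {..<e}}"]) auto
    qed
    show "?d U (p U) \<le> \<delta>" if U: "U \<in> A" for U
    proof -
      have UW: "U \<in> W1_0 \<Omega> q" using U A(1) by blast
      obtain u where u: "u \<in> sob0 \<Omega> q" "U = ae_class \<Omega> u" by (rule W1_0_rep[OF UW q1])
      note us = sob0_sob[OF u(1)]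
      have Ts: "\<phi> \<in> sob \<Omega> q" if "\<phi> \<in> T" for \<phi>
        using that T(2) test_function_sob(1)[OF _ q1] by blast
      \<comment> \<open>normalised weights of \<open>\<phi>\<close> and \<open>-\<phi>\<close>: \<open>u - p U\<close> is the average of \<open>u - \<phi>\<close> and \<open>u + \<phi>\<close>\<close>
      define a where "a \<phi> = w \<phi> U / S U" for \<phi>
      define b where "b \<phi> = w \<phi> (?n U) / S U" for \<phi>
      have ab0: "a \<phi> \<ge> 0" "b \<phi> \<ge> 0" for \<phi>
        using w0 Spos[OF U] by (auto simp: a_def b_def)
      have ab1: "(\<Sum>\<phi>\<in>T. a \<phi>) + (\<Sum>\<phi>\<in>T. b \<phi>) = 1"
        using Spos[OF U] by (simp add: a_def b_def S_def sum_divide_distrib[symmetric] add_divide_distrib[symmetric] sum.distrib)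
      let ?f = "\<lambda>\<phi> x. u x - \<phi> x" and ?g = "\<lambda>\<phi> x. u x + \<phi> x"
      have f: "?f \<phi> \<in> sob \<Omega> q" and g: "?g \<phi> \<in> sob \<Omega> q" if "\<phi> \<in> T" for \<phi>
        using sob_diff[OF us Ts[OF that] q1] sob_lincomb(1)[OF us Ts[OF that] q1, of 1 1] by auto
      have fa: "a \<phi> * grad_seminorm \<Omega> q (?f \<phi>) \<le> a \<phi> * \<delta>" if \<phi>: "\<phi> \<in> T" for \<phi>
      proof (cases "w \<phi> U = 0")
        case False
        then have "?d U \<phi> < \<delta>" by (simp add: w_def max_def split: if_splits)
        then have "grad_seminorm \<Omega> q (?f \<phi>) < \<delta>"
          using us Ts[OF \<phi>] q1 by (simp add: u grad_norm_minus_class)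
        then show ?thesis using ab0 by (intro mult_left_mono) auto
      qed (simp add: a_def)
      have gb: "b \<phi> * grad_seminorm \<Omega> q (?g \<phi>) \<le> b \<phi> * \<delta>" if \<phi>: "\<phi> \<in> T" for \<phi>
      proof (cases "w \<phi> (?n U) = 0")
        case False
        then have "?d (?n U) \<phi> < \<delta>" by (simp add: w_def max_def split: if_splits)
        then have "grad_seminorm \<Omega> q (\<lambda>x. - u x - \<phi> x) < \<delta>"
          using sob_measurable[OF us] Ts[OF \<phi>] q1 sob0_sob[OF sob0_minus[OF u(1) q1]]
          by (simp add: u uminus_ae_class grad_norm_minus_class)
        moreover have "grad_seminorm \<Omega> q (?g \<phi>) \<le> grad_seminorm \<Omega> q (\<lambda>x. - u x - \<phi> x)"
          using sob_lincomb(2)[OF sob_diff[OF sob0_sob[OF sob0_minus[OF u(1) q1]] Ts[OF \<phi>] q1] us q1, of "-1" 0]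
          by (simp add: add.commute)
        ultimately show ?thesis using ab0 by (intro mult_left_mono) auto
      qed (simp add: b_def)
      let ?F = "\<lambda>x. \<Sum>\<phi>\<in>T. a \<phi> * ?f \<phi> x" and ?G = "\<lambda>x. \<Sum>\<phi>\<in>T. b \<phi> * ?g \<phi> x"
      have F: "?F \<in> sob \<Omega> q" "grad_seminorm \<Omega> q ?F \<le> (\<Sum>\<phi>\<in>T. a \<phi> * \<delta>)"
        and G: "?G \<in> sob \<Omega> q" "grad_seminorm \<Omega> q ?G \<le> (\<Sum>\<phi>\<in>T. b \<phi> * \<delta>)"
        using sob_sum[OF T(1), of ?f q a] sob_sum[OF T(1), of ?g q b] f g q1 ab0 sum_mono[OF fa] sum_mono[OF gb]
        by force+
      have "(\<lambda>x. u x - p U x) = (\<lambda>x. 1 * ?F x + 1 * ?G x)"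
      proof
        fix x
        have "1 * ?F x + 1 * ?G x = u x * ((\<Sum>\<phi>\<in>T. a \<phi>) + (\<Sum>\<phi>\<in>T. b \<phi>)) - (\<Sum>\<phi>\<in>T. (a \<phi> - b \<phi>) * \<phi> x)"
          by (simp add: algebra_simps sum.distrib sum_subtractf sum_distrib_left)
        also have "(\<lambda>\<phi>. a \<phi> - b \<phi>) = c U"
          by (simp add: a_def b_def c_def fun_eq_iff diff_divide_distrib)
        finally show "u x - p U x = 1 * ?F x + 1 * ?G x" using ab1 by (simp add: p_def fun_eq_iff a_def b_def c_def diff_divide_distrib)
      qed
      then have "grad_seminorm \<Omega> q (\<lambda>x. u x - p U x) \<le> grad_seminorm \<Omega> q ?F + grad_seminorm \<Omega> q ?G"
        using sob_lincomb(2)[OF F(1) G(1) q1, of 1 1] by simp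
      also have "\<dots> \<le> ((\<Sum>\<phi>\<in>T. a \<phi>) + (\<Sum>\<phi>\<in>T. b \<phi>)) * \<delta>"
        using F(2) G(2) by (simp add: distrib_right sum_distrib_right)
      also have "\<dots> = \<delta>" by (simp add: ab1)
      finally show ?thesis
        using us test_function_sob(1)[OF p_test q1] q1 by (simp add: u grad_norm_minus_class)
    qed
  qed
qed

section \<open>Comparison of Rayleigh quotients\<close>

text \<open>By the Poincare inequality, the norm of \<open>L\<^sup>q\<close> is Lipschitz for the gradient metric.\<close>

lemma fun_norm_diff_le:
  assumes q: "1 < q"
  obtains C where "C > 0" "\<And>U V. U \<in> W1_0 \<Omega> q \<Longrightarrow> V \<in> W1_0 \<Omega> q \<Longrightarrow>
     \<bar>fun_norm \<Omega> q U - fun_norm \<Omega> q V\<bar> \<le> C * grad_norm \<Omega> q (minus_class \<Omega> U V)"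
proof -
  have q1: "1 \<le> q" using q by simp
  obtain C where C: "C > 0" "\<And>u. u \<in> sob0 \<Omega> q \<Longrightarrow> L_norm \<Omega> q u \<le> C * grad_seminorm \<Omega> q u"
    using poincare[OF q] by metis
  have one: "fun_norm \<Omega> q U - fun_norm \<Omega> q V \<le> C * grad_norm \<Omega> q (minus_class \<Omega> U V)"
    if UV: "U \<in> W1_0 \<Omega> q" "V \<in> W1_0 \<Omega> q" for U V
  proof -
    obtain u where u: "u \<in> sob0 \<Omega> q" "U = ae_class \<Omega> u" by (rule W1_0_rep[OF UV(1) q1])
    obtain v where v: "v \<in> sob0 \<Omega> q" "V = ae_class \<Omega> v" by (rule W1_0_rep[OF UV(2) q1])
    note S = sob0_sob[OF u(1)] sob0_sob[OF v(1)]
    have "L_norm \<Omega> q u \<le> L_norm \<Omega> q (\<lambda>x. u x - v x) + L_norm \<Omega> q v"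
      using L_norm_lincomb_le[OF sob_L_space[OF sob_diff[OF S q1]] sob_L_space[OF S(2)] q1, of 1 1] by simp
    moreover have "L_norm \<Omega> q (\<lambda>x. u x - v x) \<le> C * grad_seminorm \<Omega> q (\<lambda>x. u x - v x)"
      by (rule C(2)[OF sob0_diff[OF u(1) v(1) q1]])
    ultimately show ?thesis
      using S q1 by (simp add: u v fun_norm_ae_class sob_measurable grad_norm_minus_class)
  qed
  show ?thesis
  proof (rule that[OF C(1)])
    fix U V assume "U \<in> W1_0 \<Omega> q" "V \<in> W1_0 \<Omega> q"
    then show "\<bar>fun_norm \<Omega> q U - fun_norm \<Omega> q V\<bar> \<le> C * grad_norm \<Omega> q (minus_class \<Omega> U V)"
      using one[of U V] one[of V U, folded grad_norm_minus_class_commute[of q U V]] by simp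
  qed
qed

lemma grad_norm_diff_le:
  assumes q: "1 < q" and UV: "U \<in> W1_0 \<Omega> q" "V \<in> W1_0 \<Omega> q"
  shows "grad_norm \<Omega> q V \<le> grad_norm \<Omega> q U + grad_norm \<Omega> q (minus_class \<Omega> U V)"
proof -
  have q1: "1 \<le> q" using q by simp
  obtain u where u: "u \<in> sob0 \<Omega> q" "U = ae_class \<Omega> u" by (rule W1_0_rep[OF UV(1) q1])
  obtain v where v: "v \<in> sob0 \<Omega> q" "V = ae_class \<Omega> v" by (rule W1_0_rep[OF UV(2) q1])
  note S = sob0_sob[OF u(1)] sob0_sob[OF v(1)]
  show ?thesis
    using sob_lincomb(2)[OF S(1) sob_diff[OF S q1] q1, of 1 "-1"] S q1
    by (simp add: u v grad_norm_ae_class grad_norm_minus_class)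
qed

lemma fun_norm_pos:
  assumes "1 \<le> q" "U \<in> W1_0 \<Omega> q" "U \<noteq> zero_class \<Omega>"
  shows "0 < fun_norm \<Omega> q U"
proof -
  obtain u where u: "u \<in> sob0 \<Omega> q" "U = ae_class \<Omega> u" by (rule W1_0_rep[OF assms(2,1)])
  note S = sob0_sob[OF u(1)]
  have N: "fun_norm \<Omega> q U = L_norm \<Omega> q u"
    using S by (simp add: u fun_norm_ae_class sob_measurable)
  have "L_norm \<Omega> q u \<noteq> 0"
  proof
    assume "L_norm \<Omega> q u = 0"
    then have "AE x in lebesgue_on \<Omega>. u x = 0" by (rule L_norm_eq_0D[OF sob_L_space[OF S]])
    then have "U = zero_class \<Omega>" unfolding u zero_class_def by (rule ae_class_cong)
    then show False using assms(3) by simp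
  qed
  then show ?thesis using N L_norm_nonneg[of \<Omega> q u] by simp
qed

lemma fun_norm_zero_class: "1 \<le> q \<Longrightarrow> fun_norm \<Omega> q (zero_class \<Omega>) = 0"
  by (simp add: zero_class_def fun_norm_ae_class sob_zero_norms)

text \<open>For every \<open>x\<close> above the supremum, a sufficiently fine odd finite-rank approximation \<open>P\<close> of the
  identity on \<open>A\<close> has all Rayleigh quotients on \<open>P(A)\<close> below \<open>x\<close>. The empty \<open>A\<close>, which is admissible
  only for \<open>k = 0\<close>, is admissible for every exponent.\<close>

lemma lambda_k2_le_SUP:
  assumes q: "1 < q" and qr: "q \<le> r" and A: "A \<in> Sigma_k \<Omega> k q"
  shows "lambda_k2 \<Omega> k q r \<le> (SUP U\<in>A. ereal (rayleigh \<Omega> q U))"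
proof (cases "A = {}")
  case True
  have "A \<in> Sigma_k \<Omega> k r" using A True by (auto simp: Sigma_k_def genus_def)
  then show ?thesis unfolding lambda_k2_def by (intro INF_lower) (simp add: True)
next
  case False
  have r: "1 < r" and q1: "1 \<le> q" and r1: "1 \<le> r" using q qr by auto
  have AW: "A \<subseteq> W1_0 \<Omega> q" and A0: "zero_class \<Omega> \<notin> A" and Ac: "compactin (W1_0_topology \<Omega> q) A" and An: "uminus_class \<Omega> ` A = A"
    using A by (auto simp: Sigma_k_def)
  obtain C where C: "C > 0" "\<And>U V. U \<in> W1_0 \<Omega> q \<Longrightarrow> V \<in> W1_0 \<Omega> q \<Longrightarrow>
     \<bar>fun_norm \<Omega> q U - fun_norm \<Omega> q V\<bar> \<le> C * grad_norm \<Omega> q (minus_class \<Omega> U V)"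
    using fun_norm_diff_le[OF q] by metis
  interpret Q: Metric_space "W1_0 \<Omega> q" "\<lambda>U V. grad_norm \<Omega> q (minus_class \<Omega> U V)"
    by (rule Metric_space_W1_0[OF q])
  have "continuous_map (W1_0_topology \<Omega> q) euclideanreal (fun_norm \<Omega> q)"
    unfolding W1_0_topology_def by (rule Q.continuous_map_Lipschitz_real[OF C(2)])
  then have "compact (fun_norm \<Omega> q ` A)"
    using image_compactin[OF Ac] by fastforce
  then obtain U0 where U0: "U0 \<in> A" "\<And>U. U \<in> A \<Longrightarrow> fun_norm \<Omega> q U0 \<le> fun_norm \<Omega> q U"
    using compact_attains_inf[of "fun_norm \<Omega> q ` A"] False by auto
  define m where "m = fun_norm \<Omega> q U0"
  have m: "m > 0"
    unfolding m_def using U0(1) A0 AW by (intro fun_norm_pos[OF q1]) auto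
  let ?\<Lambda> = "SUP U\<in>A. ereal (rayleigh \<Omega> q U)"
  have up: "ereal (rayleigh \<Omega> q U) \<le> ?\<Lambda>" if "U \<in> A" for U
    using that by (rule SUP_upper)
  have R0: "0 \<le> rayleigh \<Omega> q U" for U by (simp add: rayleigh_def)
  show ?thesis
  proof (rule dense_ge)
    fix y assume y: "?\<Lambda> < y"
    show "lambda_k2 \<Omega> k q r \<le> y"
    proof (cases "y = \<infinity>")
      case False
      have "0 \<le> ?\<Lambda>" using up[OF U0(1)] R0[of U0] by (meson ereal_less_eq(5) order_trans)
      then obtain t where t: "?\<Lambda> = ereal t" "0 \<le> t" using y by (cases ?\<Lambda>) auto
      obtain x where x: "y = ereal x" "t < x" using y t False by (cases y) auto
      define \<rho> where "\<rho> = t powr (1 / q)"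
      define \<rho>' where "\<rho>' = x powr (1 / q)"
      have \<rho>: "0 \<le> \<rho>" "\<rho> < \<rho>'" unfolding \<rho>_def \<rho>'_def using t x q by (auto intro!: powr_less_mono2)
      have \<rho>'q: "\<rho>' powr q = x" using t x q by (simp add: \<rho>'_def powr_powr)
      \<comment> \<open>the first bound gives \<open>\<rho> b + \<delta> \<le> \<rho>' (b - C \<delta>)\<close> for all \<open>b \<ge> m\<close>, the second keeps \<open>b - C \<delta>\<close> positive\<close>
      define \<delta> where "\<delta> = min ((\<rho>' - \<rho>) * m / (1 + \<rho>' * C)) (m / (2 * C))"
      have pos: "1 + \<rho>' * C > 0" using \<rho> C by (simp add: add_pos_nonneg)
      have \<delta>: "\<delta> > 0" using \<rho> m C pos by (simp add: \<delta>_def)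
      have \<delta>1: "\<delta> * (1 + \<rho>' * C) \<le> (\<rho>' - \<rho>) * m"
      proof -
        have "\<delta> \<le> (\<rho>' - \<rho>) * m / (1 + \<rho>' * C)" by (simp add: \<delta>_def)
        then show ?thesis using pos by (simp add: pos_le_divide_eq)
      qed
      have \<delta>2: "C * \<delta> < m"
      proof -
        have "\<delta> \<le> m / (2 * C)" by (simp add: \<delta>_def)
        then have "C * \<delta> \<le> m / 2" using C by (simp add: field_simps)
        then show ?thesis using m by simp
      qed
      obtain p where p: "\<And>U. U \<in> A \<Longrightarrow> p U \<in> test_functions \<Omega>"
        "continuous_map (subtopology (W1_0_topology \<Omega> q) A) (W1_0_topology \<Omega> r) (\<lambda>U. ae_class \<Omega> (p U))"
        "\<And>U. U \<in> A \<Longrightarrow> p (uminus_class \<Omega> U) = (\<lambda>x. - p U x)"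
        "\<And>U. U \<in> A \<Longrightarrow> grad_norm \<Omega> q (minus_class \<Omega> U (ae_class \<Omega> (p U))) \<le> \<delta>"
        using exists_finite_rank_odd_approximation[OF q r \<delta> AW Ac An] by blast
      let ?P = "\<lambda>U. ae_class \<Omega> (p U)"
      have PW: "?P U \<in> W1_0 \<Omega> s" if "U \<in> A" "1 \<le> s" for U s
        using test_function_sob0[OF p(1)[OF that(1)] that(2)] W1_0_eq[OF that(2)] by simp
      have bP: "fun_norm \<Omega> q U - C * \<delta> \<le> fun_norm \<Omega> q (?P U)" if U: "U \<in> A" for U
      proof -
        have "\<bar>fun_norm \<Omega> q U - fun_norm \<Omega> q (?P U)\<bar> \<le> C * grad_norm \<Omega> q (minus_class \<Omega> U (?P U))"
          using U AW PW[OF U q1] by (intro C(2)) auto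
        also have "\<dots> \<le> C * \<delta>" using p(4)[OF U] C(1) by (intro mult_left_mono) auto
        finally show ?thesis by linarith
      qed
      have bpos: "0 < fun_norm \<Omega> q (?P U)" if U: "U \<in> A" for U
        using bP[OF U] U0(2)[OF U] \<delta>2 by (simp add: m_def)
      have "?P ` A \<in> Sigma_k \<Omega> k r"
      proof (rule Sigma_k_image[OF A q p(2)])
        show "?P ` A \<subseteq> W1_0 \<Omega> r - {zero_class \<Omega>}"
          using PW[OF _ r1] bpos fun_norm_zero_class[OF q1] by fastforce
        show "?P (uminus_class \<Omega> U) = uminus_class \<Omega> (?P U)" if "U \<in> A" for U
          using p(3)[OF that] sob_measurable[OF test_function_sob(1)[OF p(1)[OF that] q1]]
          by (simp add: uminus_ae_class)
      qed
      moreover have "?P ` A \<subseteq> W1 \<Omega> q"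
        using PW[OF _ q1] by (auto simp: W1_0_def)
      ultimately have "lambda_k2 \<Omega> k q r \<le> (SUP V\<in>?P ` A. ereal (rayleigh \<Omega> q V))"
        unfolding lambda_k2_def by (intro INF_lower) simp
      also have "\<dots> \<le> ereal x"
      proof (rule SUP_least)
        fix V assume "V \<in> ?P ` A"
        then obtain U where U: "U \<in> A" and V: "V = ?P U" by blast
        have UW: "U \<in> W1_0 \<Omega> q" using U AW by blast
        define a where "a = grad_norm \<Omega> q U"
        define b where "b = fun_norm \<Omega> q U"
        have a0: "a \<ge> 0" by (simp add: a_def grad_norm_def L_norm_nonneg)
        have bm: "m \<le> b" using U0(2)[OF U] by (simp add: b_def m_def)
        have b0: "b > 0" using bm m by simp
        have "ereal (rayleigh \<Omega> q U) \<le> ereal t" using up[OF U] t by simp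
        then have "a powr q / b powr q \<le> t" by (simp add: rayleigh_def a_def b_def)
        then have "(a / b) powr q \<le> t" using a0 b0 by (simp add: powr_divide)
        then have "((a / b) powr q) powr (1 / q) \<le> \<rho>"
          unfolding \<rho>_def using q by (intro powr_mono2) auto
        then have "a / b \<le> \<rho>" using q a0 b0 by (simp add: powr_powr)
        then have ab: "a \<le> \<rho> * b" using b0 by (simp add: pos_divide_le_eq)
        have "grad_norm \<Omega> q V \<le> a + \<delta>"
          using grad_norm_diff_le[OF q UW PW[OF U q1]] p(4)[OF U] by (simp add: V a_def)
        also have "\<dots> \<le> \<rho>' * (b - C * \<delta>)"
        proof -
          have "(\<rho>' - \<rho>) * m \<le> (\<rho>' - \<rho>) * b" using bm \<rho> by (intro mult_left_mono) auto
          then show ?thesis using ab \<delta>1 by (simp add: algebra_simps)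
        qed
        also have "\<dots> \<le> \<rho>' * fun_norm \<Omega> q V"
          using bP[OF U] \<rho> by (intro mult_left_mono) (auto simp: V b_def)
        finally have "grad_norm \<Omega> q V \<le> \<rho>' * fun_norm \<Omega> q V" .
        then have "grad_norm \<Omega> q V powr q \<le> (\<rho>' * fun_norm \<Omega> q V) powr q"
          using q by (intro powr_mono2) (auto simp: grad_norm_def L_norm_nonneg)
        also have "\<dots> = x * fun_norm \<Omega> q V powr q"
          using \<rho> \<rho>'q bpos[OF U] by (simp add: V powr_mult)
        finally have "rayleigh \<Omega> q V \<le> x"
          unfolding rayleigh_def using bpos[OF U] by (simp add: V pos_divide_le_eq)
        then show "ereal (rayleigh \<Omega> q V) \<le> ereal x" by simp
      qed
      finally show ?thesis by (simp add: x)
    qed simp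
  qed
qed

end

theorem lemmaA4:
  fixes \<Omega> :: "(real^'n) set" and q r :: real and k :: nat
  assumes "open \<Omega>" and "connected \<Omega>" and "\<Omega> \<noteq> {}" and "bounded \<Omega>"
    and "1 < q" and "q < r"
  shows "lambda_k \<Omega> k q = lambda_k2 \<Omega> k q r"
proof (rule antisym)
  interpret bounded_open_set \<Omega> by unfold_locales fact+
  have qr: "q \<le> r" using assms by simp
  show "lambda_k \<Omega> k q \<le> lambda_k2 \<Omega> k q r"
    by (rule lambda_k_le_lambda_k2[OF \<open>1 < q\<close> qr])
  show "lambda_k2 \<Omega> k q r \<le> lambda_k \<Omega> k q"
    unfolding lambda_k_def by (intro INF_greatest lambda_k2_le_SUP[OF \<open>1 < q\<close> qr])
qed

end
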